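(* Let $\varepsilon > 0$ be a constant and let $\Delta \ge 3$ be an integer. If $p = p(n) \in [0,1]$ satisfies $p \gg n^{-\frac{1}{\Delta-1}} \log^5 n$, then the random graph $\mathcal{G}(n,p)$ is asymptotically almost surely universal for the family $\mathcal{H}((1-\varepsilon)n, \Delta)$; that is, the probability that $\mathcal{G}(n,p)$ contains every member of $\mathcal{H}((1-\varepsilon)n,\Delta)$ as a (not necessarily induced) subgraph tends to $1$ as $n \to \infty$.
   Context: $\mathcal{G}(n,p)$ is the binomial random graph on a vertex set of size $n$ in which each pair of vertices is an edge independently with probability $p$. For $m > 0$, $\mathcal{H}(m,\Delta)$ is the family of all graphs on at most $m$ vertices with maximum degree at most $\Delta$. A graph $G$ is universal for a family $\mathcal{H}$ if it contains (an isomorphic copy of) every member of $\mathcal{H}$ as a subgraph, not necessarily induced. The notation $a \gg b$ means $b = o(a)$, i.e. $b(n)/a(n) \to 0$ as $n \to \infty$. Here $\log^5 n = (\log n)^5$. *)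

theory Defs
  imports "HOL-Probability.Probability" "HOL-Library.Landau_Symbols"
begin

type_synonym 'a ugraph = "'a set \<times> 'a set set"

definition vertices :: "'a ugraph \<Rightarrow> 'a set" where
  "vertices G = fst G"

definition edges :: "'a ugraph \<Rightarrow> 'a set set" where
  "edges G = snd G"

definition vertex_pairs :: "'a set \<Rightarrow> 'a set set" where
  "vertex_pairs V = {e. e \<subseteq> V \<and> card e = 2}"

definition finite_simple_graph :: "'a ugraph \<Rightarrow> bool" where
  "finite_simple_graph G \<longleftrightarrow> finite (vertices G) \<and> edges G \<subseteq> vertex_pairs (vertices G)"

definition vertex_degree :: "'a ugraph \<Rightarrow> 'a \<Rightarrow> nat" where
  "vertex_degree G v = card {e \<in> edges G. v \<in> e}"

text \<open>For the graph without vertices this is 0, the supremum of the empty set of naturals.\<close>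

definition max_degree :: "'a ugraph \<Rightarrow> nat" where
  "max_degree G = (SUP v \<in> vertices G. vertex_degree G v)"

definition is_subgraph :: "'a ugraph \<Rightarrow> 'a ugraph \<Rightarrow> bool" where
  "is_subgraph H G \<longleftrightarrow> vertices H \<subseteq> vertices G \<and> edges H \<subseteq> edges G"

definition graph_isomorphic :: "'a ugraph \<Rightarrow> 'b ugraph \<Rightarrow> bool" where
  "graph_isomorphic H G \<longleftrightarrow>
     (\<exists>f. bij_betw f (vertices H) (vertices G) \<and> edges G = (\<lambda>e. f ` e) ` edges H)"

definition contains_copy :: "'b ugraph \<Rightarrow> 'a ugraph \<Rightarrow> bool" where
  "contains_copy G H \<longleftrightarrow>
     (\<exists>G'. finite_simple_graph G' \<and> is_subgraph G' G \<and> graph_isomorphic H G')"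

definition universal_for :: "'b ugraph \<Rightarrow> 'a ugraph set \<Rightarrow> bool" where
  "universal_for G \<H> \<longleftrightarrow> (\<forall>H\<in>\<H>. contains_copy G H)"

text \<open>
  The vertices of the members are natural numbers; every finite graph is isomorphic to such a
  graph, and containment only depends on the isomorphism type.  The bound \<open>m\<close> is real, so that
  \<open>(1 - \<epsilon>) n\<close> needs no rounding.
\<close>

definition bounded_degree_graphs :: "real \<Rightarrow> nat \<Rightarrow> nat ugraph set" where
  "bounded_degree_graphs m \<Delta> =
     {H. finite_simple_graph H \<and> real (card (vertices H)) \<le> m \<and> max_degree H \<le> \<Delta>}"

definition binomial_random_graph :: "nat \<Rightarrow> real \<Rightarrow> nat ugraph pmf" where
  "binomial_random_graph n p =
     map_pmf (\<lambda>X. ({..<n}, {e \<in> vertex_pairs {..<n}. X e}))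
       (Pi_pmf (vertex_pairs {..<n}) False (\<lambda>_. bernoulli_pmf p))"

end

theory Submission
  imports Defs "HOL-Real_Asymp.Real_Asymp"
begin

text \<open>
  A graph \<open>H\<close> of maximum degree \<open>\<Delta>\<close> is cut into single vertices and short induced cycles, and the
  pieces are embedded in a polylogarithmic number of batches such that every embedded single vertex
  has at most \<open>\<Delta> - 1\<close> earlier neighbours and every cycle vertex at most \<open>\<Delta> - 2\<close>. Such an
  order exists because every vertex is at distance \<open>O(log n)\<close> from a vertex of degree less than
  \<open>\<Delta>\<close> or from a cycle of length \<open>O(log n)\<close>: vertices further away from these go first, and a
  maximal family of cycles at pairwise distance at least 3 goes last. Hence in all cases a set \<open>T\<close>
  of vertices of a piece must satisfy at most \<open>(\<Delta> - 1) |T|\<close> edge constraints, which matches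
  \<open>n p ^ (\<Delta> - 1)\<close> being a large power of \<open>log n\<close>.

  By Janson's inequality and a union bound over the images of the earlier neighbours (not over \<open>H\<close>),
  with high probability any \<open>m\<close> pieces of a batch, even with \<open>K m\<close> vertices of the host intervals
  forbidden, include one that has a copy. So a maximal disjoint family of copies misses only a
  \<open>1 / K\<close> fraction of a batch, and \<open>O(log n)\<close> rounds on small reserved intervals embed the rest.
\<close>

subsection \<open>Janson's inequality\<close>

text \<open>The obstacle is a vertex embedded after \<open>\<Delta>\<close> neighbours: for p close
  to the lower bound, \<open>\<Delta>\<close> host vertices have about n p ^ \<Delta> common
  neighbours, far less than 1. In a \<open>\<Delta>\<close>-regular component every vertex-by-vertex
  order ends with such a vertex. A cycle embedded as a whole spends one inner edge and at most
  \<open>\<Delta> - 2\<close> outer edges per vertex, which is just affordable.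

  The powers of log n come from three demands. The batches have total piece length O(log^2 n), and
  each position needs a reserve in O(log n) rounds, so a reserve has about n / log^3 n vertices and
  K is about log^3 n. Describing m pieces and their hosts takes about m L K log n = m log^5 n units
  of entropy, where L = O(log n) bounds the piece length, so c = log^6 n in the failure probability
  exp (- m c / 2) is enough. Janson's inequality then asks for b p ^ (\<Delta> - 1) of order L c =
  log^7 n, that is, for n p ^ (\<Delta> - 1) of order log^10 n. The hypothesis provides log n to the
  power 5 (\<Delta> - 1), which is exactly 10 for \<open>\<Delta>\<close> = 3.\<close>

abbreviation bits :: "'e set \<Rightarrow> real \<Rightarrow> ('e \<Rightarrow> bool) pmf" where
  "bits E p \<equiv> Pi_pmf E False (\<lambda>_. bernoulli_pmf p)"

lemma prob_bits_coordinate: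
  fixes p :: real
  assumes "finite E" "e \<in> E" "0 \<le> p" "p \<le> 1"
  shows "measure_pmf.prob (bits E p) {X. X e \<and> D X}
       = p * measure_pmf.prob (bits E p) {X. D (X(e := True))}"
proof -
  define N where "N = bits (E - {e}) p"
  have M: "bits E p = bernoulli_pmf p \<bind> (\<lambda>b. map_pmf (\<lambda>f. f(e := b)) N)"
    using Pi_pmf_insert'[of "E - {e}" e False "\<lambda>_. bernoulli_pmf p"] assms
    by (simp add: N_def insert_absorb map_pmf_def)
  have *: "measure_pmf.prob (bits E p) A
      = p * measure_pmf.prob N {f. f(e := True) \<in> A} + (1 - p) * measure_pmf.prob N {f. f(e := False) \<in> A}"
    for A
  proof -
    have "emeasure (bits E p) A = ennreal (p * measure_pmf.prob N {f. f(e := True) \<in> A}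
        + (1 - p) * measure_pmf.prob N {f. f(e := False) \<in> A})"
      unfolding M emeasure_bind_pmf using assms
      by (simp add: nn_integral_bernoulli_pmf)
        (simp add: measure_pmf.emeasure_eq_measure vimage_def ennreal_mult'' mult.commute)
    then show ?thesis
      using assms by (simp add: measure_pmf.emeasure_eq_measure flip: ennreal_plus)
  qed
  show ?thesis unfolding * by (simp add: algebra_simps)
qed

text \<open>Given that all bits of \<open>F\<close> are set, the other bits are still independent,
  so the condition amounts to forcing these bits to 1. This reduces the correlation inequality in
  Janson's proof to the fact that setting more bits cannot help an event of the form "no
  \<open>A k\<close> occurs".\<close>

lemma prob_bits_all:
  fixes p :: real
  assumes "finite E" "F \<subseteq> E" "0 \<le> p" "p \<le> 1"
  shows "measure_pmf.prob (bits E p) {X. (\<forall>e\<in>F. X e) \<and> C X}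
       = p ^ card F * measure_pmf.prob (bits E p) {X. C (\<lambda>e. e \<in> F \<or> X e)}"
proof -
  have "finite F" using assms finite_subset by blast
  then show ?thesis using assms(2)
  proof (induction F arbitrary: C)
    case (insert e F)
    have "{X. (\<forall>f\<in>insert e F. X f) \<and> C X} = {X. X e \<and> ((\<forall>f\<in>F. X f) \<and> C X)}" by auto
    also have "measure_pmf.prob (bits E p) \<dots>
        = p * measure_pmf.prob (bits E p) {X. (\<forall>f\<in>F. (X(e := True)) f) \<and> C (X(e := True))}"
      using insert assms by (subst prob_bits_coordinate) auto
    also have "{X. (\<forall>f\<in>F. (X(e := True)) f) \<and> C (X(e := True))}
        = {X. (\<forall>f\<in>F. X f) \<and> C (X(e := True))}"
      using insert by auto
    also have "measure_pmf.prob (bits E p) \<dots>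
        = p ^ card F * measure_pmf.prob (bits E p) {X. C ((\<lambda>f. f \<in> F \<or> X f)(e := True))}"
      using insert by simp
    also have "(\<lambda>X. (\<lambda>f. f \<in> F \<or> X f)(e := True)) = (\<lambda>X f. f \<in> insert e F \<or> X f)"
      by (auto simp: fun_eq_iff)
    then have "{X. C ((\<lambda>f. f \<in> F \<or> X f)(e := True))} = {X. C (\<lambda>f. f \<in> insert e F \<or> X f)}"
      by metis
    finally show ?case using insert by simp
  qed simp
qed

text \<open>Induction on the index set. The old indices are split into \<open>J\<close>, whose sets
  meet \<open>A i\<close>, and \<open>K\<close>, whose sets do not. Relative to the event that
  nothing in \<open>K\<close> occurs, \<open>A i\<close> keeps its probability by independence, and
  each \<open>j\<close> in \<open>J\<close> takes away at most
  \<open>p ^ card (A i \<union> A j)\<close>, since forcing bits only makes that event less likely.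
  So a new index costs a factor of at most 1 - d \<le> exp (- d).\<close>

lemma janson_delta:
  fixes p :: real
  assumes E: "finite E" and p: "0 \<le> p" "p \<le> 1"
    and I: "finite I" "\<And>i. i \<in> I \<Longrightarrow> A i \<subseteq> E"
  shows "measure_pmf.prob (bits E p) {X. \<forall>i\<in>I. \<not> (\<forall>e\<in>A i. X e)}
      \<le> exp (- (\<Sum>i\<in>I. p ^ card (A i))
          + (\<Sum>i\<in>I. \<Sum>j\<in>I. if i \<noteq> j \<and> A i \<inter> A j \<noteq> {} then p ^ card (A i \<union> A j) else 0) / 2)"
  using I
proof (induction I rule: finite_induct)
  case (insert i I)
  define P where "P = measure_pmf.prob (bits E p)"
  define none where "none = (\<lambda>K X. \<forall>k\<in>K. \<not> (\<forall>e\<in>A k. X e))"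
  define c where "c = (\<lambda>i j. if i \<noteq> j \<and> A i \<inter> A j \<noteq> {} then p ^ card (A i \<union> A j) else 0)"
  define J where "J = {j\<in>I. A i \<inter> A j \<noteq> {}}"
  define K where "K = I - J"
  define d where "d = p ^ card (A i) - (\<Sum>j\<in>I. c i j)"
  have fin: "finite I" "finite J" using insert by (auto simp: J_def)
  have sumJ: "(\<Sum>j\<in>I. c i j) = (\<Sum>j\<in>J. p ^ card (A i \<union> A j))"
    using insert unfolding J_def c_def by (subst sum.inter_filter) (auto intro!: sum.cong)
  have Pmono: "A' \<subseteq> B' \<Longrightarrow> P A' \<le> P B'" for A' B'
    unfolding P_def by (intro measure_pmf.finite_measure_mono) auto
  have P0: "P A' \<ge> 0" for A' by (simp add: P_def)
  have split: "P {X. none (insert i I) X} = P {X. none I X} - P {X. (\<forall>e\<in>A i. X e) \<and> none I X}"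
  proof -
    have "{X. none I X} = {X. none (insert i I) X} \<union> {X. (\<forall>e\<in>A i. X e) \<and> none I X}"
      by (auto simp: none_def)
    moreover have "{X. none (insert i I) X} \<inter> {X. (\<forall>e\<in>A i. X e) \<and> none I X} = {}"
      by (auto simp: none_def)
    ultimately have "P {X. none I X} = P {X. none (insert i I) X} + P {X. (\<forall>e\<in>A i. X e) \<and> none I X}"
      unfolding P_def by (simp add: measure_pmf.finite_measure_Union)
    then show ?thesis by simp
  qed
  have i1: "P {X. (\<forall>e\<in>A i. X e) \<and> none K X} = p ^ card (A i) * P {X. none K X}"
  proof -
    have "none K (\<lambda>e. e \<in> A i \<or> X e) \<longleftrightarrow> none K X" for X
      unfolding none_def K_def J_def by blast
    then show ?thesis
      unfolding P_def using insert E p by (subst prob_bits_all) auto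
  qed
  have i2: "P {X. (\<forall>e\<in>A i \<union> A j. X e) \<and> none K X} \<le> p ^ card (A i \<union> A j) * P {X. none K X}"
    if "j \<in> J" for j
  proof -
    have "P {X. (\<forall>e\<in>A i \<union> A j. X e) \<and> none K X}
        = p ^ card (A i \<union> A j) * P {X. none K (\<lambda>e. e \<in> A i \<union> A j \<or> X e)}"
      unfolding P_def using insert that E p by (subst prob_bits_all) (auto simp: J_def)
    also have "\<dots> \<le> p ^ card (A i \<union> A j) * P {X. none K X}"
      using p by (intro mult_left_mono Pmono) (auto simp: none_def)
    finally show ?thesis .
  qed
  have i3: "P {X. (\<forall>e\<in>A i. X e) \<and> none K X} \<le> P {X. (\<forall>e\<in>A i. X e) \<and> none I X}
      + (\<Sum>j\<in>J. P {X. (\<forall>e\<in>A i \<union> A j. X e) \<and> none K X})"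
  proof -
    have "{X. (\<forall>e\<in>A i. X e) \<and> none K X} \<subseteq> {X. (\<forall>e\<in>A i. X e) \<and> none I X}
        \<union> (\<Union>j\<in>J. {X. (\<forall>e\<in>A i \<union> A j. X e) \<and> none K X})"
      unfolding none_def K_def by blast
    then have "P {X. (\<forall>e\<in>A i. X e) \<and> none K X} \<le> P ({X. (\<forall>e\<in>A i. X e) \<and> none I X}
        \<union> (\<Union>j\<in>J. {X. (\<forall>e\<in>A i \<union> A j. X e) \<and> none K X}))"
      by (rule Pmono)
    also have "\<dots> \<le> P {X. (\<forall>e\<in>A i. X e) \<and> none I X}
        + P (\<Union>j\<in>J. {X. (\<forall>e\<in>A i \<union> A j. X e) \<and> none K X})"
      unfolding P_def by (intro measure_Un_le) auto
    also have "P (\<Union>j\<in>J. {X. (\<forall>e\<in>A i \<union> A j. X e) \<and> none K X})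
        \<le> (\<Sum>j\<in>J. P {X. (\<forall>e\<in>A i \<union> A j. X e) \<and> none K X})"
      unfolding P_def using fin by (intro measure_UNION_le) auto
    finally show ?thesis by simp
  qed
  have i4: "P {X. none K X} * d \<le> P {X. (\<forall>e\<in>A i. X e) \<and> none I X}"
  proof -
    have "(\<Sum>j\<in>J. P {X. (\<forall>e\<in>A i \<union> A j. X e) \<and> none K X})
        \<le> (\<Sum>j\<in>J. p ^ card (A i \<union> A j) * P {X. none K X})"
      by (intro sum_mono i2)
    also have "\<dots> = P {X. none K X} * (\<Sum>j\<in>J. p ^ card (A i \<union> A j))"
      by (simp add: sum_distrib_left mult.commute)
    finally show ?thesis
      using i3 unfolding i1 d_def sumJ right_diff_distrib by (simp add: mult.commute)
  qed
  have i5: "P {X. none I X} * d \<le> P {X. (\<forall>e\<in>A i. X e) \<and> none I X}"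
  proof (cases "d \<ge> 0")
    case True
    have "P {X. none I X} \<le> P {X. none K X}"
      by (intro Pmono) (auto simp: none_def K_def)
    then have "P {X. none I X} * d \<le> P {X. none K X} * d"
      using True by (intro mult_right_mono)
    then show ?thesis using i4 by simp
  next
    case False
    then have "P {X. none I X} * d \<le> 0" using P0 by (simp add: mult_nonneg_nonpos)
    then show ?thesis using P0[of "{X. (\<forall>e\<in>A i. X e) \<and> none I X}"] by linarith
  qed
  have "P {X. none (insert i I) X} \<le> P {X. none I X} * (1 - d)"
    using i5 unfolding split by (simp add: algebra_simps)
  also have "\<dots> \<le> P {X. none I X} * exp (- d)"
    using exp_ge_add_one_self[of "-d"] by (intro mult_left_mono P0) simp
  also have "\<dots> \<le> exp (- (\<Sum>i\<in>I. p ^ card (A i)) + (\<Sum>i\<in>I. \<Sum>j\<in>I. c i j) / 2) * exp (- d)"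
    unfolding P_def none_def c_def using insert by (intro mult_right_mono insert.IH) auto
  also have "\<dots> = exp (- (\<Sum>i\<in>insert i I. p ^ card (A i))
      + (\<Sum>k\<in>insert i I. \<Sum>j\<in>insert i I. c k j) / 2)"
  proof -
    have sym: "c k j = c j k" for k j by (auto simp: c_def Int_commute Un_commute)
    have c0: "c i i = 0" by (simp add: c_def)
    have "(\<Sum>k\<in>insert i I. \<Sum>j\<in>insert i I. c k j)
        = (\<Sum>j\<in>I. c i j) + (\<Sum>k\<in>I. c k i + (\<Sum>j\<in>I. c k j))"
      using insert c0 by simp
    also have "\<dots> = 2 * (\<Sum>j\<in>I. c i j) + (\<Sum>k\<in>I. \<Sum>j\<in>I. c k j)"
      using sym[of _ i] by (simp add: sum.distrib)
    finally show ?thesis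
      using insert by (simp add: d_def field_simps flip: exp_add)
  qed
  finally show ?case unfolding P_def none_def c_def .
qed simp

text \<open>If each \<open>i\<close> is kept independently with probability \<open>q i\<close>, the
  left side is the expectation of the right side. The proof does this one coordinate at a time:
  because of \<open>c i i = 0\<close> the expression is affine in each \<open>q i\<close>
  separately, so one of the values 0 and 1 does not decrease it.\<close>

lemma multilinear_rounding:
  fixes q a :: "'i \<Rightarrow> real" and c :: "'i \<Rightarrow> 'i \<Rightarrow> real"
  assumes I: "finite I" and q: "\<And>i. i \<in> I \<Longrightarrow> 0 \<le> q i \<and> q i \<le> 1" and c: "\<And>i. i \<in> I \<Longrightarrow> c i i = 0"
  shows "\<exists>J\<subseteq>I. (\<Sum>i\<in>I. q i * a i) - (\<Sum>i\<in>I. \<Sum>j\<in>I. q i * q j * c i j) / 2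
            \<le> (\<Sum>i\<in>J. a i) - (\<Sum>i\<in>J. \<Sum>j\<in>J. c i j) / 2"
proof -
  define F where "F = (\<lambda>q. (\<Sum>i\<in>I. q i * a i) - (\<Sum>i\<in>I. \<Sum>j\<in>I. q i * q j * c i j) / 2)"
  have affine: "F (q(s := t)) = F (q(s := 0)) + t * (F (q(s := 1)) - F (q(s := 0)))"
    if "s \<in> I" for q s and t :: real
  proof -
    have 1: "(\<Sum>i\<in>I. (q(s := t)) i * a i) = (\<Sum>i\<in>I. (q(s := 0)) i * a i)
        + t * ((\<Sum>i\<in>I. (q(s := 1)) i * a i) - (\<Sum>i\<in>I. (q(s := 0)) i * a i))"
      unfolding sum_subtractf[symmetric] sum_distrib_left sum.distrib[symmetric]
      by (intro sum.cong) (auto simp: algebra_simps)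
    have 2: "(\<Sum>i\<in>I. \<Sum>j\<in>I. (q(s := t)) i * (q(s := t)) j * c i j)
       = (\<Sum>i\<in>I. \<Sum>j\<in>I. (q(s := 0)) i * (q(s := 0)) j * c i j)
        + t * ((\<Sum>i\<in>I. \<Sum>j\<in>I. (q(s := 1)) i * (q(s := 1)) j * c i j)
             - (\<Sum>i\<in>I. \<Sum>j\<in>I. (q(s := 0)) i * (q(s := 0)) j * c i j))"
      unfolding sum_subtractf[symmetric] sum_distrib_left sum.distrib[symmetric]
      using c[OF that] by (intro sum.cong) (auto simp: algebra_simps)
    have lin: "(A0 + t * (A1 - A0)) - (B0 + t * (B1 - B0)) / 2
        = (A0 - B0 / 2) + t * ((A1 - B1 / 2) - (A0 - B0 / 2))" for A0 A1 B0 B1 :: real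
      by (simp add: field_simps)
    show ?thesis unfolding F_def 1 2 by (rule lin)
  qed
  have "\<exists>q'. (\<forall>i\<in>I. 0 \<le> q' i \<and> q' i \<le> 1) \<and> (\<forall>i\<in>S. q' i = 0 \<or> q' i = 1) \<and> F q \<le> F q'"
    if "finite S" "S \<subseteq> I" for S
    using that
  proof (induction S rule: finite_induct)
    case empty
    show ?case using q by (intro exI[of _ q]) auto
  next
    case (insert s S)
    then obtain q' where q': "\<forall>i\<in>I. 0 \<le> q' i \<and> q' i \<le> 1" "\<forall>i\<in>S. q' i = 0 \<or> q' i = 1" "F q \<le> F q'"
      by auto
    have s: "0 \<le> q' s" "q' s \<le> 1" using q' insert by auto
    have eq: "F q' = F (q'(s := 0)) + q' s * (F (q'(s := 1)) - F (q'(s := 0)))"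
      using affine[of s q' "q' s"] insert by simp
    have "F q' \<le> F (q'(s := 0)) \<or> F q' \<le> F (q'(s := 1))"
    proof (cases "F (q'(s := 1)) \<ge> F (q'(s := 0))")
      case True
      then have "q' s * (F (q'(s := 1)) - F (q'(s := 0))) \<le> 1 * (F (q'(s := 1)) - F (q'(s := 0)))"
        using s by (intro mult_right_mono) auto
      then show ?thesis using eq by simp
    next
      case False
      then have "q' s * (F (q'(s := 1)) - F (q'(s := 0))) \<le> 0"
        using s by (simp add: mult_nonneg_nonpos)
      then show ?thesis using eq by simp
    qed
    then obtain t :: real where t: "t = 0 \<or> t = 1" "F q' \<le> F (q'(s := t))" by auto
    moreover have "F q \<le> F (q'(s := t))" using t q' by linarith
    moreover have "\<forall>i\<in>I. 0 \<le> (q'(s := t)) i \<and> (q'(s := t)) i \<le> 1"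
      "\<forall>i\<in>insert s S. (q'(s := t)) i = 0 \<or> (q'(s := t)) i = 1"
      using q' t by auto
    ultimately show ?case by blast
  qed
  from this[OF I order_refl] obtain q' where
    q': "\<forall>i\<in>I. q' i = 0 \<or> q' i = 1" "F q \<le> F q'" by blast
  define J where "J = {i\<in>I. q' i = 1}"
  have "J \<subseteq> I" by (auto simp: J_def)
  moreover have "(\<Sum>i\<in>I. q' i * a i) = (\<Sum>i\<in>J. a i)"
    unfolding J_def using I q' by (subst sum.inter_filter) (auto intro!: sum.cong)
  moreover have "(\<Sum>i\<in>I. \<Sum>j\<in>I. q' i * q' j * c i j) = (\<Sum>i\<in>J. \<Sum>j\<in>J. c i j)"
  proof -
    have "(\<Sum>j\<in>I. q' i * q' j * c i j) = (if q' i = 1 then \<Sum>j\<in>J. c i j else 0)" if "i \<in> I" for i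
      unfolding J_def using I q' that by (subst sum.inter_filter) (auto intro!: sum.cong)
    then show ?thesis
      unfolding J_def using I q' by (subst sum.inter_filter) (auto intro!: sum.cong)
  qed
  ultimately show ?thesis using q'(2) unfolding F_def by auto
qed

text \<open>The weights turn the bound \<open>exp (- \<mu> + \<Delta> / 2)\<close> into Janson's bound for \<open>\<Delta> > \<mu>\<close>.\<close>

lemma janson_weighted:
  fixes p :: real and q :: "'i \<Rightarrow> real"
  assumes "finite E" "0 \<le> p" "p \<le> 1" "finite I" "\<And>i. i \<in> I \<Longrightarrow> A i \<subseteq> E"
    and q: "\<And>i. i \<in> I \<Longrightarrow> 0 \<le> q i \<and> q i \<le> 1"
  shows "measure_pmf.prob (bits E p) {X. \<forall>i\<in>I. \<not> (\<forall>e\<in>A i. X e)}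
      \<le> exp (- (\<Sum>i\<in>I. q i * p ^ card (A i))
          + (\<Sum>i\<in>I. \<Sum>j\<in>I. if i \<noteq> j \<and> A i \<inter> A j \<noteq> {} then q i * q j * p ^ card (A i \<union> A j) else 0) / 2)"
proof -
  define c where "c = (\<lambda>i j. if i \<noteq> j \<and> A i \<inter> A j \<noteq> {} then p ^ card (A i \<union> A j) else 0)"
  obtain J where J: "J \<subseteq> I" and le:
    "(\<Sum>i\<in>I. q i * p ^ card (A i)) - (\<Sum>i\<in>I. \<Sum>j\<in>I. q i * q j * c i j) / 2
            \<le> (\<Sum>i\<in>J. p ^ card (A i)) - (\<Sum>i\<in>J. \<Sum>j\<in>J. c i j) / 2"
    using multilinear_rounding[of I q c "\<lambda>i. p ^ card (A i)"] assms(4) q by (auto simp: c_def)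
  have "measure_pmf.prob (bits E p) {X. \<forall>i\<in>I. \<not> (\<forall>e\<in>A i. X e)}
      \<le> measure_pmf.prob (bits E p) {X. \<forall>i\<in>J. \<not> (\<forall>e\<in>A i. X e)}"
    using J by (intro measure_pmf.finite_measure_mono) auto
  also have "\<dots> \<le> exp (- (\<Sum>i\<in>J. p ^ card (A i)) + (\<Sum>i\<in>J. \<Sum>j\<in>J. c i j) / 2)"
    unfolding c_def using assms J by (intro janson_delta) (auto intro: finite_subset)
  also have "\<dots> \<le> exp (- (\<Sum>i\<in>I. q i * p ^ card (A i)) + (\<Sum>i\<in>I. \<Sum>j\<in>I. q i * q j * c i j) / 2)"
    using le by simp
  also have "(\<Sum>i\<in>I. \<Sum>j\<in>I. q i * q j * c i j)
     = (\<Sum>i\<in>I. \<Sum>j\<in>I. if i \<noteq> j \<and> A i \<inter> A j \<noteq> {} then q i * q j * p ^ card (A i \<union> A j) else 0)"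
    unfolding c_def by (intro sum.cong) auto
  finally show ?thesis .
qed

subsection \<open>Copies of pieces in the random graph\<close>

definition agree :: "nat \<Rightarrow> (nat \<Rightarrow> 'a) \<Rightarrow> (nat \<Rightarrow> 'a) \<Rightarrow> nat set" where
  "agree l x y = {i. i < l \<and> x i = y i}"

text \<open>Copies in disjoint hosts can share a vertex only at equal indices, so
  \<open>agree\<close> describes their overlap. The weighted sum is a product over the coordinates:
  an index of \<open>Q\<close> contributes the factor \<open>h\<close>, any other index at most
  \<open>b + h\<close>, one value agreeing with weight \<open>h\<close> and the rest having weight
  1.\<close>

lemma sum_agree_le:
  fixes h :: real
  assumes B: "\<And>i. i < l \<Longrightarrow> finite (B i) \<and> card (B i) = b" and x: "x \<in> PiE {..<l} B"
    and Q: "Q \<subseteq> {..<l}" and h: "0 \<le> h" and b: "0 < b"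
  shows "(\<Sum>y\<in>PiE {..<l} B. if Q \<subseteq> agree l x y then h ^ card (agree l x y) else 0)
      \<le> real b ^ l * (h / b) ^ card Q * (1 + h / b) ^ l"
proof -
  define f where "f = (\<lambda>i y. if y = x i then h else if i \<in> Q then 0 else 1)"
  have pt: "(if Q \<subseteq> agree l x y then h ^ card (agree l x y) else 0) = (\<Prod>i<l. f i (y i))"
    if "y \<in> PiE {..<l} B" for y
  proof (cases "Q \<subseteq> agree l x y")
    case True
    have "(\<Prod>i<l. f i (y i)) = (\<Prod>i<l. if i \<in> agree l x y then h else 1)"
      using True by (intro prod.cong) (auto simp: f_def agree_def)
    also have "\<dots> = (\<Prod>i\<in>{..<l} \<inter> agree l x y. h)"
      by (subst prod.inter_restrict) auto
    also have "{..<l} \<inter> agree l x y = agree l x y" by (auto simp: agree_def)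
    finally show ?thesis using True by simp
  next
    case False
    then obtain i where "i \<in> Q" "i < l" "x i \<noteq> y i" using Q by (auto simp: agree_def)
    then have "(\<Prod>i<l. f i (y i)) = 0"
      by (intro prod_zero) (auto simp: f_def intro!: bexI[of _ i])
    then show ?thesis using False by simp
  qed
  have row: "(\<Sum>y\<in>B i. f i y) \<le> (if i \<in> Q then h else 1) * (if i \<in> Q then 1 else b + h)" if "i < l" for i
  proof -
    have xi: "x i \<in> B i" using x that by auto
    have "(\<Sum>y\<in>B i. f i y) = f i (x i) + (\<Sum>y\<in>B i - {x i}. f i y)"
      using B[OF that] xi by (simp add: sum.remove)
    also have "(\<Sum>y\<in>B i - {x i}. f i y) = (\<Sum>y\<in>B i - {x i}. if i \<in> Q then 0 else 1)"
      by (intro sum.cong) (auto simp: f_def)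
    also have "f i (x i) = h" by (simp add: f_def)
    finally have "(\<Sum>y\<in>B i. f i y) = h + (\<Sum>y\<in>B i - {x i}. if i \<in> Q then 0 else 1)" .
    moreover have "(\<Sum>y\<in>B i - {x i}. if i \<in> Q then 0 else 1) \<le> (if i \<in> Q then 0 else real b)"
      using B[OF that] xi by simp
    ultimately show ?thesis by (cases "i \<in> Q") auto
  qed
  have "(\<Sum>y\<in>PiE {..<l} B. if Q \<subseteq> agree l x y then h ^ card (agree l x y) else 0)
      = (\<Sum>y\<in>PiE {..<l} B. \<Prod>i<l. f i (y i))"
    by (intro sum.cong pt refl)
  also have "\<dots> = (\<Prod>i<l. \<Sum>y\<in>B i. f i y)"
    using B by (subst prod_sum_PiE) auto
  also have "\<dots> \<le> (\<Prod>i<l. (if i \<in> Q then h else 1) * (if i \<in> Q then 1 else b + h))"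
    using h row by (intro prod_mono conjI sum_nonneg) (auto simp: f_def)
  also have "\<dots> = (\<Prod>i<l. real b * ((if i \<in> Q then h / b else 1) * (if i \<in> Q then 1 else 1 + h / b)))"
    using b by (intro prod.cong) (auto simp: field_simps)
  also have "\<dots> = real b ^ l * ((\<Prod>i<l. if i \<in> Q then h / b else 1) * (\<Prod>i<l. if i \<in> Q then 1 else 1 + h / b))"
    by (simp add: prod.distrib)
  also have "(\<Prod>i<l. if i \<in> Q then h / b else 1) = (h / b) ^ card Q"
    using Q by (subst prod.inter_restrict[symmetric]) (auto simp: Int_absorb1)
  also have "(\<Prod>i<l. if i \<in> Q then 1 else 1 + h / b) \<le> (\<Prod>i<l. 1 + h / b)"
    using h by (intro prod_mono) auto
  finally show ?thesis using h b by (simp add: mult_left_mono mult.assoc)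
qed

definition copy_edges :: "(nat \<times> nat) set \<Rightarrow> (nat \<times> 'a) set \<Rightarrow> (nat \<Rightarrow> 'a) \<Rightarrow> 'a set set" where
  "copy_edges P S x = (\<lambda>(a, c). {x a, x c}) ` P \<union> (\<lambda>(i, s). {x i, s}) ` S"

lemma copy_edges_iff:
  "e \<in> copy_edges P S x \<longleftrightarrow>
     (\<exists>a c. (a, c) \<in> P \<and> e = {x a, x c}) \<or> (\<exists>i s. (i, s) \<in> S \<and> e = {x i, s})"
  by (auto simp: copy_edges_def)

text \<open>A piece with vertices \<open>0, \<dots>, l - 1\<close>, inner edges \<open>P\<close> and, for each \<open>(i, s) \<in> S\<close>, an edge
  from \<open>i\<close> to the already embedded vertex \<open>s\<close>.\<close>

definition sparse_piece :: "nat \<Rightarrow> nat \<Rightarrow> (nat \<times> nat) set \<Rightarrow> (nat \<times> 'a) set \<Rightarrow> bool" where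
  "sparse_piece d l P S \<longleftrightarrow> P \<subseteq> {(a, c). a < c \<and> c < l} \<and> finite S \<and> fst ` S \<subseteq> {..<l} \<and>
     (\<forall>T\<subseteq>{..<l}. card {(a, c)\<in>P. a \<in> T \<and> c \<in> T} \<le> card T \<and>
        card {(a, c)\<in>P. a \<in> T \<and> c \<in> T} + card {(i, s)\<in>S. i \<in> T} \<le> d * card T)"

lemma sparse_pieceD:
  assumes "sparse_piece d l P S"
  shows "P \<subseteq> {(a, c). a < c \<and> c < l}" "finite P" "finite S" "fst ` S \<subseteq> {..<l}"
    "card P \<le> l" "card P + card S \<le> d * l"
proof -
  show P: "P \<subseteq> {(a, c). a < c \<and> c < l}" and "finite S" and S: "fst ` S \<subseteq> {..<l}"
    using assms by (auto simp: sparse_piece_def)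
  have "P \<subseteq> {..<l} \<times> {..<l}" using P by auto
  then show "finite P" by (rule finite_subset) auto
  have "i < l" if "(i, s) \<in> S" for i s
    using S that by force
  then have "{(a, c)\<in>P. a \<in> {..<l} \<and> c \<in> {..<l}} = P" "{(i, s)\<in>S. i \<in> {..<l}} = S"
    using P by auto
  moreover have "card {(a, c)\<in>P. a \<in> {..<l} \<and> c \<in> {..<l}} \<le> card {..<l} \<and>
      card {(a, c)\<in>P. a \<in> {..<l} \<and> c \<in> {..<l}} + card {(i, s)\<in>S. i \<in> {..<l}} \<le> d * card {..<l}"
    using assms unfolding sparse_piece_def by blast
  ultimately show "card P \<le> l" "card P + card S \<le> d * l"
    by simp_all
qed

lemma card_copy_edges_le:
  assumes "finite P" "finite S"
  shows "finite (copy_edges P S x)" "card (copy_edges P S x) \<le> card P + card S"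
proof -
  show "finite (copy_edges P S x)" using assms by (simp add: copy_edges_def)
  have "card (copy_edges P S x) \<le> card ((\<lambda>(a, c). {x a, x c}) ` P) + card ((\<lambda>(i, s). {x i, s}) ` S)"
    unfolding copy_edges_def by (rule card_Un_le)
  also have "\<dots> \<le> card P + card S"
    using assms by (intro add_mono card_image_le)
  finally show "card (copy_edges P S x) \<le> card P + card S" .
qed

text \<open>A common edge comes from the same pair in both copies: the hosts are disjoint, so a
  shared vertex fixes its index; attached vertices lie outside all hosts, so an inner edge is never
  an outer one; and \<open>a < c\<close> excludes a swap of the two ends.\<close>

lemma copy_edges_Int:
  assumes disj: "disjoint_family_on B {..<l}"
    and x: "x \<in> PiE {..<l} B" and y: "y \<in> PiE {..<l} B"
    and P: "P \<subseteq> {(a, c). a < c \<and> c < l}" and P': "P' \<subseteq> {(a, c). a < c \<and> c < l}"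
    and S: "fst ` S \<subseteq> {..<l}" "snd ` S \<inter> (\<Union>i<l. B i) = {}"
    and S': "fst ` S' \<subseteq> {..<l}" "snd ` S' \<inter> (\<Union>i<l. B i) = {}"
  defines "T \<equiv> agree l x y"
  shows "copy_edges P S x \<inter> copy_edges P' S' y
    \<subseteq> copy_edges {(a, c)\<in>P \<inter> P'. a \<in> T \<and> c \<in> T} {(i, s)\<in>S \<inter> S'. i \<in> T} x"
proof
  fix e assume e: "e \<in> copy_edges P S x \<inter> copy_edges P' S' y"
  have xB: "x i \<in> B i" "y i \<in> B i" if "i < l" for i using x y that by auto
  have inj: "i = k" if "x i = y k" "i < l" "k < l" for i k
    using disj xB[of i] xB[of k] that unfolding disjoint_family_on_def by (metis IntI empty_iff lessThan_iff)
  have sB: "s \<noteq> x k" "s \<noteq> y k" if "(i, s) \<in> S \<union> S'" "k < l" for i s k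
    using xB[OF that(2)] S S' that by force+
  from e consider
      (pp) a c a' c' where "(a, c) \<in> P" "(a', c') \<in> P'" "e = {x a, x c}" "e = {y a', y c'}"
    | (ps) a c i s where "(a, c) \<in> P" "(i, s) \<in> S'" "e = {x a, x c}" "e = {y i, s}"
    | (sp) a c i s where "(a, c) \<in> P'" "(i, s) \<in> S" "e = {y a, y c}" "e = {x i, s}"
    | (ss) i s i' s' where "(i, s) \<in> S" "(i', s') \<in> S'" "e = {x i, s}" "e = {y i', s'}"
    unfolding Int_iff copy_edges_iff by blast
  then show "e \<in> copy_edges {(a, c)\<in>P \<inter> P'. a \<in> T \<and> c \<in> T} {(i, s)\<in>S \<inter> S'. i \<in> T} x"
  proof cases
    case pp
    then have lt: "a < c" "c < l" "a' < c'" "c' < l" using P P' by auto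
    have "x a = y a' \<and> x c = y c' \<or> x a = y c' \<and> x c = y a'"
      using pp by (metis doubleton_eq_iff)
    then have "x a = y a' \<and> x c = y c' \<and> a = a' \<and> c = c'"
      using inj[of a a'] inj[of c c'] inj[of a c'] inj[of c a'] lt by linarith
    then show ?thesis using pp lt
      by (auto simp: copy_edges_def T_def agree_def intro!: rev_image_eqI[of "(a, c)"])
  next
    case ps
    then have lt: "a < c" "c < l" using P by auto
    have "s = x a \<or> s = x c" using ps by (metis doubleton_eq_iff)
    then show ?thesis using sB(1)[of i s a] sB(1)[of i s c] ps lt by auto
  next
    case sp
    then have lt: "a < c" "c < l" using P' by auto
    have "s = y a \<or> s = y c" using sp by (metis doubleton_eq_iff)
    then show ?thesis using sB(2)[of i s a] sB(2)[of i s c] sp lt by auto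
  next
    case ss
    then have lt: "i < l" "i' < l" using S S' by auto
    have "s' \<noteq> x i" "s \<noteq> y i'" using sB(1)[of i' s' i] sB(2)[of i s i'] ss lt by auto
    then have "x i = y i' \<and> s = s'" using ss by (metis doubleton_eq_iff)
    moreover then have "i = i'" using inj lt by auto
    ultimately show ?thesis using ss lt
      by (auto simp: copy_edges_def T_def agree_def intro!: rev_image_eqI[of "(i, s)"])
  qed
qed

lemma card_Collect_subsets_le: "card {Q. Q \<subseteq> {..<l} \<and> card Q = k} \<le> l ^ k"
proof -
  have "card {Q. Q \<subseteq> {..<l} \<and> card Q = k} = l choose k"
    using n_subsets[of "{..<l}" k] by simp
  also have "\<dots> \<le> l ^ k"
    by (cases "k \<le> l") (auto intro: binomial_le_pow simp: binomial_eq_0)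
  finally show ?thesis .
qed

lemma one_plus_power_le:
  fixes u :: real
  assumes "0 \<le> u" "real l * u \<le> 1"
  shows "(1 + u) ^ l \<le> 3"
proof -
  have "(1 + u) ^ l \<le> exp u ^ l"
    using assms by (intro power_mono) auto
  also have "\<dots> = exp (real l * u)" by (simp add: exp_of_nat_mult)
  also have "\<dots> \<le> exp 1" using assms by simp
  also have "\<dots> \<le> 3" using exp_le by simp
  finally show ?thesis .
qed

text \<open>Weighted Janson, with weights that give every piece the expected weighted number
  \<open>c\<close> of copies. Overlapping pairs then contribute at most m c. For two copies of one
  piece this follows from \<open>large\<close>: agreeing in t vertices raises the joint probability
  by at most \<open>(1 / p) ^ (d * t)\<close>, while only about one copy in \<open>b ^ t\<close>
  agrees at given positions. For different pieces it follows from \<open>small\<close>: their sets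
  \<open>S\<close> are disjoint, so they can share inner edges only.\<close>

lemma prob_no_copy:
  fixes p c :: real and n m l d b :: nat
  assumes p: "0 < p" "p \<le> 1" and c: "1 \<le> c" and l: "1 \<le> l" and d: "1 \<le> d"
    and B: "\<And>i. i < l \<Longrightarrow> B i \<subseteq> {..<n} \<and> card (B i) = b" and disj: "disjoint_family_on B {..<l}"
    and piece: "\<And>j. j < m \<Longrightarrow> sparse_piece d l (P j) (S j) \<and> snd ` S j \<subseteq> {..<n} - (\<Union>i<l. B i)"
    and S: "\<And>j k. j < m \<Longrightarrow> k < m \<Longrightarrow> j \<noteq> k \<Longrightarrow> S j \<inter> S k = {}"
    and large: "6 * l * c \<le> b * p ^ d"
    and small: "2 * c * m * (3 * (l\<^sup>2 / (b\<^sup>2 * p) + l ^ 3 / (b * p) ^ 3)) \<le> 1"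
  shows "measure_pmf.prob (bits (vertex_pairs {..<n}) p)
      {X. \<forall>j<m. \<forall>x\<in>PiE {..<l} B. \<not> (\<forall>e\<in>copy_edges (P j) (S j) x. X e)} \<le> exp (- (m * c / 2))"
proof -
  define \<B> where "\<B> = PiE {..<l} B"
  define I where "I = {..<m} \<times> \<B>"
  define A where "A = (\<lambda>(j, x). copy_edges (P j) (S j) x)"
  \<comment> \<open>Each of the \<open>b ^ l\<close> copies of a piece gets weighted probability
    \<open>c / b ^ l\<close>, whatever its number of edges.\<close>
  define q where "q = (\<lambda>i. c / (b ^ l * p ^ card (A i)))"
  define N where "N = real b ^ l"
  define Y where "Y = b * p ^ d"
  have Y: "6 * l * c \<le> Y" using large by (simp add: Y_def)
  have "1 * 1 \<le> real l * c" using l c by (intro mult_mono) auto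
  moreover have "real l * 1 \<le> real l * c" using l c by (intro mult_left_mono) auto
  moreover have "1 * c \<le> real l * c" using l c by (intro mult_right_mono) auto
  ultimately have Y1: "1 \<le> Y" "c \<le> Y" "real l \<le> Y" using Y by linarith+
  have b: "0 < b"
  proof (rule ccontr)
    assume "\<not> 0 < b"
    then have "Y = 0" by (simp add: Y_def)
    then show False using Y1(1) by simp
  qed
  have finB: "finite (B i)" if "i < l" for i
    using B[OF that] by (intro finite_subset[of "B i" "{..<n}"]) auto
  have fin\<B>: "finite \<B>" unfolding \<B>_def using finB by (intro finite_PiE) auto
  have "card \<B> = b ^ l" unfolding \<B>_def using B by (subst card_PiE) auto
  then have card\<B>: "real (card \<B>) = N" by (simp add: N_def)
  have N: "0 < N" using b by (simp add: N_def)
  have finI: "finite I" using fin\<B> by (simp add: I_def)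
  have pieceD: "P j \<subseteq> {(a, c). a < c \<and> c < l}" "finite (P j)" "finite (S j)" "fst ` S j \<subseteq> {..<l}"
      "card (P j) + card (S j) \<le> d * l" "snd ` S j \<inter> (\<Union>i<l. B i) = {}" if "j < m" for j
    using piece[OF that] sparse_pieceD[of d l "P j" "S j"] by auto
  have finA: "finite (A i)" and cardA: "card (A i) \<le> d * l" if "i \<in> I" for i
    using that card_copy_edges_le[of "P (fst i)" "S (fst i)" "snd i"] pieceD[of "fst i"]
    by (auto simp: A_def I_def)
  have AE: "A i \<subseteq> vertex_pairs {..<n}" if iI: "i \<in> I" for i
  proof
    fix e assume e: "e \<in> A i"
    obtain j x where i: "i = (j, x)" "j < m" "x \<in> \<B>" using iI by (auto simp: I_def)
    have xB: "x k \<in> B k" if "k < l" for k using i that by (auto simp: \<B>_def)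
    from e consider a c where "(a, c) \<in> P j" "e = {x a, x c}" | k s where "(k, s) \<in> S j" "e = {x k, s}"
      unfolding A_def i copy_edges_iff split by blast
    then show "e \<in> vertex_pairs {..<n}"
    proof cases
      case (1 a c)
      then have lt: "a < c" "c < l" "a < l" using pieceD[OF i(2)] by force+
      then have "x a \<noteq> x c"
        using xB[of a] xB[of c] disj unfolding disjoint_family_on_def
        by (metis IntI empty_iff lessThan_iff less_irrefl)
      then show ?thesis using xB[of a] xB[of c] B[of a] B[of c] lt 1 by (auto simp: vertex_pairs_def)
    next
      case (2 k s)
      then have "k \<in> fst ` S j" "s \<in> snd ` S j" by force+
      then have k: "k < l" and s: "s \<in> {..<n} - (\<Union>i<l. B i)"
        using pieceD(4)[OF i(2)] piece[OF i(2)] by blast+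
      then have "x k \<noteq> s" using xB[of k] by auto
      then show ?thesis using xB[of k] B[of k] k s 2 by (auto simp: vertex_pairs_def)
    qed
  qed
  have q01: "0 \<le> q i \<and> q i \<le> 1" if "i \<in> I" for i
  proof -
    have "c \<le> Y" by (rule Y1)
    also have "Y \<le> Y ^ l" using Y1 l by (simp add: self_le_power)
    also have "Y ^ l = N * p ^ (d * l)" by (simp add: Y_def N_def power_mult_distrib power_mult)
    also have "\<dots> \<le> N * p ^ card (A i)"
      using N p cardA[OF that] by (intro mult_left_mono power_decreasing) auto
    finally show ?thesis using c N p by (simp add: q_def N_def divide_simps)
  qed
  \<comment> \<open>After weighting, only the number of shared edges matters.\<close>
  have w: "q i * q k * p ^ card (A i \<union> A k) = (c / N)\<^sup>2 * (1 / p) ^ card (A i \<inter> A k)"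
    if "i \<in> I" "k \<in> I" for i k
  proof -
    have "p ^ card (A i \<union> A k) * p ^ card (A i \<inter> A k) = p ^ card (A i) * p ^ card (A k)"
      using card_Un_Int[OF finA[OF that(1)] finA[OF that(2)]] by (simp flip: power_add)
    then show ?thesis using p b by (simp add: q_def N_def field_simps power2_eq_square)
  qed
  have Int_le: "card (A (j, x) \<inter> A (k, y)) \<le> card {(a, c)\<in>P j. a \<in> agree l x y \<and> c \<in> agree l x y}
      + card {(i, s)\<in>S j \<inter> S k. i \<in> agree l x y}"
    if "j < m" "k < m" "x \<in> \<B>" "y \<in> \<B>" for j k x y
  proof -
    let ?T = "agree l x y"
    let ?P = "{(a, c)\<in>P j. a \<in> ?T \<and> c \<in> ?T}" and ?S = "{(i, s)\<in>S j \<inter> S k. i \<in> ?T}"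
    have f: "finite ?P" "finite ?S"
      using pieceD[OF that(1)] by (auto elim: rev_finite_subset)
    have "A (j, x) \<inter> A (k, y) \<subseteq> copy_edges {(a, c)\<in>P j \<inter> P k. a \<in> ?T \<and> c \<in> ?T} ?S x"
      unfolding A_def split using that pieceD[OF that(1)] pieceD[OF that(2)]
      by (intro copy_edges_Int[OF disj]) (auto simp: \<B>_def)
    also have "\<dots> \<subseteq> copy_edges ?P ?S x" by (auto simp: copy_edges_def)
    finally show ?thesis
      using card_copy_edges_le[OF f, of x] by (meson card_mono order_trans)
  qed
  \<comment> \<open>Each agreeing vertex accounts for at most \<open>d\<close> shared edges, hence
    for a factor \<open>h = (1 / p) ^ d\<close>. Overlaps in a single vertex dominate: there are
    \<open>l\<close> positions, each with relative weight about 1 / Y.\<close>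
  have same: "(\<Sum>y\<in>\<B>. if (j, x) \<noteq> (j, y) \<and> A (j, x) \<inter> A (j, y) \<noteq> {} then (1 / p) ^ card (A (j, x) \<inter> A (j, y)) else 0)
      \<le> N / (2 * c)" if "j < m" "x \<in> \<B>" for j x
  proof -
    define h where "h = (1 / p) ^ d"
    have h: "0 \<le> h" using p by (simp add: h_def)
    have hb: "h / b = 1 / Y" using p b by (simp add: h_def Y_def field_simps)
    have n1: "0 \<le> (\<Sum>i<l. if {i} \<subseteq> agree l x y then h ^ card (agree l x y) else 0)" for y
      using h by (intro sum_nonneg) simp
    have pt: "(if (j, x) \<noteq> (j, y) \<and> A (j, x) \<inter> A (j, y) \<noteq> {} then (1 / p) ^ card (A (j, x) \<inter> A (j, y)) else 0)
       \<le> (\<Sum>i<l. if {i} \<subseteq> agree l x y then h ^ card (agree l x y) else 0)" if y: "y \<in> \<B>" for y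
    proof (cases "A (j, x) \<inter> A (j, y) = {}")
      case False
      let ?T = "agree l x y"
      have T: "?T \<subseteq> {..<l}" by (auto simp: agree_def)
      have "card (A (j, x) \<inter> A (j, y)) \<le> card {(a, c)\<in>P j. a \<in> ?T \<and> c \<in> ?T} + card {(i, s)\<in>S j. i \<in> ?T}"
        using Int_le[OF \<open>j < m\<close> \<open>j < m\<close> \<open>x \<in> \<B>\<close> y] by simp
      also have "\<dots> \<le> d * card ?T"
        using piece[OF \<open>j < m\<close>] T unfolding sparse_piece_def by blast
      finally have le: "card (A (j, x) \<inter> A (j, y)) \<le> d * card ?T" .
      moreover have "card (A (j, x) \<inter> A (j, y)) > 0"
        using False finA[of "(j, x)"] that \<open>j < m\<close> \<open>x \<in> \<B>\<close> by (auto simp: I_def card_gt_0_iff)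
      ultimately have "?T \<noteq> {}" by auto
      then obtain i where i: "i \<in> ?T" by blast
      have "(1 / p) ^ card (A (j, x) \<inter> A (j, y)) \<le> (1 / p) ^ (d * card ?T)"
        using le p by (intro power_increasing) auto
      also have "\<dots> = (if {i} \<subseteq> ?T then h ^ card ?T else 0)"
        using i by (simp add: h_def power_mult)
      also have "\<dots> \<le> (\<Sum>i<l. if {i} \<subseteq> ?T then h ^ card ?T else 0)"
        using i T h by (intro member_le_sum) auto
      finally show ?thesis using n1[of y] by presburger
    next
      case True
      then show ?thesis using n1[of y] by simp
    qed
    have "(\<Sum>y\<in>\<B>. if (j, x) \<noteq> (j, y) \<and> A (j, x) \<inter> A (j, y) \<noteq> {} then (1 / p) ^ card (A (j, x) \<inter> A (j, y)) else 0)
        \<le> (\<Sum>y\<in>\<B>. \<Sum>i<l. if {i} \<subseteq> agree l x y then h ^ card (agree l x y) else 0)"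
      by (intro sum_mono pt)
    also have "\<dots> = (\<Sum>i<l. \<Sum>y\<in>\<B>. if {i} \<subseteq> agree l x y then h ^ card (agree l x y) else 0)"
      by (rule sum.swap)
    also have "\<dots> \<le> (\<Sum>i<l. real b ^ l * (h / b) ^ card {i} * (1 + h / b) ^ l)"
      unfolding \<B>_def using that B finB h b
      by (intro sum_mono sum_agree_le) (auto simp: \<B>_def)
    also have "\<dots> = l * (N / Y * (1 + 1 / Y) ^ l)" by (simp add: hb N_def)
    also have "\<dots> \<le> l * (N / Y * 3)"
      using Y1 N by (intro mult_left_mono one_plus_power_le) auto
    also have "\<dots> \<le> N / (2 * c)"
      using Y Y1 N c by (simp add: field_simps)
    finally show ?thesis .
  qed
  have other: "(\<Sum>y\<in>\<B>. if (j, x) \<noteq> (k, y) \<and> A (j, x) \<inter> A (k, y) \<noteq> {} then (1 / p) ^ card (A (j, x) \<inter> A (k, y)) else 0)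
      \<le> N * (3 * (l\<^sup>2 / (b\<^sup>2 * p) + l ^ 3 / (b * p) ^ 3))" if "j < m" "k < m" "j \<noteq> k" "x \<in> \<B>" for j k x
  proof -
    define \<Q> where "\<Q> = (\<lambda>k. {Q. Q \<subseteq> {..<l} \<and> card Q = k})"
    have fin\<Q>: "finite (\<Q> k)" for k unfolding \<Q>_def by (rule finite_subset[of _ "Pow {..<l}"]) auto
    have lb: "real l * (1 / b) \<le> 1" "real l * ((1 / p) / b) \<le> 1"
    proof -
      have "Y \<le> b * p" unfolding Y_def using p d b power_decreasing[of 1 d p] by (intro mult_left_mono) auto
      then have "real l \<le> b * p" using Y1 by linarith
      moreover from this have "real l \<le> real b" using p by (smt (verit) mult_left_le of_nat_0_le_iff)
      ultimately show "real l * (1 / b) \<le> 1" "real l * ((1 / p) / b) \<le> 1"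
        using b p by (auto simp: field_simps)
    qed
    let ?f2 = "\<lambda>Q y. if Q \<subseteq> agree l x y then 1 ^ card (agree l x y) else (0::real)"
    let ?f3 = "\<lambda>Q y. if Q \<subseteq> agree l x y then (1 / p) ^ card (agree l x y) else 0"
    have n2: "0 \<le> (\<Sum>Q\<in>\<Q> 2. ?f2 Q y)" and n3: "0 \<le> (\<Sum>Q\<in>\<Q> 3. ?f3 Q y)" for y
      using p by (auto intro!: sum_nonneg)
    have pt: "(if (j, x) \<noteq> (k, y) \<and> A (j, x) \<inter> A (k, y) \<noteq> {} then (1 / p) ^ card (A (j, x) \<inter> A (k, y)) else 0)
       \<le> (1 / p) * (\<Sum>Q\<in>\<Q> 2. ?f2 Q y) + (\<Sum>Q\<in>\<Q> 3. ?f3 Q y)" if y: "y \<in> \<B>" for y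
    proof (cases "A (j, x) \<inter> A (k, y) = {}")
      case True
      then show ?thesis using n2[of y] n3[of y] p by simp
    next
      case False
      let ?T = "agree l x y"
      have T: "?T \<subseteq> {..<l}" "finite ?T" by (auto simp: agree_def)
      let ?P = "{(a, c)\<in>P j. a \<in> ?T \<and> c \<in> ?T}"
      have "S j \<inter> S k = {}" using S[OF \<open>j < m\<close> \<open>k < m\<close> \<open>j \<noteq> k\<close>] .
      then have le: "card (A (j, x) \<inter> A (k, y)) \<le> card ?P"
        using Int_le[OF \<open>j < m\<close> \<open>k < m\<close> \<open>x \<in> \<B>\<close> y] by auto
      have "card (A (j, x) \<inter> A (k, y)) > 0"
        using False finA[of "(j, x)"] \<open>j < m\<close> \<open>x \<in> \<B>\<close> by (auto simp: I_def card_gt_0_iff)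
      then have "card ?P > 0" using le by linarith
      then have "?P \<noteq> {}" by (metis card.empty less_irrefl)
      then obtain a c where ac: "(a, c) \<in> P j" "a \<in> ?T" "c \<in> ?T" by auto
      then have "a < c" using pieceD(1)[OF \<open>j < m\<close>] by auto
      then have "card {a, c} = 2" by auto
      then have "2 \<le> card ?T" using ac T by (metis card_mono empty_subsetI insert_subset)
      \<comment> \<open>Two agreeing vertices span at most one shared edge, which gives
        \<open>1 / p\<close>. The general bound \<open>(1 / p) ^ card ?T\<close> would leave a term
        of order l ^ 2 / (b p) ^ 2, which need not be small against 1 / (c m) when d = 2; from three
        vertices on it is good enough.\<close>
      then consider "card ?T = 2" | "3 \<le> card ?T" by linarith
      then have "(1 / p) ^ card (A (j, x) \<inter> A (k, y)) \<le> (1 / p) * (\<Sum>Q\<in>\<Q> 2. ?f2 Q y) + (\<Sum>Q\<in>\<Q> 3. ?f3 Q y)"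
      proof cases
        case 1
        have Tac: "?T = {a, c}"
          using 1 \<open>card {a, c} = 2\<close> ac T by (metis card_subset_eq empty_subsetI insert_subset)
        have "?P \<subseteq> {(a, c)}"
          using pieceD(1)[OF \<open>j < m\<close>] \<open>a < c\<close> unfolding Tac by auto
        then have "card ?P \<le> card {(a, c)}" by (intro card_mono) auto
        then have "(1 / p) ^ card (A (j, x) \<inter> A (k, y)) \<le> (1 / p) ^ 1"
          using le p by (intro power_increasing) auto
        also have "\<dots> = (1 / p) * ?f2 ?T y" by simp
        also have "\<dots> \<le> (1 / p) * (\<Sum>Q\<in>\<Q> 2. ?f2 Q y)"
          using p fin\<Q> 1 T by (intro mult_left_mono member_le_sum) (auto simp: \<Q>_def)
        finally show ?thesis using n3[of y] by linarith
      next
        case 2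
        then obtain Q where Q: "Q \<subseteq> ?T" "card Q = 3" by (metis obtain_subset_with_card_n)
        have "card ?P \<le> card ?T"
          using piece[OF \<open>j < m\<close>] T unfolding sparse_piece_def by blast
        then have "(1 / p) ^ card (A (j, x) \<inter> A (k, y)) \<le> (1 / p) ^ card ?T"
          using le p by (intro power_increasing) auto
        also have "\<dots> = ?f3 Q y" using Q by simp
        also have "\<dots> \<le> (\<Sum>Q\<in>\<Q> 3. ?f3 Q y)"
          using p fin\<Q> Q T by (intro member_le_sum) (auto simp: \<Q>_def)
        finally have "(1 / p) ^ card (A (j, x) \<inter> A (k, y)) \<le> (\<Sum>Q\<in>\<Q> 3. ?f3 Q y)" .
        moreover have "0 \<le> (1 / p) * (\<Sum>Q\<in>\<Q> 2. ?f2 Q y)"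
          using p n2[of y] by (intro mult_nonneg_nonneg) auto
        ultimately show ?thesis by linarith
      qed
      then show ?thesis using False \<open>j \<noteq> k\<close> by simp
    qed
    have s2: "(\<Sum>y\<in>\<B>. ?f2 Q y) \<le> N * (1 / b\<^sup>2 * 3)" if "Q \<in> \<Q> 2" for Q
    proof -
      have "(\<Sum>y\<in>\<B>. ?f2 Q y) \<le> real b ^ l * (1 / b) ^ card Q * (1 + 1 / b) ^ l"
        unfolding \<B>_def using that B finB b \<open>x \<in> \<B>\<close>
        by (intro sum_agree_le) (auto simp: \<B>_def \<Q>_def)
      also have "\<dots> = N * (1 / b\<^sup>2 * (1 + 1 / b) ^ l)"
        using that by (simp add: \<Q>_def N_def power_divide)
      also have "\<dots> \<le> N * (1 / b\<^sup>2 * 3)"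
        using N lb by (intro mult_left_mono one_plus_power_le) auto
      finally show ?thesis .
    qed
    have s3: "(\<Sum>y\<in>\<B>. ?f3 Q y) \<le> N * (1 / (b * p) ^ 3 * 3)" if "Q \<in> \<Q> 3" for Q
    proof -
      have "(\<Sum>y\<in>\<B>. ?f3 Q y) \<le> real b ^ l * ((1 / p) / b) ^ card Q * (1 + (1 / p) / b) ^ l"
        unfolding \<B>_def using that B finB b p \<open>x \<in> \<B>\<close>
        by (intro sum_agree_le) (auto simp: \<B>_def \<Q>_def)
      also have "\<dots> = N * (1 / (b * p) ^ 3 * (1 + (1 / p) / b) ^ l)"
        using that by (simp add: \<Q>_def N_def power_divide mult.commute)
      also have "\<dots> \<le> N * (1 / (b * p) ^ 3 * 3)"
        using N lb p by (intro mult_left_mono one_plus_power_le) auto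
      finally show ?thesis .
    qed
    have "(\<Sum>y\<in>\<B>. if (j, x) \<noteq> (k, y) \<and> A (j, x) \<inter> A (k, y) \<noteq> {} then (1 / p) ^ card (A (j, x) \<inter> A (k, y)) else 0)
        \<le> (\<Sum>y\<in>\<B>. (1 / p) * (\<Sum>Q\<in>\<Q> 2. ?f2 Q y) + (\<Sum>Q\<in>\<Q> 3. ?f3 Q y))"
      by (intro sum_mono pt)
    also have "\<dots> = (1 / p) * (\<Sum>y\<in>\<B>. \<Sum>Q\<in>\<Q> 2. ?f2 Q y) + (\<Sum>y\<in>\<B>. \<Sum>Q\<in>\<Q> 3. ?f3 Q y)"
      by (simp only: sum.distrib sum_distrib_left)
    also have "\<dots> = (1 / p) * (\<Sum>Q\<in>\<Q> 2. \<Sum>y\<in>\<B>. ?f2 Q y) + (\<Sum>Q\<in>\<Q> 3. \<Sum>y\<in>\<B>. ?f3 Q y)"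
      by (simp only: sum.swap[of _ \<B>])
    also have "\<dots> \<le> (1 / p) * (\<Sum>Q\<in>\<Q> 2. N * (1 / b\<^sup>2 * 3)) + (\<Sum>Q\<in>\<Q> 3. N * (1 / (b * p) ^ 3 * 3))"
      using p by (intro add_mono mult_left_mono sum_mono s2 s3) auto
    also have "\<dots> = (1 / p) * (real (card (\<Q> 2)) * (N * (1 / b\<^sup>2 * 3))) + real (card (\<Q> 3)) * (N * (1 / (b * p) ^ 3 * 3))"
      by simp
    also have "\<dots> \<le> (1 / p) * (real (l ^ 2) * (N * (1 / b\<^sup>2 * 3))) + real (l ^ 3) * (N * (1 / (b * p) ^ 3 * 3))"
      unfolding \<Q>_def using p N
      by (intro add_mono mult_left_mono mult_right_mono of_nat_mono card_Collect_subsets_le) auto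
    also have "\<dots> = N * (3 * (l\<^sup>2 / (b\<^sup>2 * p) + l ^ 3 / (b * p) ^ 3))"
      by (simp add: algebra_simps)
    finally show ?thesis .
  qed
  define r where "r = 3 * (l\<^sup>2 / (b\<^sup>2 * p) + l ^ 3 / (b * p) ^ 3)"
  have r0: "0 \<le> r" using p by (simp add: r_def)
  have row: "(\<Sum>k\<in>I. if i \<noteq> k \<and> A i \<inter> A k \<noteq> {} then (1 / p) ^ card (A i \<inter> A k) else 0) \<le> N / c"
    if iI: "i \<in> I" for i
  proof -
    obtain j x where i: "i = (j, x)" "j < m" "x \<in> \<B>" using iI by (auto simp: I_def)
    define s where "s = (\<lambda>k. \<Sum>y\<in>\<B>. if (j, x) \<noteq> (k, y) \<and> A (j, x) \<inter> A (k, y) \<noteq> {}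
        then (1 / p) ^ card (A (j, x) \<inter> A (k, y)) else 0)"
    have "(\<Sum>k\<in>I. if i \<noteq> k \<and> A i \<inter> A k \<noteq> {} then (1 / p) ^ card (A i \<inter> A k) else 0)
        = (\<Sum>k<m. s k)"
      unfolding I_def s_def i sum.cartesian_product
      by (rule sum.cong[OF refl]) (simp only: case_prod_beta prod.collapse)
    also have "\<dots> = s j + (\<Sum>k\<in>{..<m} - {j}. s k)"
      using i by (simp add: sum.remove)
    also have "\<dots> \<le> N / (2 * c) + (\<Sum>k\<in>{..<m} - {j}. N * r)"
      unfolding s_def r_def using i by (intro add_mono sum_mono same other) auto
    also have "(\<Sum>k\<in>{..<m} - {j}. N * r) \<le> m * (N * r)"
      using N r0 i by (simp add: mult_right_mono)
    also have "m * (N * r) \<le> N / (2 * c)"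
    proof -
      have "N * (2 * c * m * r) \<le> N * 1"
        using small N unfolding r_def by (intro mult_left_mono) auto
      then show ?thesis using c by (simp add: field_simps)
    qed
    finally show ?thesis using c by (simp add: field_simps)
  qed
  have "(\<Sum>i\<in>I. \<Sum>k\<in>I. if i \<noteq> k \<and> A i \<inter> A k \<noteq> {} then q i * q k * p ^ card (A i \<union> A k) else 0)
      = (\<Sum>i\<in>I. (c / N)\<^sup>2 * (\<Sum>k\<in>I. if i \<noteq> k \<and> A i \<inter> A k \<noteq> {} then (1 / p) ^ card (A i \<inter> A k) else 0))"
    unfolding sum_distrib_left by (intro sum.cong refl) (auto simp: w)
  also have "\<dots> \<le> (\<Sum>i\<in>I. (c / N)\<^sup>2 * (N / c))"
    by (intro sum_mono mult_left_mono row) auto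
  also have "\<dots> = m * c"
    using N c card\<B> by (simp add: I_def card_cartesian_product power2_eq_square)
  finally have D: "(\<Sum>i\<in>I. \<Sum>k\<in>I. if i \<noteq> k \<and> A i \<inter> A k \<noteq> {} then q i * q k * p ^ card (A i \<union> A k) else 0) \<le> m * c" .
  have "(\<Sum>i\<in>I. q i * p ^ card (A i)) = (\<Sum>i\<in>I. c / N)"
    using p by (intro sum.cong) (auto simp: q_def N_def)
  also have "\<dots> = m * c"
    using N card\<B> by (simp add: I_def card_cartesian_product)
  finally have \<mu>: "(\<Sum>i\<in>I. q i * p ^ card (A i)) = m * c" .
  have "finite (vertex_pairs {..<n})"
    by (rule finite_subset[of _ "Pow {..<n}"]) (auto simp: vertex_pairs_def)
  then have "measure_pmf.prob (bits (vertex_pairs {..<n}) p) {X. \<forall>i\<in>I. \<not> (\<forall>e\<in>A i. X e)}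
      \<le> exp (- (m * c) + (\<Sum>i\<in>I. \<Sum>k\<in>I. if i \<noteq> k \<and> A i \<inter> A k \<noteq> {} then q i * q k * p ^ card (A i \<union> A k) else 0) / 2)"
    using janson_weighted[of "vertex_pairs {..<n}" p I A q] p finI AE q01 by (simp add: \<mu>)
  also have "\<dots> \<le> exp (- (m * c) + (m * c) / 2)"
    unfolding exp_le_cancel_iff by (intro add_left_mono divide_right_mono D) simp
  also have "\<dots> = exp (- (m * c / 2))" by simp
  also have "{X. \<forall>i\<in>I. \<not> (\<forall>e\<in>A i. X e)}
      = {X. \<forall>j<m. \<forall>x\<in>PiE {..<l} B. \<not> (\<forall>e\<in>copy_edges (P j) (S j) x. X e)}"
    by (auto simp: I_def A_def \<B>_def)
  finally show ?thesis .
qed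

section \<open>The union bound over all hosts and pieces\<close>

lemma card_subsets_le:
  assumes "finite A"
  shows "finite {U. U \<subseteq> A \<and> card U \<le> k}" "card {U. U \<subseteq> A \<and> card U \<le> k} \<le> (card A + 1) ^ k"
proof -
  show fin: "finite {U. U \<subseteq> A \<and> card U \<le> k}" for k
    using assms by (rule_tac finite_subset[of _ "Pow A"]) auto
  show "card {U. U \<subseteq> A \<and> card U \<le> k} \<le> (card A + 1) ^ k"
  proof (induction k)
    case 0
    have "{U. U \<subseteq> A \<and> card U \<le> 0} = {{}}" using assms finite_subset by fastforce
    then show ?case by simp
  next
    case (Suc k)
    let ?f = "\<lambda>(o', U). case o' of None \<Rightarrow> U | Some a \<Rightarrow> insert a U"
    have "{U. U \<subseteq> A \<and> card U \<le> Suc k} \<subseteq> ?f ` (insert None (Some ` A) \<times> {U. U \<subseteq> A \<and> card U \<le> k})"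
    proof
      fix U assume U: "U \<in> {U. U \<subseteq> A \<and> card U \<le> Suc k}"
      then have finU: "finite U" using assms finite_subset by blast
      show "U \<in> ?f ` (insert None (Some ` A) \<times> {U. U \<subseteq> A \<and> card U \<le> k})"
      proof (cases "U = {}")
        case True
        then show ?thesis by (intro image_eqI[of _ _ "(None, {})"]) auto
      next
        case False
        then obtain a where "a \<in> U" by blast
        then show ?thesis using U finU
          by (intro image_eqI[of _ _ "(Some a, U - {a})"]) auto
      qed
    qed
    then have "card {U. U \<subseteq> A \<and> card U \<le> Suc k} \<le> card (insert None (Some ` A) \<times> {U. U \<subseteq> A \<and> card U \<le> k})"
      using assms fin by (meson card_image_le card_mono finite_SigmaI finite_imageI finite_insert order_trans)
    also have "\<dots> = (card A + 1) * card {U. U \<subseteq> A \<and> card U \<le> k}"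
      using assms by (simp add: card_cartesian_product card_image card_insert_if)
    also have "\<dots> \<le> (card A + 1) * (card A + 1) ^ k"
      by (intro mult_left_mono Suc) auto
    finally show ?case by simp
  qed
qed

text \<open>The removed vertices are those used by copies found before. Intervals keep the number of sets
  small enough for the union bound.\<close>

definition punctured_interval :: "nat \<Rightarrow> nat \<Rightarrow> nat set \<Rightarrow> bool" where
  "punctured_interval n k A \<longleftrightarrow> (\<exists>u v U. A = {u..<v} - U \<and> u \<le> n \<and> v \<le> n \<and> U \<subseteq> {..<n} \<and> card U \<le> k)"

lemma card_punctured_interval_le:
  "finite {A. punctured_interval n k A}" "card {A. punctured_interval n k A} \<le> (n + 1) ^ (k + 2)"
proof -
  let ?X = "{..n} \<times> {..n} \<times> {U. U \<subseteq> {..<n} \<and> card U \<le> k}"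
  have eq: "{A. punctured_interval n k A} = (\<lambda>(u, v, U). {u..<v} - U) ` ?X"
    unfolding punctured_interval_def by (auto intro!: image_eqI[of _ _ "(_, _, _)"])
  have fin: "finite ?X" using card_subsets_le(1)[of "{..<n}" k] by simp
  then show "finite {A. punctured_interval n k A}" unfolding eq by simp
  have "card {A. punctured_interval n k A} \<le> card ?X"
    unfolding eq using fin by (rule card_image_le)
  also have "\<dots> = (n + 1) * ((n + 1) * card {U. U \<subseteq> {..<n} \<and> card U \<le> k})"
    by (simp add: card_cartesian_product)
  also have "\<dots> \<le> (n + 1) * ((n + 1) * (n + 1) ^ k)"
    using card_subsets_le(2)[of "{..<n}" k] by (intro mult_left_mono) auto
  finally show "card {A. punctured_interval n k A} \<le> (n + 1) ^ (k + 2)" by simp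
qed

text \<open>The last condition concerns pairs of an index and an attached vertex; it keeps copies of
  different pieces from sharing an outer edge.\<close>

definition valid_hosts :: "nat \<Rightarrow> nat \<Rightarrow> nat \<Rightarrow> nat \<Rightarrow> nat \<Rightarrow> nat \<Rightarrow> (nat \<Rightarrow> nat set) \<Rightarrow>
    (nat \<Rightarrow> (nat \<times> nat) set) \<Rightarrow> (nat \<Rightarrow> (nat \<times> nat) set) \<Rightarrow> bool" where
  "valid_hosts n d b k m l B P S \<longleftrightarrow>
     (\<forall>i<l. punctured_interval n k (B i) \<and> b \<le> card (B i)) \<and> disjoint_family_on B {..<l} \<and>
     (\<forall>j<m. sparse_piece d l (P j) (S j) \<and> snd ` S j \<subseteq> {..<n} - (\<Union>i<l. B i)) \<and>
     (\<forall>j<m. \<forall>k<m. j \<noteq> k \<longrightarrow> S j \<inter> S k = {})"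

definition no_copy :: "nat \<Rightarrow> nat \<Rightarrow> (nat \<Rightarrow> nat set) \<Rightarrow>
    (nat \<Rightarrow> (nat \<times> nat) set) \<Rightarrow> (nat \<Rightarrow> (nat \<times> nat) set) \<Rightarrow> (nat set \<Rightarrow> bool) \<Rightarrow> bool" where
  "no_copy m l B P S X \<longleftrightarrow> (\<forall>j<m. \<forall>x\<in>PiE {..<l} B. \<not> (\<forall>e\<in>copy_edges (P j) (S j) x. X e))"

text \<open>The deterministic property from which universality is deduced. It covers all hosts and
  all attached vertices, so it applies to images that were chosen with knowledge of the graph. The
  number \<open>K * m\<close> of removed vertices grows with \<open>m\<close>, and so does the
  exponent of the failure probability, which keeps the union bound affordable.\<close>

definition expanding :: "nat \<Rightarrow> nat \<Rightarrow> nat \<Rightarrow> nat \<Rightarrow> nat \<Rightarrow> (nat set \<Rightarrow> bool) \<Rightarrow> bool" where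
  "expanding n L d b K X \<longleftrightarrow> (\<forall>m\<in>{1..n}. \<forall>l\<in>{1..L}. \<forall>B P S.
     valid_hosts n d b (K * m) m l B P S \<longrightarrow> \<not> no_copy m l B P S X)"

text \<open>Cutting every host down to exactly \<open>b\<close> vertices only loses copies, so the
  bound for hosts of equal size applies.\<close>

lemma prob_no_copy_valid:
  fixes p c :: real and n m l d b :: nat
  assumes "0 < p" "p \<le> 1" "1 \<le> c" "1 \<le> l" "1 \<le> d"
    and V: "valid_hosts n d b k m l B P S"
    and "6 * l * c \<le> b * p ^ d" "2 * c * m * (3 * (l\<^sup>2 / (b\<^sup>2 * p) + l ^ 3 / (b * p) ^ 3)) \<le> 1"
  shows "measure_pmf.prob (bits (vertex_pairs {..<n}) p) {X. no_copy m l B P S X} \<le> exp (- (m * c / 2))"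
proof -
  have "\<exists>B'. \<forall>i<l. B' i \<subseteq> B i \<and> card (B' i) = b"
  proof -
    have "\<exists>A. i < l \<longrightarrow> A \<subseteq> B i \<and> card A = b" for i
      using V unfolding valid_hosts_def by (meson obtain_subset_with_card_n)
    then show ?thesis by metis
  qed
  then obtain B' where B': "\<And>i. i < l \<Longrightarrow> B' i \<subseteq> B i \<and> card (B' i) = b" by blast
  have Bn: "B i \<subseteq> {..<n}" if "i < l" for i
    using V that unfolding valid_hosts_def punctured_interval_def by fastforce
  have "{X. no_copy m l B P S X} \<subseteq> {X. \<forall>j<m. \<forall>x\<in>PiE {..<l} B'. \<not> (\<forall>e\<in>copy_edges (P j) (S j) x. X e)}"
    unfolding no_copy_def using B' PiE_mono[of "{..<l}" B' B] by auto
  then have "measure_pmf.prob (bits (vertex_pairs {..<n}) p) {X. no_copy m l B P S X}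
      \<le> measure_pmf.prob (bits (vertex_pairs {..<n}) p)
          {X. \<forall>j<m. \<forall>x\<in>PiE {..<l} B'. \<not> (\<forall>e\<in>copy_edges (P j) (S j) x. X e)}"
    by (intro measure_pmf.finite_measure_mono) auto
  also have "\<dots> \<le> exp (- (m * c / 2))"
  proof (rule prob_no_copy)
    show "B' i \<subseteq> {..<n} \<and> card (B' i) = b" if "i < l" for i using B' Bn that by blast
    show "disjoint_family_on B' {..<l}"
      unfolding disjoint_family_on_def
    proof (intro ballI impI)
      fix i k assume ik: "i \<in> {..<l}" "k \<in> {..<l}" "i \<noteq> k"
      then have "B i \<inter> B k = {}" using V unfolding valid_hosts_def disjoint_family_on_def by blast
      then show "B' i \<inter> B' k = {}" using B'[of i] B'[of k] ik by auto
    qed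
    show "sparse_piece d l (P j) (S j) \<and> snd ` S j \<subseteq> {..<n} - (\<Union>i<l. B' i)" if "j < m" for j
    proof -
      have "(\<Union>i<l. B' i) \<subseteq> (\<Union>i<l. B i)" using B' by fastforce
      moreover have "sparse_piece d l (P j) (S j)" "snd ` S j \<subseteq> {..<n} - (\<Union>i<l. B i)"
        using V that unfolding valid_hosts_def by simp_all
      ultimately show ?thesis by blast
    qed
    show "S j \<inter> S k = {}" if "j < m" "k < m" "j \<noteq> k" for j k
      using V that unfolding valid_hosts_def by blast
  qed (use assms in auto)
  finally show ?thesis .
qed

text \<open>For fixed \<open>m\<close> and \<open>l\<close> the number of configurations is a power
  of n + 1 with exponent at most m L (K + 2 d + 4): each of the \<open>l\<close> hosts takes K m + 2
  choices, and each piece takes 2 l for its inner and 2 d l for its outer edges. By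
  \<open>entropy\<close>, the failure probability exp (- m c / 2) beats this count by (n + 1) ^ (3
  m). Two of these three factors pay for the sum over \<open>m\<close> and \<open>l\<close>.\<close>

lemma prob_not_expanding:
  fixes p c :: real and n L d b K :: nat
  assumes p: "0 < p" "p \<le> 1" and c: "1 \<le> c" and d: "1 \<le> d" and L: "1 \<le> L" "L \<le> n"
    and large: "6 * L * c \<le> b * p ^ d"
    and small: "2 * c * n * (3 * (L\<^sup>2 / (b\<^sup>2 * p) + L ^ 3 / (b * p) ^ 3)) \<le> 1"
    and entropy: "(L * (K + 2 * d + 4) + 3) * ln (real n + 1) \<le> c / 2"
  shows "measure_pmf.prob (bits (vertex_pairs {..<n}) p) {X. \<not> expanding n L d b K X} \<le> 1 / (real n + 1)"
proof -
  define M where "M = bits (vertex_pairs {..<n}) p"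
  define \<P> where "\<P> = (\<lambda>l. {P. P \<subseteq> {..<l} \<times> {..<l} \<and> card P \<le> l})"
  define \<S> where "\<S> = (\<lambda>l. {S. S \<subseteq> {..<l} \<times> {..<n} \<and> card S \<le> d * l})"
  define W where "W = (\<lambda>m l. PiE {..<l} (\<lambda>_. {A. punctured_interval n (K * m) A}) \<times>
      PiE {..<m} (\<lambda>_. \<P> l) \<times> PiE {..<m} (\<lambda>_. \<S> l))"
  define V where "V = (\<lambda>m l. {(B, P, S)\<in>W m l. valid_hosts n d b (K * m) m l B P S})"
  define N where "N = real n + 1"
  have N: "1 \<le> N" by (simp add: N_def)
  have fin\<P>: "finite (\<P> l)" and fin\<S>: "finite (\<S> l)" for l
    unfolding \<P>_def \<S>_def by (rule card_subsets_le; simp)+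
  have finW: "finite (W m l)" for m l
    unfolding W_def using fin\<P> fin\<S> card_punctured_interval_le(1) by (intro finite_cartesian_product finite_PiE) auto
  then have finV: "finite (V m l)" for m l
    unfolding V_def by (rule rev_finite_subset) auto
  have cardV: "real (card (V m l)) \<le> N ^ (m * (L * (K + 2 * d + 4)))" if ml: "m \<in> {1..n}" "l \<in> {1..L}" for m l
  proof -
    have ln: "l \<le> n" using ml L by auto
    have sq: "l * k + 1 \<le> (n + 1) ^ 2" if "k \<le> n" for k
      using mult_mono[OF ln that] by (simp add: power2_eq_square)
    have "card (\<P> l) \<le> (l * l + 1) ^ l"
      using card_subsets_le(2)[of "{..<l} \<times> {..<l}" l] by (simp add: \<P>_def card_cartesian_product)
    also have "\<dots> \<le> ((n + 1) ^ 2) ^ l" by (intro power_mono sq ln) auto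
    finally have c\<P>: "card (\<P> l) \<le> (n + 1) ^ (2 * l)" by (simp add: power_mult)
    have "card (\<S> l) \<le> (l * n + 1) ^ (d * l)"
      using card_subsets_le(2)[of "{..<l} \<times> {..<n}" "d * l"] by (simp add: \<S>_def card_cartesian_product)
    also have "\<dots> \<le> ((n + 1) ^ 2) ^ (d * l)" by (intro power_mono sq) auto
    finally have c\<S>: "card (\<S> l) \<le> (n + 1) ^ (2 * (d * l))" by (simp add: power_mult)
    have "card (V m l) \<le> card (W m l)"
      unfolding V_def using finW by (intro card_mono) auto
    also have "card (W m l) = card {A. punctured_interval n (K * m) A} ^ l * (card (\<P> l) ^ m * card (\<S> l) ^ m)"
      by (simp add: W_def card_cartesian_product card_PiE)
    also have "\<dots> \<le> ((n + 1) ^ (K * m + 2)) ^ l * (((n + 1) ^ (2 * l)) ^ m * ((n + 1) ^ (2 * (d * l))) ^ m)"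
      by (intro mult_mono power_mono card_punctured_interval_le(2) c\<P> c\<S>) auto
    also have "\<dots> = (n + 1) ^ ((K * m + 2) * l + (2 * l * m + 2 * (d * l) * m))"
      by (simp only: power_mult[symmetric] power_add[symmetric])
    also have "\<dots> \<le> (n + 1) ^ (m * (L * (K + 2 * d + 4)))"
    proof (rule power_increasing)
      have "2 * l * 1 \<le> 2 * l * m" using ml by (intro mult_left_mono) auto
      then have "(K * m + 2) * l + (2 * l * m + 2 * (d * l) * m) \<le> (K * m) * l + 2 * l * m + (2 * l * m + 2 * (d * l) * m)"
        unfolding add_mult_distrib by linarith
      also have "\<dots> = m * (l * (K + 2 * d + 4))"
        by (simp add: algebra_simps)
      also have "\<dots> \<le> m * (L * (K + 2 * d + 4))" using ml by (intro mult_mono) auto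
      finally show "(K * m + 2) * l + (2 * l * m + 2 * (d * l) * m) \<le> m * (L * (K + 2 * d + 4))" .
    qed simp
    finally have "real (card (V m l)) \<le> real ((n + 1) ^ (m * (L * (K + 2 * d + 4))))" by linarith
    then show ?thesis by (simp add: N_def add.commute)
  qed
  have sub: "{X. \<not> expanding n L d b K X}
      \<subseteq> (\<Union>m\<in>{1..n}. \<Union>l\<in>{1..L}. \<Union>(B, P, S)\<in>V m l. {X. no_copy m l B P S X})"
  proof
    fix X assume "X \<in> {X. \<not> expanding n L d b K X}"
    then obtain m l B P S where ml: "m \<in> {1..n}" "l \<in> {1..L}"
      and v: "valid_hosts n d b (K * m) m l B P S" and no: "no_copy m l B P S X"
      unfolding expanding_def by blast
    \<comment> \<open>Values outside the index ranges are normalised so that only finitely many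
      triples occur; validity and the absence of a copy depend on the indices below \<open>l\<close>
      and \<open>m\<close> alone.\<close>
    define B' where "B' = restrict B {..<l}"
    define P' where "P' = restrict P {..<m}"
    define S' where "S' = restrict S {..<m}"
    have eqs: "B' i = B i" if "i < l" for i using that by (simp add: B'_def)
    have eqs2: "P' j = P j" "S' j = S j" if "j < m" for j using that by (simp_all add: P'_def S'_def)
    have "PiE {..<l} B' = PiE {..<l} B" using eqs by (intro PiE_cong) auto
    then have no': "no_copy m l B' P' S' X"
      using no eqs2 unfolding no_copy_def by simp
    have "(\<Union>i<l. B' i) = (\<Union>i<l. B i)" using eqs by auto
    then have v': "valid_hosts n d b (K * m) m l B' P' S'"
      using v eqs eqs2 unfolding valid_hosts_def disjoint_family_on_def by simp
    have P: "P' \<in> PiE {..<m} (\<lambda>_. \<P> l)" and S: "S' \<in> PiE {..<m} (\<lambda>_. \<S> l)"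
    proof -
      have "P j \<in> \<P> l \<and> S j \<in> \<S> l" if "j < m" for j
      proof -
        have sp: "sparse_piece d l (P j) (S j)" and "snd ` S j \<subseteq> {..<n}"
          using v that unfolding valid_hosts_def by blast+
        note D = sparse_pieceD[OF sp]
        have "S j \<subseteq> {..<l} \<times> {..<n}"
          using D(4) \<open>snd ` S j \<subseteq> {..<n}\<close> by (auto simp: image_subset_iff Ball_def)
        then show ?thesis using D by (auto simp: \<P>_def \<S>_def)
      qed
      then show "P' \<in> PiE {..<m} (\<lambda>_. \<P> l)" "S' \<in> PiE {..<m} (\<lambda>_. \<S> l)"
        by (auto simp: P'_def S'_def)
    qed
    have B: "B' \<in> PiE {..<l} (\<lambda>_. {A. punctured_interval n (K * m) A})"
      using v by (auto simp: valid_hosts_def B'_def)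
    have "(B', P', S') \<in> V m l" using B P S v' by (auto simp: V_def W_def)
    then show "X \<in> (\<Union>m\<in>{1..n}. \<Union>l\<in>{1..L}. \<Union>(B, P, S)\<in>V m l. {X. no_copy m l B P S X})"
      using no' ml by blast
  qed
  have each: "measure_pmf.prob M {X. no_copy m l B P S X} \<le> exp (- (m * c / 2))"
    if "m \<in> {1..n}" "l \<in> {1..L}" "(B, P, S) \<in> V m l" for m l B P S
    unfolding M_def
  proof (rule prob_no_copy_valid[where d = d and b = b and k = "K * m"])
    show "valid_hosts n d b (K * m) m l B P S" using that by (simp add: V_def)
    have "6 * l * c \<le> 6 * L * c" using that c by (intro mult_mono) auto
    then show "6 * l * c \<le> b * p ^ d" using large by linarith
    have "2 * c * m * (3 * (l\<^sup>2 / (b\<^sup>2 * p) + l ^ 3 / (b * p) ^ 3))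
        \<le> 2 * c * n * (3 * (L\<^sup>2 / (b\<^sup>2 * p) + L ^ 3 / (b * p) ^ 3))"
      using that c p by (intro mult_mono add_mono divide_right_mono power_mono) auto
    then show "2 * c * m * (3 * (l\<^sup>2 / (b\<^sup>2 * p) + l ^ 3 / (b * p) ^ 3)) \<le> 1" using small by linarith
  qed (use that p c d in auto)
  have inner: "measure_pmf.prob M (\<Union>(B, P, S)\<in>V m l. {X. no_copy m l B P S X}) \<le> 1 / N ^ 3"
    if ml: "m \<in> {1..n}" "l \<in> {1..L}" for m l
  proof -
    have "measure_pmf.prob M (\<Union>v\<in>V m l. {X. no_copy m l (fst v) (fst (snd v)) (snd (snd v)) X})
        \<le> (\<Sum>v\<in>V m l. measure_pmf.prob M {X. no_copy m l (fst v) (fst (snd v)) (snd (snd v)) X})"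
      using finV by (intro measure_UNION_le) auto
    also have "\<dots> \<le> (\<Sum>v\<in>V m l. exp (- (m * c / 2)))"
      using each ml by (intro sum_mono) auto
    also have "\<dots> = real (card (V m l)) * exp (- (m * c / 2))" by simp
    also have "\<dots> \<le> N ^ (m * (L * (K + 2 * d + 4))) * exp (- (m * c / 2))"
      using cardV[OF ml] by (intro mult_right_mono) auto
    also have "\<dots> = exp (m * (L * (K + 2 * d + 4) * ln N - c / 2))"
    proof -
      have "N ^ e = exp (real e * ln N)" for e
        using N by (simp add: exp_of_nat_mult)
      then show ?thesis by (simp only: exp_add[symmetric]) (simp add: algebra_simps)
    qed
    also have "\<dots> \<le> exp (m * (- 3 * ln N))"
      using entropy unfolding N_def exp_le_cancel_iff by (intro mult_left_mono) (auto simp: algebra_simps)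
    also have "\<dots> \<le> exp (1 * (- 3 * ln N))"
      unfolding exp_le_cancel_iff using ml N by (intro mult_right_mono_neg) auto
    also have "\<dots> = 1 / N ^ 3"
      using N exp_of_nat_mult[of 3 "ln N"] by (simp add: exp_minus field_simps)
    finally show ?thesis by (simp add: case_prod_beta)
  qed
  have "measure_pmf.prob M {X. \<not> expanding n L d b K X}
      \<le> measure_pmf.prob M (\<Union>m\<in>{1..n}. \<Union>l\<in>{1..L}. \<Union>(B, P, S)\<in>V m l. {X. no_copy m l B P S X})"
    using sub by (intro measure_pmf.finite_measure_mono) auto
  also have "\<dots> \<le> (\<Sum>m\<in>{1..n}. measure_pmf.prob M (\<Union>l\<in>{1..L}. \<Union>(B, P, S)\<in>V m l. {X. no_copy m l B P S X}))"
    by (intro measure_UNION_le) auto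
  also have "\<dots> \<le> (\<Sum>m\<in>{1..n}. \<Sum>l\<in>{1..L}. measure_pmf.prob M (\<Union>(B, P, S)\<in>V m l. {X. no_copy m l B P S X}))"
    by (intro sum_mono measure_UNION_le) auto
  also have "\<dots> \<le> (\<Sum>m\<in>{1..n}. \<Sum>l\<in>{1..L}. 1 / N ^ 3)"
    by (intro sum_mono inner)
  also have "\<dots> = n * L / N ^ 3" by simp
  also have "\<dots> \<le> N * N / N ^ 3"
  proof (intro divide_right_mono)
    have "real n \<le> N" "real L \<le> N" using L by (auto simp: N_def)
    then show "real (n * L) \<le> N * N" unfolding of_nat_mult using N by (intro mult_mono) auto
  qed (use N in auto)
  also have "\<dots> = 1 / N" using N by (simp add: power3_eq_cube)
  finally show ?thesis by (simp add: M_def N_def)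
qed

subsection \<open>Embedding batches of pieces\<close>

text \<open>If a maximal family of disjoint copies missed more than \<open>card \<J> / K\<close> pieces, the vertices it uses
  would number at most \<open>K\<close> times the missed pieces, and expansion would yield a further copy.\<close>

lemma embed_round:
  assumes good: "expanding n L d b K X" and b: "1 \<le> b" and l: "1 \<le> l" "l \<le> L"
    and fin: "finite \<J>" "card \<J> \<le> n"
    and J: "\<And>i. i < l \<Longrightarrow> J i = {u i..<v i} \<and> v i \<le> n \<and> b + card \<J> \<le> card (J i)"
    and disj: "disjoint_family_on J {..<l}"
    and piece: "\<And>j. j \<in> \<J> \<Longrightarrow> sparse_piece d l (P j) (S j) \<and> snd ` S j \<subseteq> {..<n} - (\<Union>i<l. J i)"
    and S: "\<And>j k. j \<in> \<J> \<Longrightarrow> k \<in> \<J> \<Longrightarrow> j \<noteq> k \<Longrightarrow> S j \<inter> S k = {}"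
  obtains R x where "R \<subseteq> \<J>" "K * card R \<le> card \<J>"
    "\<And>j. j \<in> \<J> - R \<Longrightarrow> x j \<in> PiE {..<l} J \<and> (\<forall>e\<in>copy_edges (P j) (S j) (x j). X e)"
    "\<And>j k i. j \<in> \<J> - R \<Longrightarrow> k \<in> \<J> - R \<Longrightarrow> i < l \<Longrightarrow> x j i = x k i \<Longrightarrow> j = k"
proof -
  \<comment> \<open>Comparing images at the same index is enough, because the intervals
    \<open>J i\<close> are disjoint.\<close>
  define ok where "ok = (\<lambda>A x. (\<forall>j\<in>A. x j \<in> PiE {..<l} J \<and> (\<forall>e\<in>copy_edges (P j) (S j) (x j). X e)) \<and>
      (\<forall>j\<in>A. \<forall>k\<in>A. \<forall>i<l. x j i = x k i \<longrightarrow> j = k))"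
  define Pr where "Pr = (\<lambda>A. A \<subseteq> \<J> \<and> (\<exists>x. ok A x))"
  have "Pr {}" by (simp add: Pr_def ok_def)
  moreover have "\<forall>A. Pr A \<longrightarrow> card A < Suc (card \<J>)"
    unfolding Pr_def using fin by (auto intro!: le_imp_less_Suc card_mono)
  ultimately obtain A where A: "Pr A" and max: "\<And>A'. Pr A' \<Longrightarrow> card A' \<le> card A"
    using ex_has_greatest_nat[of Pr "{}" card "Suc (card \<J>)"] by blast
  obtain x where "A \<subseteq> \<J>" and x: "ok A x" using A by (auto simp: Pr_def)
  have finA: "finite A" using \<open>A \<subseteq> \<J>\<close> fin finite_subset by blast
  define R where "R = \<J> - A"
  have R: "\<J> - R = A" "finite R" using \<open>A \<subseteq> \<J>\<close> fin by (auto simp: R_def)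
  have "K * card R \<le> card \<J>"
  proof (rule ccontr)
    assume "\<not> K * card R \<le> card \<J>"
    then have KR: "card \<J> < K * card R" by simp
    define m where "m = card R"
    have "card R \<noteq> 0" using KR by (intro notI) simp
    moreover have "card R \<le> card \<J>" using fin by (intro card_mono) (auto simp: R_def)
    ultimately have m: "m \<in> {1..n}" using fin(2) unfolding m_def by simp
    obtain f where f: "bij_betw f {..<m} R"
      using ex_bij_betw_nat_finite[OF R(2)] unfolding m_def atLeast0LessThan by blast
    have fR: "f j \<in> \<J>" "f j \<notin> A" if "j < m" for j
      using bij_betwE[OF f] that by (auto simp: R_def)
    \<comment> \<open>The vertices of \<open>J i\<close> taken by the copies found so far. They
      number at most \<open>card \<J>\<close>, which is below \<open>K * m\<close> by the assumption
      to be refuted, and at least \<open>b\<close> vertices of the interval stay free.\<close>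
    define U where "U = (\<lambda>i. (\<lambda>j. x j i) ` A)"
    define B where "B = (\<lambda>i. J i - U i)"
    have cardU: "finite (U i)" "card (U i) \<le> card \<J>" for i
      using finA card_image_le[OF finA, of "\<lambda>j. x j i"] card_mono[OF fin(1) \<open>A \<subseteq> \<J>\<close>]
      by (auto simp: U_def)
    have UJ: "U i \<subseteq> J i" if "i < l" for i
      using x that by (auto simp: U_def ok_def)
    have "punctured_interval n (K * m) (B i) \<and> b \<le> card (B i)" if i: "i < l" for i
    proof
      have Ji: "J i = {u i..<v i}" "v i \<le> n" "b + card \<J> \<le> card (J i)" using J[OF i] by auto
      then have "u i \<le> n" using b by (cases "u i \<le> v i") auto
      moreover have "U i \<subseteq> {..<n}" using UJ[OF i] Ji by auto
      moreover have "card (U i) \<le> K * m" using cardU(2)[of i] KR by (simp add: m_def)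
      ultimately show "punctured_interval n (K * m) (B i)"
        unfolding punctured_interval_def B_def using Ji by blast
      have "card (B i) = card (J i) - card (U i)"
        unfolding B_def using cardU UJ[OF i] by (intro card_Diff_subset)
      then show "b \<le> card (B i)" using Ji cardU(2)[of i] by linarith
    qed
    moreover have "disjoint_family_on B {..<l}"
      using disj unfolding disjoint_family_on_def B_def by blast
    moreover have "sparse_piece d l ((P \<circ> f) j) ((S \<circ> f) j) \<and> snd ` (S \<circ> f) j \<subseteq> {..<n} - (\<Union>i<l. B i)"
      if "j < m" for j
      using piece[OF fR(1)[OF that]] unfolding B_def by fastforce
    moreover have "(S \<circ> f) j \<inter> (S \<circ> f) k = {}" if "j < m" "k < m" "j \<noteq> k" for j k
    proof -
      have "f j \<noteq> f k" using f that unfolding bij_betw_def inj_on_def by auto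
      then show ?thesis using S[OF fR(1) fR(1)] that by simp
    qed
    ultimately have "valid_hosts n d b (K * m) m l B (P \<circ> f) (S \<circ> f)"
      unfolding valid_hosts_def by blast
    then have "\<not> no_copy m l B (P \<circ> f) (S \<circ> f) X"
      using good m l unfolding expanding_def by simp
    then obtain j y where j: "j < m" and y: "y \<in> PiE {..<l} B"
      and e: "\<forall>e\<in>copy_edges (P (f j)) (S (f j)) y. X e"
      unfolding no_copy_def by auto
    have yB: "y i \<in> J i \<and> y i \<notin> U i" if "i < l" for i
      using y that unfolding B_def by blast
    have yJ: "y \<in> PiE {..<l} J" using y unfolding B_def by (auto simp: PiE_iff)
    have neq: "x k i \<noteq> y i \<and> y i \<noteq> x k i" if "k \<in> A" "i < l" for k i
      using yB[OF that(2)] that(1) unfolding U_def by (metis imageI)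
    \<comment> \<open>The new copy avoids every \<open>U i\<close>, so it extends the family,
      against maximality.\<close>
    have "ok (insert (f j) A) (x(f j := y))"
      using x yJ e neq fR[OF j] unfolding ok_def by auto
    then have "Pr (insert (f j) A)" using \<open>A \<subseteq> \<J>\<close> fR[OF j] unfolding Pr_def by auto
    then show False using max[of "insert (f j) A"] finA fR[OF j] by simp
  qed
  then show thesis using that[of R x] x unfolding R ok_def by (auto simp: R_def)
qed

text \<open>The copies not found in the first round are found in \<open>T\<close> further rounds on reserved intervals;
  the number of missing copies drops by the factor \<open>K\<close> each time.\<close>

lemma embed_group:
  assumes good: "expanding n L d b K X" and b: "1 \<le> b" and l: "1 \<le> l" "l \<le> L"
    and K: "n \<le> K * b" "n < K ^ Suc T" "1 \<le> K"
    and fin: "finite \<J>" "card \<J> \<le> n"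
    and J: "\<And>t i. t \<le> T \<Longrightarrow> i < l \<Longrightarrow> J t i = {u t i..<v t i} \<and> v t i \<le> n"
    and J0: "\<And>i. i < l \<Longrightarrow> b + card \<J> \<le> card (J 0 i)"
    and Jt: "\<And>t i. 1 \<le> t \<Longrightarrow> t \<le> T \<Longrightarrow> i < l \<Longrightarrow> 2 * b \<le> card (J t i)"
    and disj: "\<And>t i t' i'. t \<le> T \<Longrightarrow> t' \<le> T \<Longrightarrow> i < l \<Longrightarrow> i' < l \<Longrightarrow> J t i \<inter> J t' i' \<noteq> {} \<Longrightarrow> t = t' \<and> i = i'"
    and piece: "\<And>j. j \<in> \<J> \<Longrightarrow> sparse_piece d l (P j) (S j) \<and> snd ` S j \<subseteq> {..<n} - (\<Union>t\<le>T. \<Union>i<l. J t i)"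
    and S: "\<And>j k. j \<in> \<J> \<Longrightarrow> k \<in> \<J> \<Longrightarrow> j \<noteq> k \<Longrightarrow> S j \<inter> S k = {}"
  obtains x where
    "\<And>j i. j \<in> \<J> \<Longrightarrow> i < l \<Longrightarrow> x j i \<in> (\<Union>t\<le>T. J t i)"
    "\<And>j e. j \<in> \<J> \<Longrightarrow> e \<in> copy_edges (P j) (S j) (x j) \<Longrightarrow> X e"
    "\<And>j k i i'. j \<in> \<J> \<Longrightarrow> k \<in> \<J> \<Longrightarrow> i < l \<Longrightarrow> i' < l \<Longrightarrow> x j i = x k i' \<Longrightarrow> j = k \<and> i = i'"
proof -
  \<comment> \<open>\<open>R\<close> holds the pieces still without a copy after the rounds 0, ...,
    t. As \<open>card \<J> \<le> n < K ^ Suc T\<close>, it is empty after round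
    \<open>T\<close>.\<close>
  have "\<exists>R x. R \<subseteq> \<J> \<and> K ^ Suc t * card R \<le> card \<J> \<and>
      (\<forall>j\<in>\<J> - R. (\<forall>i<l. x j i \<in> (\<Union>s\<le>t. J s i)) \<and> (\<forall>e\<in>copy_edges (P j) (S j) (x j). X e)) \<and>
      (\<forall>j\<in>\<J> - R. \<forall>k\<in>\<J> - R. \<forall>i<l. x j i = x k i \<longrightarrow> j = k)" if "t \<le> T" for t
    using that
  proof (induction t)
    case 0
    have d0: "disjoint_family_on (J 0) {..<l}"
      unfolding disjoint_family_on_def using disj[of 0 0] by auto
    have p0: "sparse_piece d l (P j) (S j) \<and> snd ` S j \<subseteq> {..<n} - (\<Union>i<l. J 0 i)" if "j \<in> \<J>" for j
    proof -
      have "(\<Union>i<l. J 0 i) \<subseteq> (\<Union>t\<le>T. \<Union>i<l. J t i)" by fastforce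
      then show ?thesis using piece[OF that] by blast
    qed
    have J0': "J 0 i = {u 0 i..<v 0 i} \<and> v 0 i \<le> n \<and> b + card \<J> \<le> card (J 0 i)" if "i < l" for i
      using J[of 0 i] J0[of i] that by simp
    obtain R x where R: "R \<subseteq> \<J>" "K * card R \<le> card \<J>" and
      x: "\<And>j. j \<in> \<J> - R \<Longrightarrow> x j \<in> PiE {..<l} (J 0) \<and> (\<forall>e\<in>copy_edges (P j) (S j) (x j). X e)"
      "\<And>j k i. j \<in> \<J> - R \<Longrightarrow> k \<in> \<J> - R \<Longrightarrow> i < l \<Longrightarrow> x j i = x k i \<Longrightarrow> j = k"
      by (rule embed_round[OF good b l fin J0' d0 p0 S]) blast+
    then show ?case by (intro exI[of _ R] exI[of _ x]) (auto simp: PiE_iff)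
  next
    case (Suc t)
    then obtain R x where R: "R \<subseteq> \<J>" "K ^ Suc t * card R \<le> card \<J>" and
      x: "\<forall>j\<in>\<J> - R. (\<forall>i<l. x j i \<in> (\<Union>s\<le>t. J s i)) \<and> (\<forall>e\<in>copy_edges (P j) (S j) (x j). X e)"
      "\<forall>j\<in>\<J> - R. \<forall>k\<in>\<J> - R. \<forall>i<l. x j i = x k i \<longrightarrow> j = k"
      by auto
    let ?J = "J (Suc t)"
    have finR: "finite R" "card R \<le> n"
      using R fin finite_subset card_mono[OF fin(1) R(1)] by auto
    \<comment> \<open>After round 0 at most n / K \<le> b pieces are missing, so an interval of
      \<open>2 * b\<close> vertices still has \<open>b\<close> free ones after the copies of a
      further round are removed.\<close>
    have "K * card R \<le> K ^ Suc t * card R"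
      using K self_le_power[of K "Suc t"] by (intro mult_right_mono) auto
    also have "\<dots> \<le> n" using R fin by simp
    also have "\<dots> \<le> K * b" by (rule K)
    finally have "card R \<le> b" using K by simp
    then have JS: "?J i = {u (Suc t) i..<v (Suc t) i} \<and> v (Suc t) i \<le> n \<and> b + card R \<le> card (?J i)" if "i < l" for i
      using J[of "Suc t" i] Jt[of "Suc t" i] Suc.prems that by simp
    have d0: "disjoint_family_on ?J {..<l}"
      unfolding disjoint_family_on_def using disj[of "Suc t" "Suc t"] Suc.prems by auto
    have p0: "sparse_piece d l (P j) (S j) \<and> snd ` S j \<subseteq> {..<n} - (\<Union>i<l. ?J i)" if "j \<in> R" for j
    proof -
      have "(\<Union>i<l. ?J i) \<subseteq> (\<Union>t\<le>T. \<Union>i<l. J t i)" using Suc.prems by fastforce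
      then show ?thesis using piece[of j] R that by blast
    qed
    have SR: "S j \<inter> S k = {}" if "j \<in> R" "k \<in> R" "j \<noteq> k" for j k
      using S that R by blast
    obtain R' x' where R': "R' \<subseteq> R" "K * card R' \<le> card R" and
      x': "\<And>j. j \<in> R - R' \<Longrightarrow> x' j \<in> PiE {..<l} ?J \<and> (\<forall>e\<in>copy_edges (P j) (S j) (x' j). X e)"
      "\<And>j k i. j \<in> R - R' \<Longrightarrow> k \<in> R - R' \<Longrightarrow> i < l \<Longrightarrow> x' j i = x' k i \<Longrightarrow> j = k"
      by (rule embed_round[OF good b l finR JS d0 p0 SR]) blast+
    define y where "y = (\<lambda>j. if j \<in> R then x' j else x j)"
    have yin: "y j i \<in> ?J i" if "j \<in> R - R'" "i < l" for j i
      using x'(1)[OF that(1)] that by (auto simp: y_def)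
    have yout: "y j i \<in> (\<Union>s\<le>t. J s i)" if "j \<in> \<J> - R" "i < l" for j i
      using x(1) that by (auto simp: y_def)
    have new: "y j i \<notin> (\<Union>s\<le>t. J s i)" if "j \<in> R - R'" "i < l" for j i
    proof
      assume "y j i \<in> (\<Union>s\<le>t. J s i)"
      then obtain s where "s \<le> t" "y j i \<in> J s i" by blast
      then show False using disj[of "Suc t" s i i] yin[OF that] that Suc.prems by auto
    qed
    have cases: "j \<in> R - R' \<or> j \<in> \<J> - R" if "j \<in> \<J> - R'" for j using that R by blast
    have "K ^ Suc (Suc t) * card R' = K ^ Suc t * (K * card R')" by simp
    also have "\<dots> \<le> K ^ Suc t * card R" by (intro mult_left_mono R') auto
    also have "\<dots> \<le> card \<J>" by (rule R)
    finally have 1: "K ^ Suc (Suc t) * card R' \<le> card \<J>" .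
    have 2: "\<forall>j\<in>\<J> - R'. (\<forall>i<l. y j i \<in> (\<Union>s\<le>Suc t. J s i)) \<and> (\<forall>e\<in>copy_edges (P j) (S j) (y j). X e)"
    proof
      fix j assume "j \<in> \<J> - R'"
      then consider "j \<in> R - R'" | "j \<in> \<J> - R" using cases by blast
      then show "(\<forall>i<l. y j i \<in> (\<Union>s\<le>Suc t. J s i)) \<and> (\<forall>e\<in>copy_edges (P j) (S j) (y j). X e)"
      proof cases
        case 1
        then show ?thesis using yin[OF 1] x'(1)[OF 1] by (auto simp: y_def)
      next
        case 2
        then show ?thesis using yout[OF 2] x(1) by (fastforce simp: y_def)
      qed
    qed
    have 3: "\<forall>j\<in>\<J> - R'. \<forall>k\<in>\<J> - R'. \<forall>i<l. y j i = y k i \<longrightarrow> j = k"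
    proof (intro ballI allI impI)
      fix j k i assume jk: "j \<in> \<J> - R'" "k \<in> \<J> - R'" "i < l" "y j i = y k i"
      consider "j \<in> R - R'" "k \<in> R - R'" | "j \<in> \<J> - R" "k \<in> \<J> - R"
        | "j \<in> R - R'" "k \<in> \<J> - R" | "j \<in> \<J> - R" "k \<in> R - R'"
        using cases jk by blast
      then show "j = k"
      proof cases
        case 1 then show ?thesis using x'(2)[of j k i] jk by (auto simp: y_def)
      next
        case 2 then show ?thesis using x(2) jk by (auto simp: y_def)
      next
        case 3 then show ?thesis using new[of j i] yout[of k i] jk by auto
      next
        case 4 then show ?thesis using new[of k i] yout[of j i] jk by auto
      qed
    qed
    show ?case
      by (rule exI[of _ R'], rule exI[of _ y]) (use 1 2 3 R R' in blast)
  qed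
  from this[OF order_refl] obtain R x where R: "R \<subseteq> \<J>" "K ^ Suc T * card R \<le> card \<J>" and
      x: "\<forall>j\<in>\<J> - R. (\<forall>i<l. x j i \<in> (\<Union>s\<le>T. J s i)) \<and> (\<forall>e\<in>copy_edges (P j) (S j) (x j). X e)"
      "\<forall>j\<in>\<J> - R. \<forall>k\<in>\<J> - R. \<forall>i<l. x j i = x k i \<longrightarrow> j = k"
    by blast
  have "card R = 0"
  proof (rule ccontr)
    assume "card R \<noteq> 0"
    then have "K ^ Suc T * 1 \<le> K ^ Suc T * card R" by (intro mult_left_mono) auto
    then show False using R fin K by linarith
  qed
  then have "R = {}" using R fin finite_subset by fastforce
  show thesis
  proof (rule that[of x])
    fix j k i i' assume a: "j \<in> \<J>" "k \<in> \<J>" "i < l" "i' < l" "x j i = x k i'"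
    have "x j i \<in> (\<Union>s\<le>T. J s i)" if "j \<in> \<J>" "i < l" for j i
      using x(1) \<open>R = {}\<close> that by simp
    from this[OF a(1,3)] this[OF a(2,4)] obtain s s' where "s \<le> T" "s' \<le> T" "x j i \<in> J s i" "x k i' \<in> J s' i'"
      by blast
    then have "i = i'" using disj[of s s' i i'] a by auto
    then show "j = k \<and> i = i'" using x(2) a \<open>R = {}\<close> by blast
  qed (use x \<open>R = {}\<close> in auto)
qed

section \<open>Placing all batches in the host graph\<close>

lemma disjoint_intervals_exist:
  fixes len :: "'w \<Rightarrow> nat"
  assumes "finite \<Omega>"
  shows "\<exists>s. (\<forall>w\<in>\<Omega>. s w + len w \<le> (\<Sum>w\<in>\<Omega>. len w)) \<and>
    (\<forall>w\<in>\<Omega>. \<forall>w'\<in>\<Omega>. w \<noteq> w' \<longrightarrow> {s w..<s w + len w} \<inter> {s w'..<s w' + len w'} = {})"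
  using assms
proof (induction \<Omega> rule: finite_induct)
  case (insert v \<Omega>)
  then obtain s where s: "\<forall>w\<in>\<Omega>. s w + len w \<le> (\<Sum>w\<in>\<Omega>. len w)"
    "\<forall>w\<in>\<Omega>. \<forall>w'\<in>\<Omega>. w \<noteq> w' \<longrightarrow> {s w..<s w + len w} \<inter> {s w'..<s w' + len w'} = {}"
    by auto
  let ?s = "s(v := \<Sum>w\<in>\<Omega>. len w)"
  have sep: "{?s w..<?s w + len w} \<inter> {?s v..<?s v + len v} = {}" if "w \<in> \<Omega>" for w
    using s(1) that insert by auto
  have "\<forall>w\<in>insert v \<Omega>. \<forall>w'\<in>insert v \<Omega>. w \<noteq> w' \<longrightarrow> {?s w..<?s w + len w} \<inter> {?s w'..<?s w' + len w'} = {}"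
  proof (intro ballI impI)
    fix w w' assume w: "w \<in> insert v \<Omega>" "w' \<in> insert v \<Omega>" "w \<noteq> w'"
    then consider "w = v" "w' \<in> \<Omega>" | "w' = v" "w \<in> \<Omega>" | "w \<in> \<Omega>" "w' \<in> \<Omega>" "w \<noteq> v" "w' \<noteq> v" by blast
    then show "{?s w..<?s w + len w} \<inter> {?s w'..<?s w' + len w'} = {}"
    proof cases
      case 1 then show ?thesis using sep[of w'] by (simp add: Int_commute)
    next
      case 2 then show ?thesis using sep[of w] by simp
    next
      case 3 then show ?thesis using s(2) w(3) by simp
    qed
  qed
  moreover have "\<forall>w\<in>insert v \<Omega>. ?s w + len w \<le> (\<Sum>w\<in>insert v \<Omega>. len w)"
    using s(1) insert by fastforce
  ultimately show ?case by blast
qed simp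

text \<open>The batches \<open>\<G> 0, \<dots>, \<G> (k - 1)\<close> are embedded in this order, the pieces of one batch
  simultaneously.\<close>

definition layering :: "nat \<Rightarrow> 'v set \<Rightarrow> 'v set set \<Rightarrow> nat \<Rightarrow> (nat \<Rightarrow> 'v set set) \<Rightarrow> (nat \<Rightarrow> nat) \<Rightarrow> bool" where
  "layering d V E k \<G> l \<longleftrightarrow>
     (\<Union>g<k. \<Union>(\<G> g)) = V \<and>
     (\<forall>g<k. finite (\<G> g) \<and> 1 \<le> l g \<and> (\<forall>F\<in>\<G> g. finite F \<and> card F = l g)) \<and>
     (\<forall>g<k. \<forall>h<k. \<forall>F\<in>\<G> g. \<forall>F'\<in>\<G> h. F \<inter> F' \<noteq> {} \<longrightarrow> g = h \<and> F = F') \<and>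
     (\<forall>g<k. \<forall>F\<in>\<G> g. \<forall>F'\<in>\<G> g. F \<noteq> F' \<longrightarrow>
        (\<forall>u\<in>F. \<forall>u'\<in>F'. {u, u'} \<notin> E \<and> (\<forall>w. \<not> ({u, w} \<in> E \<and> {u', w} \<in> E)))) \<and>
     (\<forall>g<k. \<forall>F\<in>\<G> g. \<forall>T\<subseteq>F. card {e\<in>E. e \<subseteq> T} \<le> card T \<and>
        card {e\<in>E. e \<subseteq> T} + card {(u, w). u \<in> T \<and> w \<in> (\<Union>h<g. \<Union>(\<G> h)) \<and> {u, w} \<in> E} \<le> d * card T)"

text \<open>The numbering \<open>f\<close> transports the edge counts of \<open>F\<close> to
  indices. Passing from earlier vertices to their images under \<open>\<phi>\<close> can only merge
  constraints, so the counts in the graph remain upper bounds.\<close>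

lemma sparse_piece_of_layer:
  assumes E: "E \<subseteq> vertex_pairs V" "finite V" and W: "finite W"
    and f: "bij_betw f {..<l} F"
    and F: "\<And>T. T \<subseteq> F \<Longrightarrow> card {e\<in>E. e \<subseteq> T} \<le> card T \<and>
        card {e\<in>E. e \<subseteq> T} + card {(u, w). u \<in> T \<and> w \<in> W \<and> {u, w} \<in> E} \<le> d * card T"
  shows "sparse_piece d l {(a, c). a < c \<and> c < l \<and> {f a, f c} \<in> E}
    ((\<lambda>(i, w). (i, \<phi> w)) ` {(i, w). i < l \<and> w \<in> W \<and> {f i, w} \<in> E})"
  unfolding sparse_piece_def
proof (intro conjI allI impI)
  define P where "P = {(a, c). a < c \<and> c < l \<and> {f a, f c} \<in> E}"
  define S0 where "S0 = {(i, w). i < l \<and> w \<in> W \<and> {f i, w} \<in> E}"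
  show "P \<subseteq> {(a, c). a < c \<and> c < l}" by (auto simp: P_def)
  have "S0 \<subseteq> {..<l} \<times> W" by (auto simp: S0_def)
  then have finS0: "finite S0" by (rule finite_subset) (use W in simp)
  then show "finite ((\<lambda>(i, w). (i, \<phi> w)) ` S0)" by simp
  show "fst ` (\<lambda>(i, w). (i, \<phi> w)) ` S0 \<subseteq> {..<l}" by (auto simp: S0_def)
  have inj: "inj_on f {..<l}" and im: "f ` {..<l} = F" using f by (auto simp: bij_betw_def)
  have finE: "finite E"
  proof (rule finite_subset[of _ "Pow V"])
    show "E \<subseteq> Pow V" using E by (auto simp: vertex_pairs_def)
  qed (use E in simp)
  fix T assume T: "T \<subseteq> {..<l}"
  have injT: "inj_on f T" using inj T by (rule inj_on_subset)
  have cT: "card (f ` T) = card T" using injT by (rule card_image)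
  have fT: "f ` T \<subseteq> F" using T im by blast
  have finT: "finite T" using T finite_subset by blast
  have 1: "card {(a, c)\<in>P. a \<in> T \<and> c \<in> T} \<le> card {e\<in>E. e \<subseteq> f ` T}"
  proof (rule card_inj_on_le[of "\<lambda>(a, c). {f a, f c}"])
    show "inj_on (\<lambda>(a, c). {f a, f c}) {(a, c)\<in>P. a \<in> T \<and> c \<in> T}"
    proof (rule inj_onI, clarify)
      fix a c a' c' assume h: "(a, c) \<in> P" "a \<in> T" "c \<in> T" "(a', c') \<in> P" "a' \<in> T" "c' \<in> T"
        "{f a, f c} = {f a', f c'}"
      then have "a < c" "a' < c'" by (auto simp: P_def)
      moreover have "f ` {a, c} = f ` {a', c'}" using h by simp
      then have "{a, c} = {a', c'}" using h by (intro inj_on_image_eq_iff[OF injT, THEN iffD1]) auto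
      ultimately show "a = a' \<and> c = c'" by (auto simp: doubleton_eq_iff)
    qed
  qed (use finE in \<open>auto simp: P_def\<close>)
  have 2: "card {(i, s)\<in>(\<lambda>(i, w). (i, \<phi> w)) ` S0. i \<in> T} \<le> card {(u, w). u \<in> f ` T \<and> w \<in> W \<and> {u, w} \<in> E}"
  proof -
    have "{(i, s)\<in>(\<lambda>(i, w). (i, \<phi> w)) ` S0. i \<in> T} \<subseteq> (\<lambda>(i, w). (i, \<phi> w)) ` {(i, w)\<in>S0. i \<in> T}" by auto
    then have "card {(i, s)\<in>(\<lambda>(i, w). (i, \<phi> w)) ` S0. i \<in> T} \<le> card {(i, w)\<in>S0. i \<in> T}"
      using finS0 by (intro surj_card_le) (auto intro: rev_finite_subset)
    also have "\<dots> \<le> card {(u, w). u \<in> f ` T \<and> w \<in> W \<and> {u, w} \<in> E}"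
    proof (rule card_inj_on_le[of "\<lambda>(i, w). (f i, w)"])
      show "inj_on (\<lambda>(i, w). (f i, w)) {(i, w)\<in>S0. i \<in> T}"
        using injT by (auto simp: inj_on_def)
      show "finite {(u, w). u \<in> f ` T \<and> w \<in> W \<and> {u, w} \<in> E}"
        using finT W by (rule_tac finite_subset[of _ "f ` T \<times> W"]) auto
    qed (auto simp: S0_def)
    finally show ?thesis .
  qed
  show "card {(a, c)\<in>P. a \<in> T \<and> c \<in> T} \<le> card T"
    using 1 F[OF fT] cT by linarith
  show "card {(a, c)\<in>P. a \<in> T \<and> c \<in> T} + card {(i, s)\<in>(\<lambda>(i, w). (i, \<phi> w)) ` S0. i \<in> T} \<le> d * card T"
    using 1 2 F[OF fT] unfolding cT by linarith
qed

text \<open>The batches go one after the other into disjoint areas. Images of earlier batches lie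
  outside the present area, hence are admissible attached vertices, and \<open>expanding\<close>
  holds for every choice of them; so the dependence of these images on the graph does no
  harm.\<close>

lemma embed_layering:
  assumes good: "expanding n L d b K X" and b: "1 \<le> b"
    and K: "n \<le> K * b" "n < K ^ Suc T" "1 \<le> K"
    and V: "finite V" and E: "E \<subseteq> vertex_pairs V"
    and lay: "layering d V E k \<G> l" and lL: "\<And>g. g < k \<Longrightarrow> l g \<le> L"
    and space: "(\<Sum>g<k. l g * (card (\<G> g) + b + T * (2 * b))) \<le> n"
  shows "\<exists>\<phi>. inj_on \<phi> V \<and> \<phi> ` V \<subseteq> {..<n} \<and> (\<forall>e\<in>E. X (\<phi> ` e))"
proof -
  define W where "W = (\<lambda>g. \<Union>h<g. \<Union>(\<G> h))"
  have WV: "W k = V" using lay by (simp add: layering_def W_def)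
  have WVg: "W g \<subseteq> V" if "g \<le> k" for g
    using that unfolding WV[symmetric] W_def by fastforce
  have finW: "finite (W g)" if "g \<le> k" for g using WVg[OF that] V finite_subset by blast
  have lay2: "finite (\<G> g)" "1 \<le> l g" "\<And>F. F \<in> \<G> g \<Longrightarrow> finite F \<and> card F = l g" if "g < k" for g
    using lay[unfolded layering_def, THEN conjunct2, THEN conjunct1] that by blast+
  have lay3: "g = h \<and> F = F'" if "g < k" "h < k" "F \<in> \<G> g" "F' \<in> \<G> h" "u \<in> F" "u \<in> F'" for g h F F' u
  proof -
    have "F \<inter> F' \<noteq> {}" using that by blast
    then show ?thesis
      using lay[unfolded layering_def, THEN conjunct2, THEN conjunct2, THEN conjunct1] that by blast
  qed
  have lay4: "{u, u'} \<notin> E" "\<not> ({u, w} \<in> E \<and> {u', w} \<in> E)"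
    if "g < k" "F \<in> \<G> g" "F' \<in> \<G> g" "F \<noteq> F'" "u \<in> F" "u' \<in> F'" for g F F' u u' w
    using lay[unfolded layering_def, THEN conjunct2, THEN conjunct2, THEN conjunct2, THEN conjunct1] that
    by blast+
  have lay5: "card {e\<in>E. e \<subseteq> T} \<le> card T \<and>
        card {e\<in>E. e \<subseteq> T} + card {(u, w). u \<in> T \<and> w \<in> W g \<and> {u, w} \<in> E} \<le> d * card T"
    if "g < k" "F \<in> \<G> g" "T \<subseteq> F" for g F T
    using lay[unfolded layering_def, THEN conjunct2, THEN conjunct2, THEN conjunct2, THEN conjunct2] that
    unfolding W_def by blast
  define \<Omega> where "\<Omega> = Sigma {..<k} (\<lambda>g. {..T} \<times> {..<l g})"
  \<comment> \<open>There is one interval for each batch \<open>g\<close>, round \<open>t\<close>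
    and position \<open>i\<close>. In round 0 it has room for all pieces of the batch and
    \<open>b\<close> spare vertices; in later rounds at most \<open>b\<close> pieces are
    missing.\<close>
  define len where "len = (\<lambda>(g, t, i::nat). if t = (0::nat) then card (\<G> g) + b else 2 * b)"
  have fin\<Omega>: "finite \<Omega>" by (simp add: \<Omega>_def)
  have "(\<Sum>w\<in>\<Omega>. len w) = (\<Sum>g<k. \<Sum>t\<le>T. \<Sum>i<l g. len (g, t, i))"
    unfolding \<Omega>_def by (simp add: sum.Sigma)
  also have "\<dots> = (\<Sum>g<k. l g * (card (\<G> g) + b + T * (2 * b)))"
  proof (intro sum.cong refl)
    fix g
    have "(\<Sum>t\<le>T. \<Sum>i<l g. len (g, t, i)) = (\<Sum>t\<le>T. l g * (if t = 0 then card (\<G> g) + b else 2 * b))"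
      by (intro sum.cong) (auto simp: len_def)
    also have "\<dots> = l g * (card (\<G> g) + b) + (\<Sum>t\<in>{1..T}. l g * (2 * b))"
      by (subst sum.atMost_shift) (simp add: sum.atLeast1_atMost_eq)
    finally show "(\<Sum>t\<le>T. \<Sum>i<l g. len (g, t, i)) = l g * (card (\<G> g) + b + T * (2 * b))"
      by (simp add: algebra_simps)
  qed
  finally have sumlen: "(\<Sum>w\<in>\<Omega>. len w) \<le> n" using space by simp
  obtain s where s: "(\<forall>w\<in>\<Omega>. s w + len w \<le> (\<Sum>w\<in>\<Omega>. len w)) \<and>
      (\<forall>w\<in>\<Omega>. \<forall>w'\<in>\<Omega>. w \<noteq> w' \<longrightarrow> {s w..<s w + len w} \<inter> {s w'..<s w' + len w'} = {})"
    using disjoint_intervals_exist[OF fin\<Omega>, of len] by (rule exE)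
  note s1 = bspec[OF conjunct1[OF s]]
  note s2 = conjunct2[OF s, rule_format]
  define J where "J = (\<lambda>g t i. {s (g, t, i)..<s (g, t, i) + len (g, t, i)})"
  define area where "area = (\<lambda>g. \<Union>t\<le>T. \<Union>i<l g. J g t i)"
  have Jdisj: "g = g' \<and> t = t' \<and> i = i'"
    if "g < k" "g' < k" "t \<le> T" "t' \<le> T" "i < l g" "i' < l g'" "J g t i \<inter> J g' t' i' \<noteq> {}" for g g' t t' i i'
    using s2[of "(g, t, i)" "(g', t', i')"] that by (auto simp: J_def \<Omega>_def)
  have Jn: "s (g, t, i) + len (g, t, i) \<le> n" if "g < k" "t \<le> T" "i < l g" for g t i
    using s1[of "(g, t, i)"] that sumlen by (simp add: \<Omega>_def)
  have area_disj: "g = h" if gh: "g < k" "h < k" "y \<in> area g" "y \<in> area h" for g h y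
  proof -
    obtain t i t' i' where "t \<le> T" "i < l g" "y \<in> J g t i" "t' \<le> T" "i' < l h" "y \<in> J h t' i'"
      using gh(3,4) unfolding area_def by blast
    then show ?thesis using Jdisj[of g h t t' i i'] gh by blast
  qed
  have area_n: "area g \<subseteq> {..<n}" if "g < k" for g
    using Jn[OF that] unfolding area_def J_def by fastforce
  have "\<exists>\<phi>. inj_on \<phi> (W g) \<and> (\<forall>h<g. \<phi> ` \<Union>(\<G> h) \<subseteq> area h) \<and> (\<forall>e\<in>E. e \<subseteq> W g \<longrightarrow> X (\<phi> ` e))"
    if "g \<le> k" for g
    using that
  proof (induction g)
    case 0
    have "e \<noteq> {}" if "e \<in> E" for e using E that by (auto simp: vertex_pairs_def)
    then show ?case by (auto simp: W_def)
  next
    case (Suc g)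
    then have g: "g < k" by simp
    from Suc obtain \<phi> where \<phi>: "inj_on \<phi> (W g)" "\<And>h. h < g \<Longrightarrow> \<phi> ` \<Union>(\<G> h) \<subseteq> area h"
      "\<And>e. e \<in> E \<Longrightarrow> e \<subseteq> W g \<Longrightarrow> X (\<phi> ` e)" by auto
    have \<phi>area: "\<phi> w \<in> {..<n} - area g" if "w \<in> W g" for w
    proof -
      obtain h where "h < g" "w \<in> \<Union>(\<G> h)" using \<open>w \<in> W g\<close> unfolding W_def by blast
      then show ?thesis using \<phi>(2)[of h] area_disj[of g h "\<phi> w"] area_n[of h] g by fastforce
    qed
    have "\<exists>f. \<forall>F\<in>\<G> g. bij_betw (f F) {..<l g} F"
    proof -
      have "\<exists>f. bij_betw f {..<l g} F" if "F \<in> \<G> g" for F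
        using lay2(3)[OF g that] ex_bij_betw_nat_finite[of F] by (auto simp: atLeast0LessThan)
      then show ?thesis by metis
    qed
    then obtain f where f: "\<And>F. F \<in> \<G> g \<Longrightarrow> bij_betw (f F) {..<l g} F" by blast
    define P where "P = (\<lambda>F. {(a, c). a < c \<and> c < l g \<and> {f F a, f F c} \<in> E})"
    define S where "S = (\<lambda>F. (\<lambda>(i, w). (i, \<phi> w)) ` {(i, w). i < l g \<and> w \<in> W g \<and> {f F i, w} \<in> E})"
    have fF: "f F i \<in> F" if "F \<in> \<G> g" "i < l g" for F i using bij_betwE[OF f[OF that(1)]] that by blast
    have piece: "sparse_piece d (l g) (P F) (S F) \<and> snd ` S F \<subseteq> {..<n} - (\<Union>t\<le>T. \<Union>i<l g. J g t i)"
      if F: "F \<in> \<G> g" for F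
    proof
      show "sparse_piece d (l g) (P F) (S F)"
        unfolding P_def S_def using lay5[OF g F] finW g
        by (intro sparse_piece_of_layer[OF E V _ f[OF F]]) auto
      show "snd ` S F \<subseteq> {..<n} - (\<Union>t\<le>T. \<Union>i<l g. J g t i)"
        using \<phi>area unfolding S_def area_def by auto
    qed
    \<comment> \<open>A common pair would, by injectivity of \<open>\<phi>\<close> on the earlier
      vertices, give two pieces of the batch a common neighbour, which a layering forbids.\<close>
    have Sdisj: "S F \<inter> S F' = {}" if F: "F \<in> \<G> g" "F' \<in> \<G> g" "F \<noteq> F'" for F F'
    proof (rule ccontr)
      assume "S F \<inter> S F' \<noteq> {}"
      then obtain i w w' where i: "i < l g" "w \<in> W g" "w' \<in> W g" "{f F i, w} \<in> E" "{f F' i, w'} \<in> E" "\<phi> w = \<phi> w'"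
        unfolding S_def by auto
      then have "w = w'" using \<phi>(1) by (auto simp: inj_on_def)
      then show False using lay4(2)[OF g F fF[OF F(1)] fF[OF F(2)]] i by blast
    qed
    have "l g * (card (\<G> g) + b + T * (2 * b)) \<le> n"
      using member_le_sum[of g "{..<k}" "\<lambda>g. l g * (card (\<G> g) + b + T * (2 * b))"] g space by simp
    moreover have "1 * card (\<G> g) \<le> l g * (card (\<G> g) + b + T * (2 * b))"
      using lay2(2)[OF g] by (intro mult_mono) auto
    ultimately have c\<G>: "card (\<G> g) \<le> n" by linarith
    have Jeq: "J g t i = {s (g, t, i)..<s (g, t, i) + len (g, t, i)} \<and> s (g, t, i) + len (g, t, i) \<le> n"
      if "t \<le> T" "i < l g" for t i
      using Jn[OF g that] by (simp add: J_def)
    have J0: "b + card (\<G> g) \<le> card (J g 0 i)" for i by (simp add: J_def len_def)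
    have Jt: "2 * b \<le> card (J g t i)" if "1 \<le> t" for t i using that by (simp add: J_def len_def)
    have Jd: "t = t' \<and> i = i'" if "t \<le> T" "t' \<le> T" "i < l g" "i' < l g" "J g t i \<inter> J g t' i' \<noteq> {}" for t i t' i'
      using Jdisj[OF g g] that by blast
    obtain x where x1: "\<And>F i. F \<in> \<G> g \<Longrightarrow> i < l g \<Longrightarrow> x F i \<in> area g"
      and x2: "\<And>F e. F \<in> \<G> g \<Longrightarrow> e \<in> copy_edges (P F) (S F) (x F) \<Longrightarrow> X e"
      and x3: "\<And>F F' i i'. F \<in> \<G> g \<Longrightarrow> F' \<in> \<G> g \<Longrightarrow> i < l g \<Longrightarrow> i' < l g \<Longrightarrow> x F i = x F' i' \<Longrightarrow> F = F' \<and> i = i'"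
    proof (rule embed_group[OF good b lay2(2)[OF g] lL[OF g] K lay2(1)[OF g] c\<G>,
          where J = "J g" and u = "\<lambda>t i. s (g, t, i)" and v = "\<lambda>t i. s (g, t, i) + len (g, t, i)" and P = P and S = S])
      fix x assume 1: "\<And>F i. F \<in> \<G> g \<Longrightarrow> i < l g \<Longrightarrow> x F i \<in> (\<Union>t\<le>T. J g t i)"
        and 2: "\<And>F e. F \<in> \<G> g \<Longrightarrow> e \<in> copy_edges (P F) (S F) (x F) \<Longrightarrow> X e"
        and 3: "\<And>F F' i i'. F \<in> \<G> g \<Longrightarrow> F' \<in> \<G> g \<Longrightarrow> i < l g \<Longrightarrow> i' < l g \<Longrightarrow> x F i = x F' i' \<Longrightarrow> F = F' \<and> i = i'"
      show thesis
      proof (rule that[OF _ 2 3])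
        show "x F i \<in> area g" if "F \<in> \<G> g" "i < l g" for F i
          using 1[OF that] that unfolding area_def by blast
      qed
    qed (erule (1) Jeq, rule J0, erule Jt, erule (4) Jd, erule piece, erule (2) Sdisj)
    define Fo where "Fo = (\<lambda>u. SOME F. F \<in> \<G> g \<and> u \<in> F)"
    define \<psi> where "\<psi> = (\<lambda>u. if u \<in> W g then \<phi> u else x (Fo u) (the_inv_into {..<l g} (f (Fo u)) u))"
    have WG: "u \<notin> W g" if "F \<in> \<G> g" "u \<in> F" for F u
    proof
      assume "u \<in> W g"
      then obtain h F' where "h < g" "F' \<in> \<G> h" "u \<in> F'" unfolding W_def by blast
      then show False using lay3[of g h F F' u] that g by simp
    qed
    have \<psi>new: "\<psi> (f F i) = x F i" if F: "F \<in> \<G> g" and i: "i < l g" for F i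
    proof -
      have "Fo (f F i) = F"
        unfolding Fo_def by (rule some_equality) (use fF[OF F i] F lay3[OF g g] in blast)+
      moreover have "the_inv_into {..<l g} (f F) (f F i) = i"
        using f[OF F] i by (intro the_inv_into_f_f) (auto simp: bij_betw_def)
      ultimately show ?thesis using WG[OF F fF[OF F i]] by (simp add: \<psi>_def)
    qed
    have \<psi>old: "\<psi> u = \<phi> u" if "u \<in> W g" for u using that by (simp add: \<psi>_def)
    have rep: "\<exists>F i. F \<in> \<G> g \<and> i < l g \<and> u = f F i" if "u \<in> \<Union>(\<G> g)" for u
      using that f unfolding bij_betw_def by blast
    have WS: "W (Suc g) = W g \<union> \<Union>(\<G> g)" unfolding W_def lessThan_Suc by (simp add: Un_commute)
    have mixed: "\<psi> u \<noteq> \<psi> w" if u: "u \<in> W g" and w: "w \<in> \<Union>(\<G> g)" for u w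
    proof -
      obtain F i where "F \<in> \<G> g" "i < l g" "w = f F i" using rep[OF w] by blast
      then show ?thesis using \<psi>new[of F i] x1[of F i] \<psi>old[OF u] \<phi>area[OF u] by auto
    qed
    have "inj_on \<psi> (W (Suc g))"
    proof (rule inj_onI)
      fix u w assume uw: "u \<in> W (Suc g)" "w \<in> W (Suc g)" "\<psi> u = \<psi> w"
      then consider "u \<in> W g" "w \<in> W g" | "u \<in> \<Union>(\<G> g)" "w \<in> \<Union>(\<G> g)"
        using mixed[of u w] mixed[of w u] unfolding WS by auto
      then show "u = w"
      proof cases
        case 1 then show ?thesis using \<phi>(1) uw \<psi>old by (auto simp: inj_on_def)
      next
        case 2
        obtain F i where F: "F \<in> \<G> g" "i < l g" "u = f F i" using rep[OF 2(1)] by blast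
        obtain F' i' where F': "F' \<in> \<G> g" "i' < l g" "w = f F' i'" using rep[OF 2(2)] by blast
        show ?thesis using x3[of F F' i i'] F F' \<psi>new uw by auto
      qed
    qed
    moreover have "\<psi> ` \<Union>(\<G> h) \<subseteq> area h" if h: "h < Suc g" for h
    proof
      fix y assume "y \<in> \<psi> ` \<Union>(\<G> h)"
      then obtain u where u: "u \<in> \<Union>(\<G> h)" "y = \<psi> u" by blast
      show "y \<in> area h"
      proof (cases "h = g")
        case True
        then obtain F i where "F \<in> \<G> g" "i < l g" "u = f F i" using rep u by blast
        then show ?thesis using \<psi>new x1 u True by simp
      next
        case False
        then have "h < g" using h by simp
        moreover then have "u \<in> W g" using u unfolding W_def by blast
        ultimately show ?thesis using \<phi>(2)[of h] \<psi>old[of u] u by auto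
      qed
    qed
    moreover have "X (\<psi> ` e)" if e: "e \<in> E" "e \<subseteq> W (Suc g)" for e
    proof -
      have "card e = 2" using E e by (auto simp: vertex_pairs_def)
      then obtain u w where uw: "e = {u, w}" "u \<noteq> w" by (meson card_2_iff)
      have one: "X (\<psi> ` {u, w})" if one: "u \<in> \<Union>(\<G> g)" "w \<in> W g" "{u, w} \<in> E" for u w
      proof -
        obtain F i where F: "F \<in> \<G> g" "i < l g" "u = f F i" using rep[OF one(1)] by blast
        then have "(i, \<phi> w) \<in> S F" using one unfolding S_def by auto
        then have "{x F i, \<phi> w} \<in> copy_edges (P F) (S F) (x F)" unfolding copy_edges_iff by blast
        then show ?thesis using x2[OF F(1)] \<psi>new[OF F(1,2)] \<psi>old[OF one(2)] F(3) by simp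
      qed
      consider "u \<in> W g" "w \<in> W g" | "u \<in> \<Union>(\<G> g)" "w \<in> W g" | "u \<in> W g" "w \<in> \<Union>(\<G> g)"
        | "u \<in> \<Union>(\<G> g)" "w \<in> \<Union>(\<G> g)"
        using e uw unfolding WS by auto
      then show ?thesis
      proof cases
        case 1 then show ?thesis using \<phi>(3)[of e] e uw \<psi>old by simp
      next
        case 2 then show ?thesis using one[of u w] e uw by simp
      next
        case 3 then show ?thesis using one[of w u] e uw by (simp add: insert_commute)
      next
        case 4
        obtain F i where F: "F \<in> \<G> g" "i < l g" "u = f F i" using rep[OF 4(1)] by blast
        obtain F' i' where F': "F' \<in> \<G> g" "i' < l g" "w = f F' i'" using rep[OF 4(2)] by blast
        have FF: "F' = F"
          using lay4(1)[OF g F(1) F'(1) _ fF[OF F(1,2)] fF[OF F'(1,2)]] e uw F F' by auto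
        have "i < i' \<or> i' < i" using F F' FF uw by (metis linorder_neqE_nat)
        then have "{x F i, x F i'} \<in> copy_edges (P F) (S F) (x F)"
        proof
          assume "i < i'"
          then have "(i, i') \<in> P F" using F F' FF e uw by (auto simp: P_def)
          then show ?thesis unfolding copy_edges_iff by blast
        next
          assume "i' < i"
          then have "(i', i) \<in> P F" using F F' FF e uw by (auto simp: P_def insert_commute)
          then show ?thesis unfolding copy_edges_iff by (metis insert_commute)
        qed
        then show ?thesis using x2[OF F(1)] \<psi>new F F' FF uw by simp
      qed
    qed
    ultimately show ?case by blast
  qed
  from this[OF order_refl] obtain \<phi> where \<phi>: "inj_on \<phi> (W k) \<and>
      (\<forall>h<k. \<phi> ` \<Union>(\<G> h) \<subseteq> area h) \<and> (\<forall>e\<in>E. e \<subseteq> W k \<longrightarrow> X (\<phi> ` e))"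
    by (rule exE)
  have "\<phi> w \<in> {..<n}" if "w \<in> V" for w
  proof -
    obtain h F where h: "h < k" "F \<in> \<G> h" "w \<in> F" using \<open>w \<in> V\<close> WV unfolding W_def by blast
    then have "\<phi> w \<in> \<phi> ` \<Union>(\<G> h)" by blast
    also have "\<dots> \<subseteq> area h" using conjunct1[OF conjunct2[OF \<phi>]] h(1) by simp
    finally show ?thesis using area_n[OF h(1)] by blast
  qed
  then have "\<phi> ` V \<subseteq> {..<n}" by blast
  moreover have "e \<subseteq> W k" if "e \<in> E" for e using E that WV by (auto simp: vertex_pairs_def)
  ultimately show ?thesis using \<phi> WV by (intro exI[of _ \<phi>]) auto
qed

subsection \<open>Cutting a graph of bounded degree into pieces\<close>

lemma greedy_coloring:
  assumes "finite A" "\<And>u w. Q u w \<Longrightarrow> Q w u" "\<And>u. u \<in> A \<Longrightarrow> card {w\<in>A. Q u w} \<le> D"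
    "\<And>u. \<not> Q u u"
  shows "\<exists>col :: 'v \<Rightarrow> nat. (\<forall>u\<in>A. col u \<le> D) \<and> (\<forall>u\<in>A. \<forall>w\<in>A. Q u w \<longrightarrow> col u \<noteq> col w)"
  using assms(1,3)
proof (induction A rule: finite_induct)
  case (insert v A)
  have "card {w\<in>A. Q u w} \<le> D" if "u \<in> A" for u
  proof -
    have "card {w\<in>A. Q u w} \<le> card {w\<in>insert v A. Q u w}" using insert.hyps by (intro card_mono) auto
    then show ?thesis using insert.prems[of u] that by simp
  qed
  then obtain col where col: "\<forall>u\<in>A. col u \<le> D" "\<forall>u\<in>A. \<forall>w\<in>A. Q u w \<longrightarrow> col u \<noteq> (col w :: nat)"
    using insert.IH by blast
  let ?N = "{w\<in>A. Q v w}"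
  have "card (col ` ?N) \<le> card ?N" using insert.hyps by (intro card_image_le) auto
  also have "\<dots> \<le> card {w\<in>insert v A. Q v w}" using insert.hyps by (intro card_mono) auto
  also have "\<dots> \<le> D" using insert.prems by simp
  finally have "card (col ` ?N) < card {..D}" by simp
  then have "\<not> {..D} \<subseteq> col ` ?N"
    using insert.hyps card_mono[of "col ` ?N" "{..D}"] by auto
  then obtain c where c: "c \<le> D" "c \<notin> col ` ?N" by blast
  have "\<forall>u\<in>insert v A. \<forall>w\<in>insert v A. Q u w \<longrightarrow> (col(v := c)) u \<noteq> (col(v := c)) w"
    using col(2) c(2) assms(2,4) insert.hyps by auto
  moreover have "\<forall>u\<in>insert v A. (col(v := c)) u \<le> D" using col(1) c(1) by simp
  ultimately show ?case by blast
qed simp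

section \<open>Forests and induced cycles\<close>

locale edge_set =
  fixes V :: "'v set" and E :: "'v set set"
  assumes finV: "finite V" and E: "E \<subseteq> vertex_pairs V"
begin

definition nb :: "'v \<Rightarrow> 'v set" where
  "nb u = {w. {u, w} \<in> E}"

definition induced :: "'v set \<Rightarrow> 'v set set" where
  "induced U = {e\<in>E. e \<subseteq> U}"

lemma edgeD: "{u, w} \<in> E \<Longrightarrow> u \<in> V \<and> w \<in> V \<and> u \<noteq> w"
  using E by (auto simp: vertex_pairs_def)

lemma finE: "finite E"
proof (rule finite_subset[of _ "Pow V"])
  show "E \<subseteq> Pow V" using E by (auto simp: vertex_pairs_def)
qed (use finV in simp)

lemma fin_induced: "finite (induced U)"
  using finE by (simp add: induced_def)

lemma nb_subset: "nb u \<subseteq> V" and nb_irrefl: "u \<notin> nb u" and nb_sym: "w \<in> nb u \<longleftrightarrow> u \<in> nb w"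
  using edgeD[of u] edgeD[of u u] by (auto simp: nb_def insert_commute)

lemma fin_nb: "finite (nb u)"
  using finV nb_subset finite_subset by blast

lemma card_nb: "card (nb u) = card {e\<in>E. u \<in> e}"
proof (rule bij_betw_same_card[of "\<lambda>w. {u, w}"])
  have "\<exists>w. {u, w} \<in> E \<and> e = {u, w}" if "e \<in> E" "u \<in> e" for e
  proof -
    have "card e = 2" using E that by (auto simp: vertex_pairs_def)
    then obtain x y where "e = {x, y}" by (meson card_2_iff)
    then show ?thesis using that by (metis insertE insert_commute singletonD)
  qed
  then show "bij_betw (\<lambda>w. {u, w}) (nb u) {e\<in>E. u \<in> e}"
    unfolding bij_betw_def nb_def inj_on_def by (auto simp: doubleton_eq_iff)
qed

lemma induced_remove: "card (induced U) \<le> card (induced (U - {u})) + card (nb u \<inter> U)"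
proof -
  have "induced U \<subseteq> induced (U - {u}) \<union> (\<lambda>w. {u, w}) ` (nb u \<inter> U)"
  proof
    fix e assume e: "e \<in> induced U"
    show "e \<in> induced (U - {u}) \<union> (\<lambda>w. {u, w}) ` (nb u \<inter> U)"
    proof (cases "u \<in> e")
      case True
      have "card e = 2" using E e by (auto simp: vertex_pairs_def induced_def)
      then obtain x y where "e = {x, y}" by (meson card_2_iff)
      then obtain w where "e = {u, w}" using True by (metis insertE insert_commute singletonD)
      then show ?thesis using e by (auto simp: nb_def induced_def)
    qed (use e in \<open>auto simp: induced_def\<close>)
  qed
  then have "card (induced U) \<le> card (induced (U - {u}) \<union> (\<lambda>w. {u, w}) ` (nb u \<inter> U))"
    using fin_induced fin_nb by (intro card_mono) auto
  also have "\<dots> \<le> card (induced (U - {u})) + card ((\<lambda>w. {u, w}) ` (nb u \<inter> U))"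
    by (rule card_Un_le)
  also have "card ((\<lambda>w. {u, w}) ` (nb u \<inter> U)) \<le> card (nb u \<inter> U)"
    using fin_nb by (intro card_image_le) auto
  finally show ?thesis by simp
qed

text \<open>The last hypothesis says that \<open>U\<close> induces a forest. Removing a vertex with
  at most one neighbour in \<open>U\<close> loses at most one edge.\<close>

lemma card_induced_acyclic:
  assumes "finite U" "U \<noteq> {}" "\<And>W. W \<subseteq> U \<Longrightarrow> W \<noteq> {} \<Longrightarrow> \<exists>u\<in>W. card (nb u \<inter> W) \<le> 1"
  shows "card (induced U) + 1 \<le> card U"
  using assms
proof (induction "card U" arbitrary: U)
  case (Suc k)
  from Suc.prems(3)[of U] Suc.prems(2) obtain u where u: "u \<in> U" "card (nb u \<inter> U) \<le> 1" by blast
  have k: "card (U - {u}) = k" using Suc.hyps(2) u Suc.prems(1) by simp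
  show ?case
  proof (cases "U - {u} = {}")
    case True
    then have "U = {u}" using u by blast
    have "e \<notin> induced U" for e
    proof
      assume e: "e \<in> induced U"
      then have "card e \<le> card {u}" using \<open>U = {u}\<close> by (intro card_mono) (auto simp: induced_def)
      then show False using e E by (auto simp: induced_def vertex_pairs_def)
    qed
    then have "induced U = {}" by blast
    then show ?thesis using \<open>U = {u}\<close> by simp
  next
    case False
    have "card (induced (U - {u})) + 1 \<le> card (U - {u})"
      using Suc.hyps(1)[of "U - {u}"] k False Suc.prems by blast
    then show ?thesis using induced_remove[of U u] u k Suc.hyps(2) by linarith
  qed
qed simp

text \<open>These are the vertex sets of induced cycles.\<close>

definition core :: "'v set \<Rightarrow> bool" where
  "core F \<longleftrightarrow> F \<noteq> {} \<and> F \<subseteq> V \<and> (\<forall>u\<in>F. 2 \<le> card (nb u \<inter> F)) \<and>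
     (\<forall>T. T \<subset> F \<longrightarrow> T \<noteq> {} \<longrightarrow> (\<exists>u\<in>T. card (nb u \<inter> T) \<le> 1))"

lemma coreD:
  assumes "core F"
  shows "F \<noteq> {}" "F \<subseteq> V" "finite F"
proof -
  show "F \<noteq> {}" and F: "F \<subseteq> V" using assms by (simp_all add: core_def)
  show "finite F" using F finV by (rule finite_subset)
qed

text \<open>A set with at least as many edges as vertices does not induce a forest, so some nonempty
  subset has minimum degree at least 2. A smallest such subset is a core.\<close>

lemma core_exists:
  assumes U: "U \<subseteq> V" "U \<noteq> {}" "card U \<le> card (induced U)"
  shows "\<exists>F\<subseteq>U. core F"
proof -
  have finU: "finite U" using U finV finite_subset by blast
  define D where "D = (\<lambda>W. W \<subseteq> U \<and> W \<noteq> {} \<and> (\<forall>u\<in>W. 2 \<le> card (nb u \<inter> W)))"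
  have "\<exists>W. D W"
  proof (rule ccontr)
    assume "\<nexists>W. D W"
    then have "\<exists>u\<in>W. card (nb u \<inter> W) \<le> 1" if "W \<subseteq> U" "W \<noteq> {}" for W
      using that unfolding D_def by (metis Suc_1 not_less_eq_eq One_nat_def)
    then show False using card_induced_acyclic[OF finU U(2)] U(3) by force
  qed
  then obtain F where F: "D F" and min: "\<And>W. D W \<Longrightarrow> card F \<le> card W"
    using ex_has_least_nat[of D _ card] by metis
  have "\<exists>u\<in>T. card (nb u \<inter> T) \<le> 1" if "T \<subset> F" "T \<noteq> {}" for T
  proof (rule ccontr)
    assume "\<not> (\<exists>u\<in>T. card (nb u \<inter> T) \<le> 1)"
    then have "D T" using that F unfolding D_def by auto
    moreover have "card T < card F"
      using that F finU by (intro psubset_card_mono) (auto simp: D_def intro: finite_subset)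
    ultimately show False using min[of T] by simp
  qed
  then show ?thesis using F U unfolding D_def core_def by blast
qed

text \<open>The cyclic order is never made explicit. Proper subsets induce forests. For
  \<open>F\<close> itself, remove some \<open>u\<close>: the rest has a vertex \<open>w\<close> with
  at most one neighbour in it, hence at most two in \<open>F\<close>, and \<open>F - {w}\<close> is
  a forest with at most \<open>card F - 2\<close> edges.\<close>

lemma card_induced_core:
  assumes F: "core F" and T: "T \<subseteq> F"
  shows "card (induced T) \<le> card T"
proof -
  have finF: "finite F" using F by (rule coreD)
  have proper: "card (induced T) + 1 \<le> card T" if "T \<subset> F" "T \<noteq> {}" for T
    using F that finF unfolding core_def by (intro card_induced_acyclic) (auto intro: finite_subset)
  consider "T = {}" | "T \<subset> F" "T \<noteq> {}" | "T = F" using T by blast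
  then show ?thesis
  proof cases
    case 1
    then have "induced T = {}" using E by (auto simp: induced_def vertex_pairs_def)
    then show ?thesis by simp
  next
    case 2
    then show ?thesis using proper[OF 2] by simp
  next
    case 3
    obtain u where u: "u \<in> F" using F unfolding core_def by blast
    then have "F - {u} \<noteq> {}"
    proof -
      have "2 \<le> card (nb u \<inter> F)" using F u unfolding core_def by blast
      moreover have "nb u \<inter> F \<subseteq> F - {u}" using nb_irrefl by blast
      ultimately show ?thesis by (metis card.empty not_numeral_le_zero subset_empty)
    qed
    moreover have "F - {u} \<subset> F" using u by blast
    ultimately obtain w where w: "w \<in> F - {u}" "card (nb w \<inter> (F - {u})) \<le> 1"
      using F unfolding core_def by blast
    have "card (nb w \<inter> F) \<le> card (insert u (nb w \<inter> (F - {u})))"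
      using fin_nb by (intro card_mono) auto
    also have "\<dots> \<le> Suc (card (nb w \<inter> (F - {u})))" by (simp add: card_insert_le_m1 card_insert_if fin_nb)
    finally have "card (nb w \<inter> F) \<le> 2" using w by simp
    moreover have "card (induced (F - {w})) + 1 \<le> card (F - {w})"
      using w u by (intro proper) auto
    moreover have "card F = Suc (card (F - {w}))" using w finF by (intro card.remove) auto
    ultimately show ?thesis using induced_remove[of F w] unfolding 3 by linarith
  qed
qed

text \<open>Each vertex of \<open>F\<close> has two neighbours inside \<open>F\<close>, so at most
  \<open>\<Delta> - 2\<close> in \<open>W\<close>; the inner edges add at most one per vertex of
  \<open>T\<close>.\<close>

lemma core_extension:
  assumes F: "core F" and T: "T \<subseteq> F" and W: "W \<inter> F = {}"
    and deg: "\<And>u. u \<in> F \<Longrightarrow> card (nb u) \<le> \<Delta>" and \<Delta>: "2 \<le> \<Delta>"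
  shows "card (induced T) + card {(u, w). u \<in> T \<and> w \<in> W \<and> {u, w} \<in> E} \<le> (\<Delta> - 1) * card T"
proof -
  have finT: "finite T" using T coreD(3)[OF F] by (rule finite_subset)
  have "{(u, w). u \<in> T \<and> w \<in> W \<and> {u, w} \<in> E} = Sigma T (\<lambda>u. nb u \<inter> W)"
    by (auto simp: nb_def)
  then have "card {(u, w). u \<in> T \<and> w \<in> W \<and> {u, w} \<in> E} = (\<Sum>u\<in>T. card (nb u \<inter> W))"
    using finT fin_nb by simp
  also have "\<dots> \<le> (\<Sum>u\<in>T. \<Delta> - 2)"
  proof (rule sum_mono)
    fix u assume "u \<in> T"
    then have u: "u \<in> F" using T by blast
    have "card (nb u \<inter> W) + card (nb u \<inter> F) = card ((nb u \<inter> W) \<union> (nb u \<inter> F))"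
      using fin_nb W by (subst card_Un_disjoint) auto
    also have "\<dots> \<le> card (nb u)" using fin_nb by (intro card_mono) auto
    also have "\<dots> \<le> \<Delta>" by (rule deg[OF u])
    finally have "card (nb u \<inter> W) + card (nb u \<inter> F) \<le> \<Delta>" .
    moreover have "2 \<le> card (nb u \<inter> F)" using F u unfolding core_def by blast
    ultimately show "card (nb u \<inter> W) \<le> \<Delta> - 2" by linarith
  qed
  finally have "card {(u, w). u \<in> T \<and> w \<in> W \<and> {u, w} \<in> E} \<le> card T * (\<Delta> - 2)" by simp
  moreover have "(\<Delta> - 1) * card T = card T + card T * (\<Delta> - 2)"
  proof -
    have "\<Delta> - 1 = Suc (\<Delta> - 2)" using \<Delta> by simp
    then show ?thesis by (simp add: mult.commute)
  qed
  ultimately show ?thesis using card_induced_core[OF F T] by linarith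
qed

section \<open>Distances and short cycles\<close>

definition adj :: "('v \<times> 'v) set" where
  "adj = {(u, w). {u, w} \<in> E}"

lemma adj_sym: "(u, w) \<in> adj \<Longrightarrow> (w, u) \<in> adj"
  by (simp add: adj_def insert_commute)

lemma adj_relpow_sym: "(u, w) \<in> adj ^^ k \<Longrightarrow> (w, u) \<in> adj ^^ k"
proof (induction k arbitrary: u)
  case (Suc k)
  from Suc.prems obtain x where "(u, x) \<in> adj" "(x, w) \<in> adj ^^ k" by (metis relpow_Suc_D2)
  then show ?case using Suc.IH adj_sym by (metis relpow_Suc_I)
qed simp

definition nball :: "'v \<Rightarrow> nat \<Rightarrow> 'v set" where
  "nball v r = {u. \<exists>k\<le>r. (v, u) \<in> adj ^^ k}"

text \<open>If a breadth-first search tree from \<open>v\<close> misses no edge up to depth \<open>r\<close>, then its levels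
  double in size. Otherwise the tree paths from the ends of a missed edge to \<open>v\<close> span at least as
  many edges as vertices.\<close>

lemma short_core:
  assumes v: "v \<in> V" and deg: "\<And>u. u \<in> nball v r \<Longrightarrow> 3 \<le> card (nb u)" and r: "card V < 2 ^ r"
  shows "\<exists>F. core F \<and> F \<subseteq> nball v r \<and> card F \<le> 2 * r + 2"
proof -
  define S where "S = (\<lambda>k. {u. (v, u) \<in> adj ^^ k \<and> (\<forall>j<k. (v, u) \<notin> adj ^^ j)})"
  \<comment> \<open>\<open>S k\<close> is the sphere of radius \<open>k\<close> about
    \<open>v\<close>, and \<open>par\<close> picks a neighbour one level up; the pairs of a vertex
    and its parent form a breadth-first search tree.\<close>
  define par where "par = (\<lambda>u. SOME w. {w, u} \<in> E \<and> (\<exists>k. w \<in> S k \<and> u \<in> S (Suc k)))"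
  have S0: "S 0 = {v}" by (auto simp: S_def)
  have Sdisj: "j = k" if "u \<in> S j" "u \<in> S k" for u j k
    using that unfolding S_def by (metis (mono_tags, lifting) linorder_neqE_nat mem_Collect_eq)
  have Sball: "S k \<subseteq> nball v r" if "k \<le> r" for k using that by (auto simp: S_def nball_def)
  have SV: "S k \<subseteq> V" for k
  proof (cases k)
    case (Suc j)
    then show ?thesis unfolding S_def by (auto simp: adj_def dest: edgeD)
  qed (use S0 v in auto)
  have finS: "finite (S k)" for k using SV finV finite_subset by blast
  have par: "{par u, u} \<in> E \<and> par u \<in> S k" if u: "u \<in> S (Suc k)" for u k
  proof -
    from u obtain w where w: "(v, w) \<in> adj ^^ k" "(w, u) \<in> adj" by (auto simp: S_def)
    have "(v, w) \<notin> adj ^^ j" if "j < k" for j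
      using u w(2) that unfolding S_def by (auto dest!: spec[of _ "Suc j"])
    then have "w \<in> S k" using w by (auto simp: S_def)
    then have "\<exists>w. {w, u} \<in> E \<and> (\<exists>k. w \<in> S k \<and> u \<in> S (Suc k))" using w u by (auto simp: adj_def)
    then have "{par u, u} \<in> E \<and> (\<exists>k. par u \<in> S k \<and> u \<in> S (Suc k))"
      unfolding par_def by (rule someI_ex)
    then show ?thesis using Sdisj u by blast
  qed
  have level: "\<exists>j\<le>Suc k. w \<in> S j" if "u \<in> S k" "{u, w} \<in> E" for u w k
  proof -
    have ex: "(v, w) \<in> adj ^^ Suc k" using that by (auto simp: S_def adj_def)
    let ?j = "LEAST j. (v, w) \<in> adj ^^ j"
    have "w \<in> S ?j" using LeastI[of "\<lambda>j. (v, w) \<in> adj ^^ j", OF ex] not_less_Least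
      unfolding S_def by blast
    moreover have "?j \<le> Suc k" using ex by (rule Least_le)
    ultimately show ?thesis by blast
  qed
  define tree where "tree = (\<lambda>a b. \<exists>k. a \<in> S (Suc k) \<and> b = par a)"
  have "\<exists>a b i j. i \<le> r \<and> j \<le> r \<and> a \<in> S i \<and> b \<in> S j \<and> {a, b} \<in> E \<and> \<not> tree a b \<and> \<not> tree b a"
  proof (rule ccontr)
    assume "\<not> ?thesis"
    then have all: "tree a b \<or> tree b a" if "i \<le> r" "j \<le> r" "a \<in> S i" "b \<in> S j" "{a, b} \<in> E" for a b i j
      using that by blast
    have "2 ^ k \<le> card (S k)" if "k \<le> r" for k
      using that
    proof (induction k)
      case (Suc k)
      define ch where "ch = (\<lambda>u. nb u \<inter> {w\<in>S (Suc k). par w = u})"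
      have two: "2 \<le> card (ch u)" if u: "u \<in> S k" for u
      proof -
        \<comment> \<open>When every edge is a tree edge, each neighbour other than the parent is a
          child. At the root, \<open>par u\<close> is an arbitrary value, and leaving it out also
          costs at most one neighbour.\<close>
        have "nb u - {par u} \<subseteq> ch u"
        proof
          fix w assume w: "w \<in> nb u - {par u}"
          then have e: "{u, w} \<in> E" by (simp add: nb_def)
          obtain j where j: "j \<le> Suc k" "w \<in> S j" using level[OF u e] by blast
          have "tree u w \<or> tree w u" using all[of k j u w] u e j Suc.prems by simp
          then have "tree w u" using w by (auto simp: tree_def)
          then obtain i where i: "w \<in> S (Suc i)" "u = par w" by (auto simp: tree_def)
          then have "i = k" using par[OF i(1)] Sdisj u by blast
          then show "w \<in> ch u" using i w by (auto simp: ch_def)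
        qed
        then have "card (nb u - {par u}) \<le> card (ch u)"
          using finS by (intro card_mono) (auto simp: ch_def)
        moreover have "card (nb u) \<le> card (nb u - {par u}) + 1"
          using card_insert_le_m1[of "card (nb u)" "nb u - {par u}" "par u"] diff_card_le_card_Diff[of "{par u}" "nb u"] by simp
        moreover have "3 \<le> card (nb u)" using deg Sball[of k] u Suc.prems by auto
        ultimately show ?thesis by linarith
      qed
      have "2 * card (S k) = (\<Sum>u\<in>S k. 2)" by simp
      also have "\<dots> \<le> (\<Sum>u\<in>S k. card (ch u))" by (intro sum_mono two)
      also have "\<dots> = card (\<Union>u\<in>S k. ch u)"
        using finS by (subst card_UN_disjoint) (auto simp: ch_def)
      also have "\<dots> \<le> card (S (Suc k))" using finS by (intro card_mono) (auto simp: ch_def)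
      finally show ?case using Suc by simp
    qed (simp add: S0)
    from this[of r] have "2 ^ r \<le> card V" using card_mono[OF finV SV[of r]] by simp
    then show False using r by simp
  qed
  then obtain a b i j where ab: "i \<le> r" "j \<le> r" "a \<in> S i" "b \<in> S j" "{a, b} \<in> E" "\<not> tree a b" "\<not> tree b a"
    by blast
  \<comment> \<open>\<open>A\<close> is the vertex set of the tree path from \<open>u\<close> to the
    root, described by its size and by closure under parents instead of as a walk.\<close>
  have anc: "\<exists>A. u \<in> A \<and> v \<in> A \<and> A \<subseteq> (\<Union>j\<le>k. S j) \<and> card A \<le> Suc k \<and> finite A \<and> (\<forall>x\<in>A. x \<noteq> v \<longrightarrow> par x \<in> A)"
    if "u \<in> S k" for u k
    using that
  proof (induction k arbitrary: u)
    case 0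
    then show ?case using S0 by (intro exI[of _ "{v}"]) auto
  next
    case (Suc k)
    obtain A where A: "par u \<in> A" "v \<in> A" "A \<subseteq> (\<Union>j\<le>k. S j)" "card A \<le> Suc k" "finite A" "\<forall>x\<in>A. x \<noteq> v \<longrightarrow> par x \<in> A"
      using Suc.IH[of "par u"] par[OF Suc.prems] by blast
    have "insert u A \<subseteq> (\<Union>j\<le>Suc k. S j)" using A(3) Suc.prems unfolding atMost_Suc by blast
    then show ?case using A by (intro exI[of _ "insert u A"]) (auto simp: card_insert_if)
  qed
  obtain A where A: "a \<in> A" "v \<in> A" "A \<subseteq> (\<Union>j\<le>i. S j)" "card A \<le> Suc i" "finite A" "\<forall>x\<in>A. x \<noteq> v \<longrightarrow> par x \<in> A"
    using anc[OF ab(3)] by blast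
  obtain B where B: "b \<in> B" "v \<in> B" "B \<subseteq> (\<Union>k\<le>j. S k)" "card B \<le> Suc j" "finite B" "\<forall>x\<in>B. x \<noteq> v \<longrightarrow> par x \<in> B"
    using anc[OF ab(4)] by blast
  define U where "U = A \<union> B"
  have finU: "finite U" using A B by (simp add: U_def)
  have US: "\<exists>k\<le>r. x \<in> S k" if x: "x \<in> U" for x
  proof -
    have "x \<in> (\<Union>k\<le>i. S k) \<or> x \<in> (\<Union>k\<le>j. S k)" using x A(3) B(3) unfolding U_def by blast
    then obtain k where "k \<le> i \<or> k \<le> j" "x \<in> S k" by blast
    then show ?thesis using ab(1,2) by (meson order_trans)
  qed
  have UV: "U \<subseteq> V" using US SV by blast
  have Uball: "U \<subseteq> nball v r" using US Sball by blast
  have cU: "card U \<le> 2 * r + 2"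
    using card_Un_le[of A B] A(4) B(4) ab(1,2) by (simp add: U_def)
  have lev: "\<exists>k. x \<in> S (Suc k)" if x: "x \<in> U - {v}" for x
  proof -
    obtain k where "x \<in> S k" using US x by blast
    then show ?thesis using S0 x by (cases k) auto
  qed
  \<comment> \<open>Every vertex of \<open>U\<close> except the root contributes the edge to its
    parent. These are \<open>card U - 1\<close> different edges, since two vertices with the same
    edge would each lie one level below the other. The missed edge \<open>{a, b}\<close> raises the
    count to \<open>card U\<close>.\<close>
  define tr where "tr = (\<lambda>x. {x, par x})"
  have "inj_on tr (U - {v})"
  proof (rule inj_onI, rule ccontr)
    fix x y assume xy: "x \<in> U - {v}" "y \<in> U - {v}" "tr x = tr y" "x \<noteq> y"
    obtain k where k: "x \<in> S (Suc k)" using lev[OF xy(1)] by blast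
    obtain m where m: "y \<in> S (Suc m)" using lev[OF xy(2)] by blast
    have "x = par y" "y = par x" using xy unfolding tr_def by (metis doubleton_eq_iff)+
    then have "x \<in> S m" "y \<in> S k" using par[OF k] par[OF m] by auto
    then have "Suc k = m" "Suc m = k" using Sdisj k m by blast+
    then show False by simp
  qed
  then have "card (tr ` (U - {v})) = card U - 1"
    using finU A(2) by (simp add: card_image U_def)
  moreover have "{a, b} \<notin> tr ` (U - {v})"
  proof
    assume "{a, b} \<in> tr ` (U - {v})"
    then obtain x where x: "x \<in> U - {v}" "{a, b} = {x, par x}" by (auto simp: tr_def)
    then have "a = x \<and> b = par x \<or> b = x \<and> a = par x" by (metis doubleton_eq_iff)
    then show False using lev[OF x(1)] ab(6,7) unfolding tree_def by blast
  qed
  moreover have "insert {a, b} (tr ` (U - {v})) \<subseteq> induced U"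
  proof -
    have "tr x \<in> induced U" if x: "x \<in> U - {v}" for x
    proof -
      obtain k where "x \<in> S (Suc k)" using lev[OF x] by blast
      then have "{x, par x} \<in> E" using par by (metis insert_commute)
      then show ?thesis using x A(6) B(6) by (auto simp: tr_def induced_def U_def)
    qed
    moreover have "{a, b} \<in> induced U" using ab A B by (auto simp: induced_def U_def)
    ultimately show ?thesis by blast
  qed
  then have "card (insert {a, b} (tr ` (U - {v}))) \<le> card (induced U)"
    using fin_induced by (intro card_mono)
  ultimately have "card U - 1 + 1 \<le> card (induced U)" using finU by simp
  then have "card U \<le> card (induced U)" by simp
  moreover have "U \<noteq> {}" using A by (auto simp: U_def)
  ultimately obtain F where F: "F \<subseteq> U" "core F" using core_exists[OF UV] by blast
  then have "card F \<le> 2 * r + 2" using card_mono[OF finU F(1)] cU by simp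
  then show ?thesis using F Uball by blast
qed

section \<open>The order of embedding\<close>

definition near :: "'v \<Rightarrow> 'v \<Rightarrow> bool" where
  "near u w \<longleftrightarrow> {u, w} \<in> E \<or> (\<exists>x. {u, x} \<in> E \<and> {w, x} \<in> E)"

text \<open>Distance at least 3 excludes edges and common neighbours between the two sets, as a
  layering demands within a batch. \<open>near u u\<close> holds exactly when \<open>u\<close> has
  an edge, so disjointness is stated separately.\<close>

definition far :: "'v set \<Rightarrow> 'v set \<Rightarrow> bool" where
  "far F F' \<longleftrightarrow> (\<forall>u\<in>F. \<forall>u'\<in>F'. u \<noteq> u' \<and> \<not> near u u')"

lemma near_sym: "near u w \<Longrightarrow> near w u"
  by (auto simp: near_def insert_commute)

lemma near_adj: "near u w \<Longrightarrow> \<exists>j\<le>2. (u, w) \<in> adj ^^ j"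
  unfolding near_def
proof (elim disjE exE conjE)
  assume "{u, w} \<in> E"
  then have "(u, w) \<in> adj ^^ 1" by (simp add: adj_def)
  then show ?thesis by (intro exI[of _ 1]) auto
next
  fix x assume "{u, x} \<in> E" "{w, x} \<in> E"
  then have "(u, x) \<in> adj" "(x, w) \<in> adj" by (auto simp: adj_def insert_commute)
  then have "(u, w) \<in> adj ^^ 2" by (auto simp: numeral_2_eq_2)
  then show ?thesis by blast
qed

text \<open>Single vertices come in order of decreasing distance \<open>h\<close> to
  \<open>Z\<close>, each level split by colour; the chosen cycles follow, sorted by size. A vertex
  outside \<open>Z\<close> has a neighbour closer to \<open>Z\<close>, which comes later; a vertex
  of \<open>Z\<close> outside the cycles has degree below \<open>\<Delta>\<close>. Either way at
  most \<open>\<Delta> - 1\<close> neighbours come earlier. The colouring separates vertices at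
  distance at most 2, so that the batches of single vertices are admissible.\<close>

lemma layering_exists:
  assumes deg: "\<And>u. u \<in> V \<Longrightarrow> card (nb u) \<le> \<Delta>" and \<Delta>: "3 \<le> \<Delta>" and r: "card V < 2 ^ r"
  shows "\<exists>k \<G> l. layering (\<Delta> - 1) V E k \<G> l \<and> (\<forall>g<k. l g \<le> 2 * r + 2) \<and>
    (\<Sum>g<k. l g) \<le> (r + 3) * (\<Delta> * \<Delta> + \<Delta> + 1) + (2 * r + 2) ^ 2"
proof -
  define L where "L = 2 * r + 2"
  define c where "c = \<Delta> * \<Delta> + \<Delta> + 1"
  define Q where "Q = (\<lambda>u w. u \<noteq> w \<and> near u w)"
  have "card {w\<in>V. Q u w} \<le> \<Delta> * \<Delta> + \<Delta>" if u: "u \<in> V" for u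
  proof -
    have "{w\<in>V. Q u w} \<subseteq> nb u \<union> (\<Union>x\<in>nb u. nb x)"
      by (auto simp: Q_def near_def nb_def insert_commute)
    then have "card {w\<in>V. Q u w} \<le> card (nb u \<union> (\<Union>x\<in>nb u. nb x))"
      using fin_nb by (intro card_mono) auto
    also have "\<dots> \<le> card (nb u) + card (\<Union>x\<in>nb u. nb x)" by (rule card_Un_le)
    also have "card (\<Union>x\<in>nb u. nb x) \<le> (\<Sum>x\<in>nb u. card (nb x))" using fin_nb by (rule card_UN_le)
    also have "\<dots> \<le> (\<Sum>x\<in>nb u. \<Delta>)" using deg nb_subset by (intro sum_mono) auto
    also have "\<dots> \<le> \<Delta> * \<Delta>" using deg[OF u] by simp
    finally show ?thesis using deg[OF u] by linarith
  qed
  then have "\<exists>col :: 'v \<Rightarrow> nat. (\<forall>u\<in>V. col u \<le> \<Delta> * \<Delta> + \<Delta>) \<and> (\<forall>u\<in>V. \<forall>w\<in>V. Q u w \<longrightarrow> col u \<noteq> col w)"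
    using near_sym by (intro greedy_coloring[OF finV]) (auto simp: Q_def)
  then obtain col :: "'v \<Rightarrow> nat" where col: "\<And>u. u \<in> V \<Longrightarrow> col u \<le> \<Delta> * \<Delta> + \<Delta>"
    "\<And>u w. u \<in> V \<Longrightarrow> w \<in> V \<Longrightarrow> Q u w \<Longrightarrow> col u \<noteq> col w"
    by auto

  define Fam where "Fam = (\<lambda>\<F>. \<F> \<subseteq> {F. core F \<and> card F \<le> L} \<and> (\<forall>F\<in>\<F>. \<forall>F'\<in>\<F>. F \<noteq> F' \<longrightarrow> far F F'))"
  have finFam: "finite \<F> \<and> card \<F> \<le> card (Pow V)" if "Fam \<F>" for \<F>
  proof -
    have "\<F> \<subseteq> Pow V" using that coreD(2) unfolding Fam_def by blast
    then show ?thesis using finV by (meson card_mono finite_Pow_iff finite_subset)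
  qed
  have "Fam {}" by (simp add: Fam_def)
  moreover have "\<forall>\<F>. Fam \<F> \<longrightarrow> card \<F> < Suc (card (Pow V))" using finFam by (simp add: less_Suc_eq_le)
  ultimately obtain \<F> where \<F>: "Fam \<F>" and max: "\<And>\<F>'. Fam \<F>' \<Longrightarrow> card \<F>' \<le> card \<F>"
    using ex_has_greatest_nat[of Fam "{}" card "Suc (card (Pow V))"] by blast
  have \<F>core: "core F" "card F \<le> L" if "F \<in> \<F>" for F using \<F> that unfolding Fam_def by auto
  have \<F>far: "far F F'" if "F \<in> \<F>" "F' \<in> \<F>" "F \<noteq> F'" for F F' using \<F> that unfolding Fam_def by auto
  have fin\<F>: "finite \<F>" using finFam[OF \<F>] by simp
  define Z where "Z = \<Union>\<F> \<union> {v\<in>V. card (nb v) < \<Delta>}"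
  have hit: "\<exists>F'\<in>\<F>. \<exists>u\<in>F. \<exists>u'\<in>F'. u = u' \<or> near u u'" if F: "core F" "card F \<le> L" for F
  proof (rule ccontr)
    assume no: "\<not> ?thesis"
    then have far: "far F F'" "far F' F" if "F' \<in> \<F>" for F'
      using that near_sym unfolding far_def by blast+
    have "F \<notin> \<F>" using no coreD(1)[OF F(1)] by blast
    moreover have "Fam (insert F \<F>)" using \<F> F far unfolding Fam_def by auto
    ultimately show False using max[of "insert F \<F>"] fin\<F> by simp
  qed
  \<comment> \<open>If all degrees in the ball of radius \<open>r\<close> are at least
    \<open>\<Delta>\<close>, it contains a short core, and by maximality this core meets a chosen
    one or comes within distance 2 of it. This accounts for the 2 in \<open>r + 2\<close>.\<close>
  have reach: "\<exists>j\<le>r + 2. \<exists>z\<in>Z. (z, v) \<in> adj ^^ j" if v: "v \<in> V" for v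
  proof (cases "\<exists>u\<in>nball v r. card (nb u) < \<Delta>")
    case True
    then obtain u k where u: "card (nb u) < \<Delta>" "k \<le> r" "(v, u) \<in> adj ^^ k" by (auto simp: nball_def)
    have "u \<in> V"
    proof (cases k)
      case 0 then show ?thesis using u v by simp
    next
      case (Suc m) then show ?thesis using u by (auto simp: adj_def dest: edgeD)
    qed
    then have "u \<in> Z" using u by (simp add: Z_def)
    moreover have "(u, v) \<in> adj ^^ k" using u adj_relpow_sym by blast
    ultimately show ?thesis using u(2) by (meson le_add1 order_trans)
  next
    case False
    then have "3 \<le> card (nb u)" if "u \<in> nball v r" for u using that \<Delta> by force
    from short_core[OF v this r] obtain F where F: "core F" "F \<subseteq> nball v r" "card F \<le> L"
      unfolding L_def by blast
    obtain F' u u' where h: "F' \<in> \<F>" "u \<in> F" "u' \<in> F'" "u = u' \<or> near u u'" using hit F by blast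
    have "\<exists>j\<le>2. (u, u') \<in> adj ^^ j"
      using h(4)
    proof
      assume "u = u'"
      then show ?thesis by (intro exI[of _ 0]) auto
    qed (rule near_adj)
    then obtain j where j: "j \<le> 2" "(u', u) \<in> adj ^^ j" using adj_relpow_sym by blast
    obtain k where k: "k \<le> r" "(u, v) \<in> adj ^^ k" using F h(2) adj_relpow_sym unfolding nball_def by blast
    have "(u', v) \<in> adj ^^ (j + k)" using j k by (auto simp: relpow_add)
    moreover have "u' \<in> Z" using h by (auto simp: Z_def)
    moreover have "j + k \<le> r + 2" using j k by simp
    ultimately show ?thesis by blast
  qed
  define h where "h = (\<lambda>v. LEAST j. \<exists>z\<in>Z. (z, v) \<in> adj ^^ j)"
  have h_le: "h v \<le> r + 2" if "v \<in> V" for v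
  proof -
    obtain j where "j \<le> r + 2" "\<exists>z\<in>Z. (z, v) \<in> adj ^^ j" using reach[OF \<open>v \<in> V\<close>] by blast
    then show ?thesis
      unfolding h_def using Least_le[of "\<lambda>j. \<exists>z\<in>Z. (z, v) \<in> adj ^^ j" j] by linarith
  qed
  have h_dec: "\<exists>w\<in>nb v. h w < h v" if v: "v \<in> V" "v \<notin> Z" for v
  proof -
    obtain j where "\<exists>z\<in>Z. (z, v) \<in> adj ^^ j" using reach[OF v(1)] by blast
    then have "\<exists>z\<in>Z. (z, v) \<in> adj ^^ h v" unfolding h_def by (rule LeastI)
    then obtain z where z: "z \<in> Z" "(z, v) \<in> adj ^^ h v" by blast
    then have "h v \<noteq> 0" using v by (intro notI) auto
    then obtain m where m: "h v = Suc m" using not0_implies_Suc by blast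
    then obtain w where w: "(z, w) \<in> adj ^^ m" "(w, v) \<in> adj" using z by auto
    then have "h w \<le> m" unfolding h_def using z(1) by (intro Least_le[of "\<lambda>j. \<exists>z\<in>Z. (z, w) \<in> adj ^^ j"]) blast
    moreover have "w \<in> nb v" using w(2) by (simp add: adj_def nb_def insert_commute)
    ultimately show ?thesis using m by (intro bexI[of _ w]) auto
  qed

  \<comment> \<open>The distances 0, ..., r + 2 give r + 3 levels of \<open>c\<close> batches each.
    As \<open>c\<close> exceeds every colour, quotient and remainder of \<open>g\<close> by
    \<open>c\<close> are the level and the colour. From \<open>ks\<close> on, cycles are grouped by
    size because all pieces of a batch have the same length.\<close>
  define ks where "ks = (r + 3) * c"
  define k where "k = ks + L"
  define \<G> where "\<G> = (\<lambda>g. if g < ks then {{v} |v. v \<in> V - \<Union>\<F> \<and> g = (r + 2 - h v) * c + col v}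
      else {F\<in>\<F>. card F = g - ks + 1})"
  define l where "l = (\<lambda>g. if g < ks then 1 else g - ks + 1)"
  have key: "(r + 2 - h v) * c + col v < ks" if "v \<in> V" for v
  proof -
    have "(r + 2 - h v) * c \<le> (r + 2) * c" by (intro mult_right_mono) auto
    moreover have "col v < c" using col(1)[OF that] by (simp add: c_def)
    ultimately show ?thesis by (simp add: ks_def algebra_simps)
  qed
  have single: "\<exists>v. F = {v} \<and> v \<in> V - \<Union>\<F> \<and> g = (r + 2 - h v) * c + col v"
    if "F \<in> \<G> g" "g < ks" for F g using that by (auto simp: \<G>_def)
  have cyc: "F \<in> \<F> \<and> card F = g - ks + 1" if "F \<in> \<G> g" "\<not> g < ks" for F g
    using that by (auto simp: \<G>_def)
  have cov: "(\<Union>g<k. \<Union>(\<G> g)) = V"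
  proof
    show "(\<Union>g<k. \<Union>(\<G> g)) \<subseteq> V"
    proof
      fix v assume "v \<in> (\<Union>g<k. \<Union>(\<G> g))"
      then obtain g F where F: "F \<in> \<G> g" "v \<in> F" by blast
      show "v \<in> V"
      proof (cases "g < ks")
        case True
        then show ?thesis using single[OF F(1)] F(2) by auto
      next
        case False
        then show ?thesis using cyc[OF F(1)] coreD(2) \<F>core(1) F(2) by blast
      qed
    qed
    show "V \<subseteq> (\<Union>g<k. \<Union>(\<G> g))"
    proof
      fix v assume v: "v \<in> V"
      show "v \<in> (\<Union>g<k. \<Union>(\<G> g))"
      proof (cases "v \<in> \<Union>\<F>")
        case True
        then obtain F where F: "F \<in> \<F>" "v \<in> F" by blast
        have "1 \<le> card F" using F(2) coreD(3)[OF \<F>core(1)[OF F(1)]]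
          by (metis One_nat_def Suc_leI card_gt_0_iff empty_iff)
        then have "F \<in> \<G> (ks + (card F - 1))" "ks + (card F - 1) < k"
          using F \<F>core(2)[OF F(1)] by (auto simp: \<G>_def k_def)
        then show ?thesis using F by blast
      next
        case False
        then have "{v} \<in> \<G> ((r + 2 - h v) * c + col v)" using key[OF v] v by (auto simp: \<G>_def)
        moreover have "(r + 2 - h v) * c + col v < k" using key[OF v] by (simp add: k_def)
        ultimately show ?thesis by blast
      qed
    qed
  qed
  have sizes: "finite (\<G> g) \<and> 1 \<le> l g \<and> (\<forall>F\<in>\<G> g. finite F \<and> card F = l g)" for g
  proof (cases "g < ks")
    case True
    have "\<G> g \<subseteq> (\<lambda>v. {v}) ` V" using single True by blast
    then have "finite (\<G> g)" using finV by (meson finite_imageI finite_subset)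
    moreover have "finite F \<and> card F = l g" if "F \<in> \<G> g" for F
      using single[OF that True] True by (auto simp: l_def)
    ultimately show ?thesis using True by (simp add: l_def)
  next
    case False
    have "\<G> g \<subseteq> \<F>" using cyc False by blast
    then have "finite (\<G> g)" using fin\<F> by (rule finite_subset)
    moreover have "finite F \<and> card F = l g" if "F \<in> \<G> g" for F
      using cyc[OF that False] coreD(3) \<F>core(1) False by (simp add: l_def)
    ultimately show ?thesis using False by (simp add: l_def)
  qed
  have disj: "g = g' \<and> F = F'" if F: "F \<in> \<G> g" "F' \<in> \<G> g'" "u \<in> F" "u \<in> F'" for g g' F F' u
  proof (cases "g < ks"; cases "g' < ks")
    assume "g < ks" "g' < ks"
    then show ?thesis using single[OF F(1)] single[OF F(2)] F by auto
  next
    assume "g < ks" "\<not> g' < ks"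
    then show ?thesis using single[OF F(1)] cyc[OF F(2)] F by auto
  next
    assume "\<not> g < ks" "g' < ks"
    then show ?thesis using single[OF F(2)] cyc[OF F(1)] F by auto
  next
    assume a: "\<not> g < ks" "\<not> g' < ks"
    have "F = F'"
    proof (rule ccontr)
      assume "F \<noteq> F'"
      then have "far F F'" using \<F>far cyc[OF F(1)] cyc[OF F(2)] a by blast
      then show False using F(3,4) by (auto simp: far_def)
    qed
    then show ?thesis using a cyc[OF F(1)] cyc[OF F(2)] by auto
  qed
  have apart: "\<not> near u u'" if F: "F \<in> \<G> g" "F' \<in> \<G> g" "F \<noteq> F'" "u \<in> F" "u' \<in> F'" for g F F' u u'
  proof (cases "g < ks")
    case True
    obtain v where v: "F = {v}" "v \<in> V" "g = (r + 2 - h v) * c + col v" using single[OF F(1) True] by blast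
    obtain w where w: "F' = {w}" "w \<in> V" "g = (r + 2 - h w) * c + col w" using single[OF F(2) True] by blast
    have lt: "col v < c" "col w < c" using col(1)[OF v(2)] col(1)[OF w(2)] by (simp_all add: c_def)
    have "g mod c = col v" unfolding v(3) using lt by simp
    moreover have "g mod c = col w" unfolding w(3) using lt by simp
    ultimately have "\<not> Q v w" using col(2)[OF v(2) w(2)] by metis
    moreover have "v \<noteq> w" using v w F(3) by blast
    ultimately show ?thesis using v(1) w(1) F(4,5) by (auto simp: Q_def)
  next
    case False
    then have "far F F'" using \<F>far cyc[OF F(1)] cyc[OF F(2)] F(3) by blast
    then show ?thesis using F by (auto simp: far_def)
  qed
  have sparse: "card (induced T) \<le> card T \<and>
      card (induced T) + card {(u, w). u \<in> T \<and> w \<in> (\<Union>h<g. \<Union>(\<G> h)) \<and> {u, w} \<in> E} \<le> (\<Delta> - 1) * card T"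
    if F: "F \<in> \<G> g" "T \<subseteq> F" for g F T
  proof (cases "g < ks")
    case True
    define W where "W = (\<Union>h<g. \<Union>(\<G> h))"
    obtain v where v: "F = {v}" "v \<in> V" "v \<notin> \<Union>\<F>" "g = (r + 2 - h v) * c + col v" using single[OF F(1) True] by blast
    have "e \<notin> induced T" for e
    proof
      assume e: "e \<in> induced T"
      then have "card e \<le> card {v}" using v F(2) by (intro card_mono) (auto simp: induced_def)
      then show False using e E by (auto simp: induced_def vertex_pairs_def)
    qed
    then have i0: "induced T = {}" by blast
    have nbW: "card (nb v \<inter> W) \<le> \<Delta> - 1"
    proof (cases "card (nb v) < \<Delta>")
      case True
      have "card (nb v \<inter> W) \<le> card (nb v)" using fin_nb by (intro card_mono) auto
      then show ?thesis using True by simp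
    next
      case False
      then have "v \<notin> Z" using v by (simp add: Z_def)
      then obtain w where w: "w \<in> nb v" "h w < h v" using h_dec v by blast
      have wV: "w \<in> V" using w nb_subset by blast
      \<comment> \<open>Either \<open>w\<close> lies in a chosen cycle, hence in a batch from
        \<open>ks\<close> on, or it is a single vertex at least one level later, and one level
        outweighs any difference of colours. \<open>h_le\<close> keeps the truncated subtraction
        \<open>r + 2 - h v\<close> exact.\<close>
      have "w \<notin> W"
      proof
        assume "w \<in> W"
        then obtain g' F' where g': "g' < g" "F' \<in> \<G> g'" "w \<in> F'" unfolding W_def by blast
        then have "g' < ks" using \<open>g < ks\<close> by simp
        then have eq: "g' = (r + 2 - h w) * c + col w" using single[OF g'(2)] g'(3) by auto
        have "r + 2 - h v + 1 \<le> r + 2 - h w" using w(2) h_le[OF v(2)] by simp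
        then have "(r + 2 - h v + 1) * c \<le> (r + 2 - h w) * c" by (rule mult_right_mono) simp
        moreover have "col v < c" using col(1)[OF v(2)] by (simp add: c_def)
        ultimately have "g \<le> g'" using v(4) eq by (simp add: algebra_simps)
        then show False using g' by simp
      qed
      then have "card (nb v \<inter> W) \<le> card (nb v - {w})" using fin_nb by (intro card_mono) auto
      also have "\<dots> = card (nb v) - 1" using w fin_nb by simp
      also have "\<dots> \<le> \<Delta> - 1" using deg[OF v(2)] by simp
      finally show ?thesis .
    qed
    consider "T = {}" | "T = {v}" using F(2) v(1) by blast
    then have "card {(u, w). u \<in> T \<and> w \<in> W \<and> {u, w} \<in> E} \<le> (\<Delta> - 1) * card T"
    proof cases
      case 2
      have "{(u, w). u \<in> T \<and> w \<in> W \<and> {u, w} \<in> E} = Pair v ` (nb v \<inter> W)"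
        using 2 by (auto simp: nb_def)
      then have "card {(u, w). u \<in> T \<and> w \<in> W \<and> {u, w} \<in> E} = card (nb v \<inter> W)"
        by (simp add: card_image inj_on_def)
      then show ?thesis using nbW 2 by simp
    qed simp
    then show ?thesis using i0 unfolding W_def by simp
  next
    case False
    note C = cyc[OF F(1) False]
    have "(\<Union>h<g. \<Union>(\<G> h)) \<inter> F = {}" using disj[OF F(1)] by blast
    moreover have F': "core F" using \<F>core(1) C by blast
    moreover have "card (nb u) \<le> \<Delta>" if "u \<in> F" for u using deg coreD(2)[OF F'] that by blast
    ultimately show ?thesis
      using card_induced_core[OF F' F(2)] \<Delta> by (intro conjI core_extension[OF F' F(2)]) auto
  qed
  have "layering (\<Delta> - 1) V E k \<G> l"
    unfolding layering_def
  proof (intro conjI)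
    show "\<forall>g<k. \<forall>h<k. \<forall>F\<in>\<G> g. \<forall>F'\<in>\<G> h. F \<inter> F' \<noteq> {} \<longrightarrow> g = h \<and> F = F'"
      using disj by blast
    show "\<forall>g<k. \<forall>F\<in>\<G> g. \<forall>F'\<in>\<G> g. F \<noteq> F' \<longrightarrow>
        (\<forall>u\<in>F. \<forall>u'\<in>F'. {u, u'} \<notin> E \<and> (\<forall>w. \<not> ({u, w} \<in> E \<and> {u', w} \<in> E)))"
      using apart unfolding near_def by blast
    show "\<forall>g<k. \<forall>F\<in>\<G> g. \<forall>T\<subseteq>F. card {e\<in>E. e \<subseteq> T} \<le> card T \<and>
        card {e\<in>E. e \<subseteq> T} + card {(u, w). u \<in> T \<and> w \<in> (\<Union>h<g. \<Union>(\<G> h)) \<and> {u, w} \<in> E} \<le> (\<Delta> - 1) * card T"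
      using sparse unfolding induced_def by blast
  qed (use cov sizes in auto)
  moreover have "\<forall>g<k. l g \<le> 2 * r + 2" by (auto simp: l_def k_def L_def)
  moreover have "(\<Sum>g<k. l g) \<le> (r + 3) * (\<Delta> * \<Delta> + \<Delta> + 1) + (2 * r + 2) ^ 2"
  proof -
    have "(\<Sum>g<k. l g) = (\<Sum>g<ks. l g) + (\<Sum>g\<in>{ks..<ks + L}. l g)"
      unfolding k_def lessThan_atLeast0 by (subst sum.atLeastLessThan_concat) auto
    also have "\<dots> \<le> (\<Sum>g<ks. 1) + (\<Sum>g\<in>{ks..<ks + L}. L)"
      by (intro add_mono sum_mono) (auto simp: l_def)
    also have "\<dots> = ks + L * L" by simp
    finally show ?thesis by (simp add: ks_def c_def L_def power2_eq_square)
  qed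
  ultimately show ?thesis by blast
qed

end

subsection \<open>Universality\<close>

lemma sum_card_layering:
  assumes "layering d V E k \<G> l"
  shows "(\<Sum>g<k. l g * card (\<G> g)) = card V"
proof -
  note lay = assms[unfolded layering_def]
  have sizes: "finite (\<G> g)" "\<And>F. F \<in> \<G> g \<Longrightarrow> finite F \<and> card F = l g" if "g < k" for g
    using lay[THEN conjunct2, THEN conjunct1] that by blast+
  have disj: "g = h \<and> F = F'" if "g < k" "h < k" "F \<in> \<G> g" "F' \<in> \<G> h" "F \<inter> F' \<noteq> {}" for g h F F'
    using lay[THEN conjunct2, THEN conjunct2, THEN conjunct1] that by blast
  have layer: "finite (\<Union>(\<G> g)) \<and> card (\<Union>(\<G> g)) = l g * card (\<G> g)" if g: "g < k" for g
  proof
    show "finite (\<Union>(\<G> g))" using sizes[OF g] by blast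
    have "card (\<Union>(\<G> g)) = (\<Sum>F\<in>\<G> g. card F)"
      using sizes[OF g] disj[OF g g] by (intro card_Union_disjoint) (auto simp: pairwise_def disjnt_def)
    also have "\<dots> = (\<Sum>F\<in>\<G> g. l g)" using sizes[OF g] by (intro sum.cong) auto
    finally show "card (\<Union>(\<G> g)) = l g * card (\<G> g)" by simp
  qed
  have "V = (\<Union>g<k. \<Union>(\<G> g))" using lay by simp
  also have "card \<dots> = (\<Sum>g<k. card (\<Union>(\<G> g)))"
  proof (rule card_UN_disjoint)
    show "\<forall>g\<in>{..<k}. \<forall>h\<in>{..<k}. g \<noteq> h \<longrightarrow> \<Union>(\<G> g) \<inter> \<Union>(\<G> h) = {}"
    proof (intro ballI impI)
      fix g h assume gh: "g \<in> {..<k}" "h \<in> {..<k}" "g \<noteq> h"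
      show "\<Union>(\<G> g) \<inter> \<Union>(\<G> h) = {}"
      proof (rule ccontr)
        assume "\<Union>(\<G> g) \<inter> \<Union>(\<G> h) \<noteq> {}"
        then obtain F F' where "F \<in> \<G> g" "F' \<in> \<G> h" "F \<inter> F' \<noteq> {}" by blast
        then show False using disj[of g h F F'] gh by simp
      qed
    qed
  qed (use layer in auto)
  also have "\<dots> = (\<Sum>g<k. l g * card (\<G> g))" using layer by (intro sum.cong) auto
  finally show ?thesis by simp
qed

lemma vertex_degree_le_max_degree:
  assumes "finite_simple_graph H" "v \<in> vertices H"
  shows "vertex_degree H v \<le> max_degree H"
  unfolding max_degree_def using assms
  by (intro cSUP_upper) (auto simp: finite_simple_graph_def)

text \<open>The graph \<open>H\<close> leaves at least \<epsilon> n host vertices over, and by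
  \<open>space\<close> the reserves fit there: every position of every batch needs \<open>b\<close>
  spare vertices in round 0 and \<open>r\<close> intervals of \<open>2 * b\<close> vertices.\<close>

lemma universal_if_expanding:
  fixes n r b K \<Delta> :: nat and \<epsilon> :: real
  assumes good: "expanding n (2 * r + 2) (\<Delta> - 1) b K X" and \<Delta>: "3 \<le> \<Delta>" and b: "1 \<le> b"
    and K: "n \<le> K * b" "n < K ^ Suc r" "1 \<le> K" and r: "n < 2 ^ r" and \<epsilon>: "0 \<le> \<epsilon>"
    and space: "real (((r + 3) * (\<Delta> * \<Delta> + \<Delta> + 1) + (2 * r + 2) ^ 2) * (b + r * (2 * b))) \<le> \<epsilon> * n"
  shows "universal_for ({..<n}, {e\<in>vertex_pairs {..<n}. X e}) (bounded_degree_graphs ((1 - \<epsilon>) * real n) \<Delta>)"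
  unfolding universal_for_def
proof
  fix H assume "H \<in> bounded_degree_graphs ((1 - \<epsilon>) * real n) \<Delta>"
  then have H: "finite_simple_graph H" "real (card (vertices H)) \<le> (1 - \<epsilon>) * real n" "max_degree H \<le> \<Delta>"
    by (auto simp: bounded_degree_graphs_def)
  define V where "V = vertices H"
  define E where "E = edges H"
  have fV: "finite V" and E: "E \<subseteq> vertex_pairs V"
    using H(1) by (auto simp: finite_simple_graph_def V_def E_def)
  interpret edge_set V E by unfold_locales (fact fV, fact E)
  have deg: "card (nb u) \<le> \<Delta>" if "u \<in> V" for u
  proof -
    have "card (nb u) = vertex_degree H u" unfolding card_nb by (simp add: vertex_degree_def E_def)
    also have "\<dots> \<le> max_degree H" using that by (intro vertex_degree_le_max_degree H) (simp add: V_def)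
    finally show ?thesis using H(3) by simp
  qed
  have "(1 - \<epsilon>) * real n \<le> 1 * real n" using \<epsilon> by (intro mult_right_mono) auto
  then have "real (card V) \<le> real n" using H(2) unfolding V_def by linarith
  then have "card V < 2 ^ r" using r by simp
  from layering_exists[OF deg \<Delta> this] obtain k \<G> l where lay: "layering (\<Delta> - 1) V E k \<G> l"
    and lL: "\<And>g. g < k \<Longrightarrow> l g \<le> 2 * r + 2"
    and suml: "(\<Sum>g<k. l g) \<le> (r + 3) * (\<Delta> * \<Delta> + \<Delta> + 1) + (2 * r + 2) ^ 2" by blast
  have "(\<Sum>g<k. l g * (card (\<G> g) + b + r * (2 * b))) = card V + (\<Sum>g<k. l g) * (b + r * (2 * b))"
    unfolding sum_card_layering[OF lay, symmetric] sum_distrib_right sum.distrib[symmetric]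
    by (intro sum.cong) (auto simp: algebra_simps)
  also have "\<dots> \<le> card V + ((r + 3) * (\<Delta> * \<Delta> + \<Delta> + 1) + (2 * r + 2) ^ 2) * (b + r * (2 * b))"
    by (intro add_mono mult_mono suml) auto
  also have "\<dots> \<le> n"
  proof -
    have "real (card V) \<le> (1 - \<epsilon>) * real n" using H(2) by (simp add: V_def)
    then have "real (card V) + real (((r + 3) * (\<Delta> * \<Delta> + \<Delta> + 1) + (2 * r + 2) ^ 2) * (b + r * (2 * b)))
        \<le> (1 - \<epsilon>) * real n + \<epsilon> * real n"
      using space by (rule add_mono)
    also have "\<dots> = real n" by (simp add: algebra_simps)
    finally show ?thesis by (simp only: of_nat_add[symmetric] of_nat_le_iff)
  qed
  finally have sp: "(\<Sum>g<k. l g * (card (\<G> g) + b + r * (2 * b))) \<le> n" .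
  obtain \<phi> where \<phi>: "inj_on \<phi> V" "\<phi> ` V \<subseteq> {..<n}" "\<forall>e\<in>E. X (\<phi> ` e)"
    using embed_layering[OF good b K fV E lay lL sp] by blast
  define G' where "G' = (\<phi> ` V, (\<lambda>e. \<phi> ` e) ` E)"
  have pairs: "\<phi> ` e \<in> vertex_pairs (\<phi> ` V)" if "e \<in> E" for e
  proof -
    have e: "e \<subseteq> V" "card e = 2" using E that by (auto simp: vertex_pairs_def)
    then have "card (\<phi> ` e) = 2" using \<phi>(1) by (metis card_image inj_on_subset)
    then show ?thesis using e by (auto simp: vertex_pairs_def)
  qed
  have "finite_simple_graph G'"
    using fV pairs by (auto simp: finite_simple_graph_def G'_def vertices_def edges_def)
  moreover have "is_subgraph G' ({..<n}, {e\<in>vertex_pairs {..<n}. X e})"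
  proof -
    have "\<phi> ` e \<in> vertex_pairs {..<n}" if "e \<in> E" for e
      using pairs[OF that] \<phi>(2) order_trans[of "\<phi> ` e" "\<phi> ` V"] by (simp add: vertex_pairs_def)
    then show ?thesis using \<phi> by (auto simp: is_subgraph_def G'_def vertices_def edges_def)
  qed
  moreover have "graph_isomorphic H G'"
    unfolding graph_isomorphic_def using \<phi>(1)
    by (intro exI[of _ \<phi>]) (simp add: G'_def bij_betw_def vertices_def edges_def V_def E_def)
  ultimately show "contains_copy ({..<n}, {e\<in>vertex_pairs {..<n}. X e}) H"
    unfolding contains_copy_def by blast
qed

text \<open>Here \<open>r = O(log n)\<close> is the search depth and the number of rounds, \<open>b = \<Theta>(n / log\<^sup>3 n)\<close> the size
  of the reserves, \<open>K = n / b\<close> up to rounding and \<open>c = log\<^sup>6 n\<close> the exponent in Janson's inequality.\<close>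

lemma eventually_parameters:
  fixes \<epsilon> :: real and \<Delta> :: nat and p :: "nat \<Rightarrow> real"
  assumes \<epsilon>: "\<epsilon> > 0" and \<Delta>: "\<Delta> \<ge> 3" and p: "\<And>n. 0 \<le> p n \<and> p n \<le> 1"
    and o: "(\<lambda>n. real n powr (- 1 / (real \<Delta> - 1)) * ln (real n) ^ 5) \<in> o(p)"
  shows "\<forall>\<^sub>F n in sequentially. \<exists>(r::nat) (b::nat) (K::nat) (c::real).
    n < 2 ^ r \<and> 1 \<le> b \<and> n \<le> K * b \<and> n < K ^ Suc r \<and> 1 \<le> K \<and> 2 * r + 2 \<le> n \<and> 0 < p n \<and> 1 \<le> c \<and>
    6 * (2 * r + 2) * c \<le> b * p n ^ (\<Delta> - 1) \<and>
    2 * c * n * (3 * ((2 * r + 2)\<^sup>2 / (b\<^sup>2 * p n) + (2 * r + 2) ^ 3 / (b * p n) ^ 3)) \<le> 1 \<and>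
    ((2 * r + 2) * (K + 2 * (\<Delta> - 1) + 4) + 3) * ln (real n + 1) \<le> c / 2 \<and>
    real (((r + 3) * (\<Delta> * \<Delta> + \<Delta> + 1) + (2 * r + 2) ^ 2) * (b + r * (2 * b))) \<le> \<epsilon> * n"
proof -
  \<comment> \<open>The cap at 1 ensures \<open>b \<le> n\<close>.\<close>
  define \<delta> where "\<delta> = min \<epsilon> 1"
  \<comment> \<open>The reserves have total size at most 455 b log^3 n, where 455 = 65 * 7 comes
    from the bounds on \<open>C\<close> and 2 r + 1. Replacing 455 by 500 absorbs the rounding of
    \<open>b\<close>.\<close>
  define \<beta> where "\<beta> = \<delta> / 500"
  \<comment> \<open>The number 48 = 6 * 8 comes from 6 L c with L \<le> 8 log n.\<close>
  define M where "M = 48 / \<beta> + 1"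
  define d where "d = \<Delta> - 1"
  define a where "a = real (\<Delta> * \<Delta> + \<Delta> + 1)"
  have \<delta>: "0 < \<delta>" "\<delta> \<le> 1" "\<delta> \<le> \<epsilon>" using \<epsilon> by (auto simp: \<delta>_def)
  have \<beta>: "0 < \<beta>" using \<delta> by (simp add: \<beta>_def)
  have "1 \<le> M" using \<beta> by (simp add: M_def)
  then have M: "1 \<le> M" "0 < M" by simp_all
  have d: "2 \<le> d" "real \<Delta> - 1 = real d" using \<Delta> by (auto simp: d_def)
  have nice: "\<forall>\<^sub>F x in at_top. P x \<Longrightarrow> \<forall>\<^sub>F n in sequentially. P (real n)" for P
    by (rule eventually_compose_filterlim[OF _ filterlim_real_sequentially])
  have "\<forall>\<^sub>F n in sequentially. norm (real n powr (- 1 / (real \<Delta> - 1)) * ln (real n) ^ 5) \<le> (1 / M) * norm (p n)"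
    using o M by (intro landau_o.smallD) auto
  moreover have "\<forall>\<^sub>F n in sequentially. 3 \<le> ln (real n)" by (rule nice) real_asymp
  moreover have "\<forall>\<^sub>F n in sequentially. 8 * ln (real n) \<le> real n" by (rule nice) real_asymp
  moreover have "\<forall>\<^sub>F n in sequentially. 6 * ln (real n) * a \<le> ln (real n) ^ 2" by (rule nice) real_asymp
  moreover have "\<forall>\<^sub>F n in sequentially. 1 \<le> \<delta> * real n / (455 * ln (real n) ^ 3) - \<beta> * real n / ln (real n) ^ 3"
    unfolding \<beta>_def using \<delta>(1) by (intro nice) real_asymp
  moreover have "\<forall>\<^sub>F n in sequentially. 1 \<le> \<beta> * real n / ln (real n) ^ 3"
    using \<beta> by (intro nice) real_asymp
  moreover have "\<forall>\<^sub>F n in sequentially.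
      (8 * ln (real n) * (ln (real n) ^ 3 / \<beta> + 1 + 2 * d + 4) + 3) * ln (real n + 1) \<le> ln (real n) ^ 6 / 2"
    using \<beta> by (intro nice) real_asymp
  moreover have "\<forall>\<^sub>F n in sequentially. 2 * ln (real n) ^ 6 * real n * (3 * ((8 * ln (real n))\<^sup>2 / ((\<beta> * real n / ln (real n) ^ 3)\<^sup>2 * real n powr (-1/2))
      + (8 * ln (real n)) ^ 3 / ((\<beta> * real n / ln (real n) ^ 3) * real n powr (-1/2)) ^ 3)) \<le> 1"
    using \<beta> by (intro nice) real_asymp
  ultimately show ?thesis
  proof eventually_elim
    case (elim n)
    define x where "x = ln (real n)"
    have x: "3 \<le> x" using elim by (simp add: x_def)
    have n: "1 \<le> real n" "n \<noteq> 0" using x by (auto simp: x_def intro!: Suc_leI Nat.gr0I)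
    \<comment> \<open>The factor 2 gives n < 2 ^ r, since 2 ln 2 > 1.\<close>
    define r where "r = nat \<lceil>2 * x\<rceil>"
    have r: "2 * x \<le> real r" "real r \<le> 2 * x + 1" using x by (auto simp: r_def)
    have r3: "real r \<le> 3 * x" using r x by linarith
    \<comment> \<open>\<open>C\<close> bounds the total length of all batches, and
      \<open>D * b\<close> is then the total size of the reserves.\<close>
    define C where "C = (r + 3) * (\<Delta> * \<Delta> + \<Delta> + 1) + (2 * r + 2) ^ 2"
    define D where "D = C * (2 * r + 1)"
    define b where "b = nat \<lfloor>\<delta> * real n / D\<rfloor>"
    define K where "K = n div b + 1"
    have D1: "1 \<le> D" by (simp add: D_def C_def)
    have "real n < 2 ^ r"
    proof -
      have "x * 1 < x * (4 / 3)" using x by (intro mult_strict_left_mono) auto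
      also have "\<dots> = 2 * x * (2 / 3)" by simp
      also have "\<dots> \<le> real r * ln 2"
        using r x ln2_ge_two_thirds by (intro mult_mono) auto
      finally have "exp x < exp (real r * ln 2)" by simp
      also have "\<dots> = 2 ^ r" by (simp add: exp_of_nat_mult)
      finally show ?thesis using n by (simp add: x_def)
    qed
    then have r2: "n < 2 ^ r" by (metis of_nat_less_iff of_nat_numeral of_nat_power)
    have L: "real (2 * r + 2) \<le> 8 * x" using r3 x by simp
    have Ln: "2 * r + 2 \<le> n" using L elim by (simp add: x_def)
    have "real C = (real r + 3) * a + (2 * real r + 2) ^ 2"
      by (simp add: C_def a_def algebra_simps)
    also have "\<dots> \<le> (6 * x) * a + (8 * x) ^ 2"
      using r3 x by (intro add_mono mult_right_mono power_mono) (auto simp: a_def)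
    also have "\<dots> \<le> 65 * x ^ 2" using elim by (simp add: x_def power2_eq_square)
    finally have C: "real C \<le> 65 * x ^ 2" .
    have "real D = real C * (2 * real r + 1)" by (simp add: D_def algebra_simps)
    also have "\<dots> \<le> 65 * x ^ 2 * (7 * x)" using C r3 x by (intro mult_mono) auto
    also have "\<dots> = 455 * x ^ 3" by (simp add: power2_eq_square power3_eq_cube)
    finally have D: "real D \<le> 455 * x ^ 3" .
    have x3: "0 < x ^ 3" using x by simp
    have "\<delta> * real n / (455 * x ^ 3) \<le> \<delta> * real n / D"
      using D D1 \<delta> n x by (intro divide_left_mono mult_pos_pos) auto
    also have "\<dots> \<le> real b + 1" using \<delta> by (simp add: b_def)
    finally have bl: "\<beta> * real n / x ^ 3 \<le> real b" using elim by (simp add: x_def)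
    have "1 \<le> real b" using elim(6) bl unfolding x_def by linarith
    then have b1: "1 \<le> b" by simp
    have bu: "real b \<le> \<delta> * real n / D" using \<delta> by (simp add: b_def)
    also have "\<dots> \<le> real n / 1" using \<delta> D1 by (intro frac_le) (auto simp: mult_left_le_one_le)
    finally have bn: "b \<le> n" by simp
    have nKb: "n \<le> K * b"
      using dividend_less_times_div[of b n] b1 by (simp add: K_def mult.commute)
    have K2: "2 \<le> K" using b1 bn by (simp add: K_def div_greater_zero_iff Suc_le_eq)
    have nK: "n < K ^ Suc r"
    proof -
      have "n < 2 ^ r" by (rule r2)
      also have "\<dots> \<le> K ^ r" using K2 by (intro power_mono) auto
      also have "\<dots> \<le> K ^ Suc r" using K2 by (intro power_increasing) auto
      finally show ?thesis .
    qed
    have KU: "real K \<le> x ^ 3 / \<beta> + 1"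
    proof -
      have "real (n div b) \<le> real n / real b" by (rule of_nat_div_le_of_nat)
      also have "\<dots> \<le> real n / (\<beta> * real n / x ^ 3)"
        using bl b1 \<beta> n x3 by (intro divide_left_mono) auto
      also have "\<dots> = x ^ 3 / \<beta>" using n by simp
      finally show ?thesis by (simp add: K_def)
    qed
    have pM: "M * (real n powr (- 1 / real d) * x ^ 5) \<le> p n"
      using elim(1) M p[of n] x unfolding d(2) x_def by (simp add: field_simps)
    have pow1: "1 \<le> x ^ k" for k using x by (intro one_le_power) auto
    \<comment> \<open>As d \<ge> 2, \<open>p n\<close> is at least the inverse square root of n. For
      \<open>small\<close> this is enough, because powers of n are to spare there.\<close>
    have plow: "real n powr (- 1 / 2) \<le> p n"
    proof -
      have "real n powr (- 1 / 2) \<le> real n powr (- 1 / real d)"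
        using n d by (intro powr_mono) (auto simp: field_simps)
      also have "\<dots> = 1 * (real n powr (- 1 / real d) * 1)" by simp
      also have "\<dots> \<le> M * (real n powr (- 1 / real d) * x ^ 5)"
        using M(1) pow1[of 5] by (intro mult_mono mult_left_mono) auto
      finally show ?thesis using pM by linarith
    qed
    have p0: "0 < p n" using plow n by (smt (verit) powr_gt_zero of_nat_0_le_iff)
    \<comment> \<open>Here the exponent 5 enters: the \<open>d\<close>-th power of log^5 n is at
      least log^10 n, with equality for \<open>\<Delta>\<close> = 3. In \<open>large\<close> it is
      spent as log n for the piece length, log^6 n for \<open>c\<close> and log^3 n for the
      reserves.\<close>
    have pd: "M * x ^ 10 / real n \<le> p n ^ d"
    proof -
      have "M * x ^ 10 / real n \<le> M ^ d * x ^ (5 * d) / real n"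
        using M x d by (intro divide_right_mono mult_mono self_le_power power_increasing) auto
      also have "\<dots> = (M * (real n powr (- 1 / real d) * x ^ 5)) ^ d"
      proof -
        have "(real n powr (- 1 / real d)) ^ d = real n powr (- 1)"
          using n d by (simp add: powr_power)
        then have "(real n powr (- 1 / real d)) ^ d = 1 / real n" using n by (simp add: powr_minus_divide)
        then show ?thesis unfolding power_mult_distrib power_mult by simp
      qed
      also have "\<dots> \<le> p n ^ d" using pM M x by (intro power_mono) auto
      finally show ?thesis .
    qed
    have large: "6 * (2 * r + 2) * x ^ 6 \<le> b * p n ^ (\<Delta> - 1)"
    proof -
      have "6 * (2 * r + 2) * x ^ 6 \<le> 6 * (8 * x) * x ^ 6"
        using L x by (intro mult_right_mono) auto
      also have "\<dots> = 48 * x ^ 7" by (simp add: power_numeral_reduce)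
      also have "\<dots> \<le> \<beta> * M * x ^ 7" using \<beta> x by (intro mult_right_mono) (auto simp: M_def field_simps)
      also have "\<dots> = \<beta> * real n / x ^ 3 * (M * x ^ 10 / real n)"
        using n x by (simp add: field_simps power_numeral_reduce)
      also have "\<dots> \<le> real b * p n ^ d" using bl pd M x by (intro mult_mono) auto
      finally show ?thesis by (simp add: d_def)
    qed
    define B0 where "B0 = \<beta> * real n / x ^ 3"
    define P0 where "P0 = real n powr (- 1 / 2)"
    have B0: "0 < B0" "B0 \<le> real b" using bl \<beta> n x3 by (auto simp: B0_def)
    have P0: "0 < P0" "P0 \<le> p n" using plow n by (auto simp: P0_def)
    have small: "2 * x ^ 6 * n * (3 * ((2 * r + 2)\<^sup>2 / (b\<^sup>2 * p n) + (2 * r + 2) ^ 3 / (b * p n) ^ 3)) \<le> 1"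
    proof -
      have "real ((2 * r + 2)\<^sup>2) / (b\<^sup>2 * p n) \<le> (8 * x)\<^sup>2 / (B0\<^sup>2 * P0)"
        unfolding of_nat_power using L B0 P0 x by (intro frac_le mult_mono power_mono mult_pos_pos) auto
      moreover have "real ((2 * r + 2) ^ 3) / (b * p n) ^ 3 \<le> (8 * x) ^ 3 / (B0 * P0) ^ 3"
        unfolding of_nat_power using L B0 P0 x by (intro frac_le mult_mono power_mono mult_pos_pos zero_less_power) auto
      ultimately have "2 * x ^ 6 * n * (3 * ((2 * r + 2)\<^sup>2 / (b\<^sup>2 * p n) + (2 * r + 2) ^ 3 / (b * p n) ^ 3))
          \<le> 2 * x ^ 6 * n * (3 * ((8 * x)\<^sup>2 / (B0\<^sup>2 * P0) + (8 * x) ^ 3 / (B0 * P0) ^ 3))"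
        using x by (intro mult_left_mono add_mono) auto
      also have "\<dots> \<le> 1" using elim(8) unfolding B0_def P0_def x_def by simp
      finally show ?thesis .
    qed
    have entropy: "((2 * r + 2) * (K + 2 * (\<Delta> - 1) + 4) + 3) * ln (real n + 1) \<le> x ^ 6 / 2"
    proof -
      have "real ((2 * r + 2) * (K + 2 * (\<Delta> - 1) + 4) + 3) = real (2 * r + 2) * (real K + 2 * d + 4) + 3"
        unfolding d_def of_nat_add of_nat_mult by simp
      also have "\<dots> \<le> 8 * x * (x ^ 3 / \<beta> + 1 + 2 * d + 4) + 3"
        using L KU x by (intro add_mono mult_mono) auto
      finally have "((2 * r + 2) * (K + 2 * (\<Delta> - 1) + 4) + 3) * ln (real n + 1)
          \<le> (8 * x * (x ^ 3 / \<beta> + 1 + 2 * d + 4) + 3) * ln (real n + 1)"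
        by (intro mult_right_mono) auto
      also have "\<dots> \<le> x ^ 6 / 2" using elim(7) unfolding x_def by simp
      finally show ?thesis .
    qed
    have "C * (b + r * (2 * b)) = D * b" by (simp add: D_def algebra_simps)
    then have "real (C * (b + r * (2 * b))) = real D * real b" by simp
    also have "\<dots> \<le> \<delta> * n" using bu D1 by (simp add: field_simps)
    also have "\<dots> \<le> \<epsilon> * n" using \<delta> by (intro mult_right_mono) auto
    finally have space: "real (C * (b + r * (2 * b))) \<le> \<epsilon> * n" .
    show ?case
      using r2 b1 nKb nK K2 Ln p0 pow1[of 6] large small entropy space unfolding C_def
      by (intro exI[of _ r] exI[of _ b] exI[of _ K] exI[of _ "x ^ 6"] conjI) auto
  qed
qed

theorem theorem1p1:
  fixes \<epsilon> :: real and \<Delta> :: nat and p :: "nat \<Rightarrow> real"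
  assumes "\<epsilon> > 0"
    and "\<Delta> \<ge> 3"
    and "\<And>n. 0 \<le> p n \<and> p n \<le> 1"
    and "(\<lambda>n. real n powr (- 1 / (real \<Delta> - 1)) * ln (real n) ^ 5) \<in> o(p)"
  shows "(\<lambda>n. measure_pmf.prob (binomial_random_graph n (p n))
            {G. universal_for G (bounded_degree_graphs ((1 - \<epsilon>) * real n) \<Delta>)})
         \<longlonglongrightarrow> 1"
proof (rule tendsto_sandwich[where h = "\<lambda>_. 1"])
  let ?P = "\<lambda>n. measure_pmf.prob (binomial_random_graph n (p n))
            {G. universal_for G (bounded_degree_graphs ((1 - \<epsilon>) * real n) \<Delta>)}"
  show "\<forall>\<^sub>F n in sequentially. 1 - 1 / (real n + 1) \<le> ?P n"
    using eventually_parameters[OF assms]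
  proof eventually_elim
    case (elim n)
    then obtain r b K :: nat and c :: real where
      par: "n < 2 ^ r" "1 \<le> b" "n \<le> K * b" "n < K ^ Suc r" "1 \<le> K" "2 * r + 2 \<le> n" "0 < p n" "1 \<le> c"
      "6 * (2 * r + 2) * c \<le> b * p n ^ (\<Delta> - 1)"
      "2 * c * n * (3 * ((2 * r + 2)\<^sup>2 / (b\<^sup>2 * p n) + (2 * r + 2) ^ 3 / (b * p n) ^ 3)) \<le> 1"
      "((2 * r + 2) * (K + 2 * (\<Delta> - 1) + 4) + 3) * ln (real n + 1) \<le> c / 2"
      "real (((r + 3) * (\<Delta> * \<Delta> + \<Delta> + 1) + (2 * r + 2) ^ 2) * (b + r * (2 * b))) \<le> \<epsilon> * n"
      by blast
    let ?M = "bits (vertex_pairs {..<n}) (p n)"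
    let ?X = "{X. expanding n (2 * r + 2) (\<Delta> - 1) b K X}"
    have "measure_pmf.prob ?M {X. \<not> expanding n (2 * r + 2) (\<Delta> - 1) b K X} \<le> 1 / (real n + 1)"
      using par assms by (intro prob_not_expanding[of "p n" c]) auto
    moreover have "measure_pmf.prob ?M {X. \<not> expanding n (2 * r + 2) (\<Delta> - 1) b K X} = 1 - measure_pmf.prob ?M ?X"
      using measure_pmf.prob_compl[of ?X ?M] by (simp add: Compl_eq_Diff_UNIV[symmetric] Collect_neg_eq)
    ultimately have "1 - 1 / (real n + 1) \<le> measure_pmf.prob ?M ?X" by simp
    also have "\<dots> \<le> measure_pmf.prob ?M
        {X. universal_for ({..<n}, {e\<in>vertex_pairs {..<n}. X e}) (bounded_degree_graphs ((1 - \<epsilon>) * real n) \<Delta>)}"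
      using par assms by (intro measure_pmf.finite_measure_mono) (auto intro!: universal_if_expanding[of n r \<Delta> b K])
    also have "\<dots> = ?P n"
      by (simp add: binomial_random_graph_def vimage_def)
    finally show ?case .
  qed
  show "(\<lambda>n. 1 - 1 / (real n + 1)) \<longlonglongrightarrow> 1" by real_asymp
qed auto

end
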